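(* Let $\alpha>0$ be fixed. Then there exists an exponent $p^\star=p^\star(\alpha)$ such that for every $p>p^\star(\alpha)$ the problem $-\Delta u=|x|^\alpha|u|^{p-1}u$ in $B$, $u=0$ on $\partial B$, admits at least $\lceil\alpha/2\rceil$ distinct positive nonradial solutions.
   Context: $B$ is the open unit disc of $\mathbb R^2$; $\lceil\cdot\rceil$ is the ceiling function. *)

theory Defs
  imports "HOL-Analysis.Analysis"
begin

definition dpart :: "2 \<Rightarrow> (real^2 \<Rightarrow> real) \<Rightarrow> real^2 \<Rightarrow> real" where
  "dpart i f x = deriv (\<lambda>t. f (x + t *\<^sub>R axis i 1)) 0"

definition laplacian :: "(real^2 \<Rightarrow> real) \<Rightarrow> real^2 \<Rightarrow> real" where
  "laplacian f x = (\<Sum>i\<in>UNIV. dpart i (dpart i f) x)"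

definition C2_on :: "(real^2) set \<Rightarrow> (real^2 \<Rightarrow> real) \<Rightarrow> bool" where
  "C2_on S f \<longleftrightarrow> f differentiable_on S \<and> (\<forall>i. dpart i f differentiable_on S)
      \<and> (\<forall>i j. continuous_on S (dpart j (dpart i f)))"

definition henon_pos_solution :: "real \<Rightarrow> real \<Rightarrow> (real^2 \<Rightarrow> real) \<Rightarrow> bool" where
  "henon_pos_solution \<alpha> p u \<longleftrightarrow>
     C2_on (ball 0 1) u \<and> continuous_on (cball 0 1) u \<and>
     (\<forall>x\<in>sphere 0 1. u x = 0) \<and>
     (\<forall>x\<in>ball 0 1. u x > 0) \<and>
     (\<forall>x\<in>ball 0 1. - laplacian u x = norm x powr \<alpha> * \<bar>u x\<bar> powr (p - 1) * u x)"

definition radial_on :: "(real^2) set \<Rightarrow> (real^2 \<Rightarrow> real) \<Rightarrow> bool" where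
  "radial_on S u \<longleftrightarrow> (\<exists>g::real \<Rightarrow> real. \<forall>x\<in>S. u x = g (norm x))"

definition rot :: "real \<Rightarrow> real^2 \<Rightarrow> real^2" where
  "rot \<theta> x = vector [cos \<theta> * x$1 - sin \<theta> * x$2, sin \<theta> * x$1 + cos \<theta> * x$2]"

definition rot_equiv :: "(real^2 \<Rightarrow> real) \<Rightarrow> (real^2 \<Rightarrow> real) \<Rightarrow> bool" where
  "rot_equiv u v \<longleftrightarrow> (\<exists>\<theta>. \<forall>x\<in>cball 0 1. u (rot \<theta> x) = v x)"

end

(* Solutions are fixed points u = G(|x|^a u^p) of the Green operator G of the disc. Maximizing the
   quadratic form of G on densities h with int |x|^b h^(1+1/p) <= 1 yields, for every weight
   exponent b >= 0, a positive solution; write M_b for the maximum. The covering z -> z^n turns the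
   maximizer for b_n = (a+2)/n - 2 into a solution u_n for the exponent a that is invariant under
   the rotation by 2 pi/n, and int |x|^a u_n^(p+1) is the (p+1)/(p-1)-th power of
   n^((p+3)/(p+1)) / M_(b_n).  Since c^(1/(p+1)) M_0 <= M_b <= M_0 (for the lower bound transplant
   a competitor into a small disc away from the origin), these numbers are pairwise different for
   large p, so no two of the u_n agree up to a rotation. For radial competitors the covering
   argument can be run with a rational exponent (k+1)/k <= (b+2)/2 instead of n, which lowers the
   energy by a factor bounded away from 1 as p grows; hence for b_n > 0, that is n <= ceiling(a/2),
   the maximizer is not radial. *)

theory Submission
  imports Defs "HOL-Complex_Analysis.Complex_Analysis"
begin

no_notation fps_nth (infixl \<open>$\<close> 75)

section \<open>Polar coordinates\<close>

text \<open>Densities and the explicit Green kernel keep every object a bounded Borel function: no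
  Sobolev space, weak derivative or trace enters, and classical regularity is recovered only at the
  end from the integral equation. What has to be supplied in exchange is positivity of the quadratic
  form of G, because the existence of maximizers rests on its Cauchy-Schwarz inequality; it is read
  off from an explicit expansion of G. Points are complex numbers because z -> z^n and G are
  algebraic there: the behaviour of the energy under coverings is the factorization of x^n - y^n,
  used twice inside the logarithm. No asymptotics of M_b in p are computed. All comparisons concern
  (p+1)-th powers: M_0^(p+1) <= L M_b^(p+1) with L independent of p, whereas radial symmetry, or
  coincidence of two solutions up to rotation, would force R^(p+3) <= L for a fixed R > 1. Hence the
  threshold ln L / ln R. Transplantation loses so little because the area factor of the small disc
  enters the energy squared and the mass once, and rescaling to unit mass nearly cancels it.\<close>

lemma measurable_vector2: "(\<lambda>(r::real,t::real). vector [r,t] :: real^2) \<in> borel_measurable (lborel \<Otimes>\<^sub>M lborel)"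
proof -
  have "(\<lambda>(r::real,t::real). vector [r,t] :: real^2) = (\<lambda>p. fst p *\<^sub>R axis 1 1 + snd p *\<^sub>R axis 2 1)"
    by (auto simp: fun_eq_iff vec_eq_iff forall_2 axis_def)
  then show ?thesis
    by (simp add: lborel_prod) (intro borel_measurable_continuous_onI continuous_intros)
qed

text \<open>The change of variables is carried out in \<open>real^2\<close>, while iterated
  integrals belong to the product measure; this identity connects the two.\<close>

lemma lborel_vec2: "(lborel :: (real^2) measure) = distr (lborel \<Otimes>\<^sub>M lborel) borel (\<lambda>(r,t). vector [r,t])"
proof (rule lborel_eqI)
  note m = measurable_vector2
  fix l u :: "real^2" assume lu: "\<And>b. b \<in> Basis \<Longrightarrow> l \<bullet> b \<le> u \<bullet> b"
  have l1: "l$i \<le> u$i" for i using lu[of "axis i 1"] by (auto simp: Basis_vec_def inner_axis)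
  have "(\<lambda>(r,t). vector [r,t] :: real^2) -` box l u = box (l$1) (u$1) \<times> box (l$2) (u$2)"
    by (auto simp: mem_box_cart forall_2)
  then show "emeasure (distr (lborel \<Otimes>\<^sub>M lborel) borel (\<lambda>(r,t). vector [r,t])) (box l u) = ennreal (\<Prod>b\<in>Basis. (u - l) \<bullet> b)"
    using m l1
    by (simp add: emeasure_distr space_pair_measure lborel.emeasure_pair_measure_Times ennreal_mult Basis_vec_def UNIV_2 inner_axis axis_eq_axis mult.commute)
qed simp

text \<open>Injectivity of polar coordinates forces an open angle interval, and the price is the
  slit along the nonnegative real axis. The slit is a null set and disappears in
  \<open>polar_emeasure_box\<close>.\<close>

lemma polar_image:
  fixes B :: "complex set"
  shows "(\<lambda>v::real^2. vector [v$1 * cos (v$2), v$1 * sin (v$2)]) ` {v. 0 < v$1 \<and> 0 < v$2 \<and> v$2 < 2*pi \<and> rcis (v$1) (v$2) \<in> B}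
    = {w::real^2. Complex (w$1) (w$2) \<in> B - {z. Im z = 0 \<and> 0 \<le> Re z}}"  (is "?g ` ?S = ?R")
proof (intro set_eqI iffI)
  fix w assume "w \<in> ?g ` ?S"
  then obtain v where v: "0 < v$1" "0 < v$2" "v$2 < 2*pi" "rcis (v$1) (v$2) \<in> B" "w = ?g v" by auto
  have "Complex (w$1) (w$2) = rcis (v$1) (v$2)" using v by (simp add: complex_eq_iff)
  moreover have "cos (v$2) < 1" if "sin (v$2) = 0"
  proof -
    have "v$2 = pi" using that v(2,3) sin_eq_0_pi[of "v$2 - pi"] by (smt (verit) pi_gt_zero sin_minus_pi)
    then show ?thesis by simp
  qed
  moreover have "\<bar>cos (v$2)\<bar> = 1" if "sin (v$2) = 0" using that sin_zero_abs_cos_one by blast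
  ultimately have "\<not> (Im (rcis (v$1) (v$2)) = 0 \<and> 0 \<le> Re (rcis (v$1) (v$2)))"
    using v(1) by (auto simp: zero_le_mult_iff abs_if split: if_splits)
  then show "w \<in> ?R" using v(4) \<open>Complex (w$1) (w$2) = rcis (v$1) (v$2)\<close>
    by (metis (mono_tags, lifting) Diff_iff mem_Collect_eq)
next
  fix w assume w: "w \<in> ?R"
  define z where "z = Complex (w$1) (w$2)"
  define v :: "real^2" where "v = vector [cmod z, Arg2pi z]"
  have zn: "z \<noteq> 0" using w by (auto simp: z_def complex_eq_iff)
  have "Arg2pi z \<noteq> 0"
  proof
    assume "Arg2pi z = 0"
    then have "z = of_real (cmod z)" using Arg2pi_eq[of z] by simp
    then have "Im z = 0 \<and> 0 \<le> Re z" by (metis Im_complex_of_real Re_complex_of_real norm_ge_zero)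
    then show False using w by (simp add: z_def)
  qed
  then have "0 < Arg2pi z" using Arg2pi_ge_0[of z] by simp
  moreover have "rcis (cmod z) (Arg2pi z) = z" using Arg2pi_eq[of z] by (simp add: rcis_def cis_conv_exp)
  moreover have "z \<in> B" using w by (simp add: z_def)
  ultimately have "v \<in> ?S" using zn Arg2pi_lt_2pi[of z] by (simp add: v_def)
  moreover have "w = ?g v"
    using cos_Arg2pi[of z] sin_Arg2pi[of z] by (simp add: vec_eq_iff forall_2 v_def) (simp add: z_def)
  ultimately show "w \<in> ?g ` ?S" by blast
qed

lemma polar_emeasure_box:
  fixes l u :: complex
  assumes "Re l \<le> Re u" "Im l \<le> Im u"
  defines "S \<equiv> {v::real^2. 0 < v$1 \<and> 0 < v$2 \<and> v$2 < 2*pi \<and> rcis (v$1) (v$2) \<in> box l u}"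
  shows "(\<integral>\<^sup>+v. ennreal (v$1) * indicator S v \<partial>lborel) = ennreal ((Re u - Re l) * (Im u - Im l))"
proof -
  let ?g = "\<lambda>v::real^2. vector [v$1 * cos (v$2), v$1 * sin (v$2)] :: real^2"
  define g' where "g' = (\<lambda>v::real^2. \<lambda>h::real^2. vector [h$1 * cos (v$2) - v$1 * sin (v$2) * h$2, h$1 * sin (v$2) + v$1 * cos (v$2) * h$2] :: real^2)"
  have d: "(?g has_derivative g' v) (at v within A)" for v A
  proof -
    have e: "?g = (\<lambda>v. (v$1 * cos (v$2)) *\<^sub>R axis 1 1 + (v$1 * sin (v$2)) *\<^sub>R axis 2 1)"
      "g' v = (\<lambda>h. (h$1 * cos (v$2) - v$1 * sin (v$2) * h$2) *\<^sub>R axis 1 1 + (h$1 * sin (v$2) + v$1 * cos (v$2) * h$2) *\<^sub>R axis 2 1)"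
      by (auto simp: fun_eq_iff vec_eq_iff forall_2 axis_def g'_def)
    have n: "((\<lambda>v::real^2. v$i) has_derivative (\<lambda>h. h$i)) (at v within A)" for i
      by (rule bounded_linear_imp_has_derivative[OF bounded_linear_vec_nth])
    show ?thesis unfolding e
      by (rule derivative_eq_intros n refl)+ (auto simp: algebra_simps fun_eq_iff)
  qed
  have det: "det (matrix (g' v)) = v$1" for v
  proof -
    have "det (matrix (g' v)) = v$1 * ((cos (v$2))\<^sup>2 + (sin (v$2))\<^sup>2)"
      by (simp add: det_2 matrix_def g'_def axis_def power2_eq_square algebra_simps del: sin_cos_squared_add sin_cos_squared_add2 sin_cos_squared_add3)
    then show ?thesis by simp
  qed
  have inj: "inj_on ?g S"
  proof (rule inj_onI)
    fix v w assume v: "v \<in> S" and w: "w \<in> S" and eq: "?g v = ?g w"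
    have "rcis (v$1) (v$2) = rcis (w$1) (w$2)" using eq by (auto simp: complex_eq_iff vec_eq_iff forall_2)
    moreover have "v$1 = cmod (rcis (v$1) (v$2))" "v$2 = Arg2pi (rcis (v$1) (v$2))" if "v \<in> S" for v :: "real^2"
      using that Arg2pi_unique[of "v$1" "v$2"] by (auto simp: S_def rcis_def cis_conv_exp norm_mult)
    ultimately have "v$1 = w$1" "v$2 = w$2" using v w by metis+
    then show "v = w" by (simp add: vec_eq_iff forall_2)
  qed
  have oS: "open S"
  proof -
    have "continuous_on UNIV (\<lambda>v::real^2. rcis (v$1) (v$2))"
      unfolding rcis_def by (intro continuous_intros)
    then have "open ((\<lambda>v::real^2. rcis (v$1) (v$2)) -` box l u)"
      by (rule open_vimage[OF open_box, unfolded continuous_on_eq_continuous_at[OF open_UNIV]])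
    moreover have "open {v::real^2. 0 < v$i}" "open {v::real^2. v$i < 2*pi}" for i
      by (intro open_Collect_less continuous_intros)+
    moreover have "S = {v. 0 < v$1} \<inter> {v. 0 < v$2} \<inter> {v. v$2 < 2*pi} \<inter> (\<lambda>v::real^2. rcis (v$1) (v$2)) -` box l u"
      by (auto simp: S_def)
    ultimately show ?thesis by (simp add: open_Int)
  qed
  define l' :: "real^2" where "l' = vector [Re l, Im l]"
  define u' :: "real^2" where "u' = vector [Re u, Im u]"
  have im: "?g ` S = box l' u' - {w. w$2 = 0 \<and> 0 \<le> w$1}"
    unfolding S_def polar_image
    by (auto simp: l'_def u'_def mem_box_cart forall_2 in_box_complex_iff)
  have neg: "negligible {w::real^2. w$2 = 0 \<and> 0 \<le> w$1}"
    by (rule negligible_subset[OF negligible_standard_hyperplane_cart[of 2]]) auto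
  have meas: "?g ` S \<in> lmeasurable" unfolding im
    using neg by (intro fmeasurable_Diff lmeasurable_box negligible_imp_sets)
  have ms: "measure lebesgue (?g ` S) = (Re u - Re l) * (Im u - Im l)"
  proof -
    have "measure lebesgue (?g ` S) = measure lebesgue (box l' u')"
      unfolding im using neg by (intro measure_Diff_null_set) (auto simp: negligible_iff_null_sets)
    also have "\<dots> = (Re u - Re l) * (Im u - Im l)"
      using assms by (auto simp: measure_lborel_box_eq Basis_vec_def UNIV_2 inner_axis axis_eq_axis l'_def u'_def)
    finally show ?thesis .
  qed
  have "((\<lambda>x. \<bar>det (matrix (g' x))\<bar>) has_integral (Re u - Re l) * (Im u - Im l)) S"
    by (rule has_measure_differentiable_image[OF _ d inj, THEN iffD1]) (use meas ms borel_open[OF oS] in \<open>simp_all add: sets_completionI_sets\<close>)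
  then have "((\<lambda>v. v$1) has_integral (Re u - Re l) * (Im u - Im l)) S"
    by (rule has_integral_eq[rotated]) (simp add: det S_def)
  then show ?thesis by (rule nn_integral_has_integral_lebesgue'[rotated]) (simp add: S_def)
qed

lemma measurable_rcis [measurable]: "(\<lambda>(r,t). rcis r t) \<in> borel_measurable (lborel \<Otimes>\<^sub>M lborel)"
  by (auto simp: lborel_prod case_prod_beta rcis_def intro!: borel_measurable_continuous_onI continuous_intros)

text \<open>Boxes determine Lebesgue measure, so \<open>polar_emeasure_box\<close> is all that is
  needed. In this pushforward form polar coordinates apply to every nonnegative Borel function,
  without any integrability condition.\<close>

lemma lborel_polar:
  "(lborel :: complex measure) =
     distr (density (lborel \<Otimes>\<^sub>M lborel) (\<lambda>(r,t). ennreal r * indicator ({0<..} \<times> {0<..<2*pi}) (r,t))) borel (\<lambda>(r,t). rcis r t)"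
proof (rule lborel_eqI)
  fix l u :: complex assume lu: "\<And>b. b \<in> Basis \<Longrightarrow> l \<bullet> b \<le> u \<bullet> b"
  have lu': "Re l \<le> Re u" "Im l \<le> Im u" using lu[of 1] lu[of \<i>] by (auto simp: Basis_complex_def)
  let ?f = "\<lambda>(r::real,t::real). ennreal r * indicator ({0<..} \<times> {0<..<2*pi}) (r,t)"
  have mf [measurable]: "?f \<in> borel_measurable (lborel \<Otimes>\<^sub>M lborel)" by measurable
  have mv [measurable]: "(\<lambda>(r::real,t::real). vector [r,t] :: real^2) \<in> borel_measurable (lborel \<Otimes>\<^sub>M lborel)"
    by (rule measurable_vector2)
  let ?S = "{v::real^2. 0 < v$1 \<and> 0 < v$2 \<and> v$2 < 2*pi \<and> rcis (v$1) (v$2) \<in> box l u}"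
  have mS: "(\<lambda>v. ennreal (v$1) * indicator ?S v) \<in> borel_measurable borel"
  proof -
    have [measurable]: "(\<lambda>v::real^2. v$i) \<in> borel_measurable borel" for i
      by (intro borel_measurable_continuous_onI continuous_intros)
    have [measurable]: "(\<lambda>v::real^2. rcis (v$1) (v$2)) \<in> borel_measurable borel"
      unfolding rcis_def by (intro borel_measurable_continuous_onI continuous_intros)
    show ?thesis by measurable
  qed
  have "emeasure (distr (density (lborel \<Otimes>\<^sub>M lborel) ?f) borel (\<lambda>(r,t). rcis r t)) (box l u) =
      (\<integral>\<^sup>+x. ?f x * indicator ((\<lambda>(r,t). rcis r t) -` box l u) x \<partial>(lborel \<Otimes>\<^sub>M lborel))"
  proof -
    have "(\<lambda>(r,t). rcis r t) -` box l u \<in> sets (lborel \<Otimes>\<^sub>M lborel)"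
      using measurable_sets[OF measurable_rcis, of "box l u"] by (simp add: space_pair_measure)
    then show ?thesis
      by (subst emeasure_distr) (simp_all add: emeasure_density space_pair_measure)
  qed
  also have "\<dots> = (\<integral>\<^sup>+x. (\<lambda>v. ennreal (v$1) * indicator ?S v) ((\<lambda>(r,t). vector [r,t]) x) \<partial>(lborel \<Otimes>\<^sub>M lborel))"
    by (rule nn_integral_cong) (auto simp: indicator_def split: if_splits)
  also have "\<dots> = (\<integral>\<^sup>+v. ennreal (v$1) * indicator ?S v \<partial>lborel)"
    by (subst lborel_vec2, subst nn_integral_distr[OF mv]) (use mS in simp_all)
  also have "\<dots> = ennreal ((Re u - Re l) * (Im u - Im l))" by (rule polar_emeasure_box[OF lu'])
  also have "\<dots> = (\<Prod>b\<in>Basis. (u - l) \<bullet> b)" by (simp add: Basis_complex_def)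
  finally show "emeasure (distr (density (lborel \<Otimes>\<^sub>M lborel) ?f) borel (\<lambda>(r,t). rcis r t)) (box l u) = \<dots>" .
qed simp

lemma nn_integral_polar:
  fixes F :: "complex \<Rightarrow> ennreal"
  assumes [measurable]: "F \<in> borel_measurable borel"
  shows "(\<integral>\<^sup>+z. F z \<partial>lborel) =
    (\<integral>\<^sup>+r. (\<integral>\<^sup>+t. F (rcis r t) * indicator {0<..<2*pi} t \<partial>lborel) * (ennreal r * indicator {0<..} r) \<partial>lborel)"
proof -
  have [measurable]: "(\<lambda>p. rcis (fst p) (snd p)) \<in> borel_measurable (lborel \<Otimes>\<^sub>M lborel)"
    using measurable_rcis by (simp add: case_prod_beta)
  have [measurable]: "(\<lambda>t. rcis r t) \<in> borel_measurable lborel" for r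
    unfolding rcis_def by (auto intro!: borel_measurable_continuous_onI continuous_intros)
  have "(\<integral>\<^sup>+z. F z \<partial>lborel) = (\<integral>\<^sup>+p. (ennreal (fst p) * indicator ({0<..} \<times> {0<..<2*pi}) p) * F (rcis (fst p) (snd p)) \<partial>(lborel \<Otimes>\<^sub>M lborel))"
    by (subst lborel_polar, subst nn_integral_distr, simp, simp, subst nn_integral_density) (auto simp: case_prod_beta)
  also have "\<dots> = (\<integral>\<^sup>+r. \<integral>\<^sup>+t. (ennreal r * indicator ({0<..} \<times> {0<..<2*pi}) (r,t)) * F (rcis r t) \<partial>lborel \<partial>lborel)"
    by (subst lborel.nn_integral_fst[symmetric]) (auto)
  also have "\<dots> = (\<integral>\<^sup>+r. (\<integral>\<^sup>+t. F (rcis r t) * indicator {0<..<2*pi} t \<partial>lborel) * (ennreal r * indicator {0<..} r) \<partial>lborel)"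
    by (rule nn_integral_cong, subst nn_integral_multc[symmetric]) (auto simp: indicator_def mult.commute intro!: nn_integral_cong)
  finally show ?thesis .
qed

section \<open>Weighted measures on the disc\<close>

lemma nn_integral_Ioo_split:
  fixes \<phi> :: "real \<Rightarrow> ennreal"
  assumes [measurable]: "\<phi> \<in> borel_measurable borel" and "a \<le> b" "b \<le> c"
  shows "(\<integral>\<^sup>+t. \<phi> t * indicator {a<..<c} t \<partial>lborel) =
    (\<integral>\<^sup>+t. \<phi> t * indicator {a<..<b} t \<partial>lborel) + (\<integral>\<^sup>+t. \<phi> t * indicator {b<..<c} t \<partial>lborel)"
proof -
  have "(\<integral>\<^sup>+t. \<phi> t * indicator {a<..<c} t \<partial>lborel) = (\<integral>\<^sup>+t. \<phi> t * indicator {a<..<b} t + \<phi> t * indicator {b<..<c} t \<partial>lborel)"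
    using assms by (intro nn_integral_cong_AE eventually_mono[OF AE_lborel_singleton[of b]]) (auto simp: indicator_def)
  then show ?thesis by (simp add: nn_integral_add)
qed

lemma nn_integral_Ioo_shift:
  fixes \<phi> :: "real \<Rightarrow> ennreal"
  assumes [measurable]: "\<phi> \<in> borel_measurable borel"
  shows "(\<integral>\<^sup>+t. \<phi> (t + c) * indicator {a<..<b} t \<partial>lborel) = (\<integral>\<^sup>+t. \<phi> t * indicator {a+c<..<b+c} t \<partial>lborel)"
  by (subst nn_integral_real_affine[of "\<lambda>t. \<phi> t * indicator {a+c<..<b+c} t" 1 c])
    (auto simp: indicator_def add.commute intro!: nn_integral_cong)

lemma nn_integral_periodic_shift:
  fixes \<phi> :: "real \<Rightarrow> ennreal"
  assumes [measurable]: "\<phi> \<in> borel_measurable borel" and per: "\<And>t. \<phi> (t + T) = \<phi> t" and c: "0 \<le> c" "c \<le> T"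
  shows "(\<integral>\<^sup>+t. \<phi> (t + c) * indicator {0<..<T} t \<partial>lborel) = (\<integral>\<^sup>+t. \<phi> t * indicator {0<..<T} t \<partial>lborel)"
proof -
  have "(\<integral>\<^sup>+t. \<phi> (t + c) * indicator {0<..<T} t \<partial>lborel) = (\<integral>\<^sup>+t. \<phi> t * indicator {c<..<T+c} t \<partial>lborel)"
    by (simp add: nn_integral_Ioo_shift)
  also have "\<dots> = (\<integral>\<^sup>+t. \<phi> t * indicator {c<..<T} t \<partial>lborel) + (\<integral>\<^sup>+t. \<phi> t * indicator {0+T<..<c+T} t \<partial>lborel)"
    using c nn_integral_Ioo_split[of \<phi> c T "T+c"] by (simp add: add.commute)
  also have "(\<integral>\<^sup>+t. \<phi> t * indicator {0+T<..<c+T} t \<partial>lborel) = (\<integral>\<^sup>+t. \<phi> t * indicator {0<..<c} t \<partial>lborel)"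
    by (subst nn_integral_Ioo_shift[symmetric]) (simp_all add: per)
  finally show ?thesis using c nn_integral_Ioo_split[of \<phi> 0 c T] by (simp add: add.commute)
qed

text \<open>Angular half of the covering map: while t runs through one period, m t runs through m of
  them, and the factor m cancels against the Jacobian of the dilation.\<close>

lemma nn_integral_periodic_scale:
  fixes \<phi> :: "real \<Rightarrow> ennreal"
  assumes [measurable]: "\<phi> \<in> borel_measurable borel" and per: "\<And>t. \<phi> (t + T) = \<phi> t" and T: "0 < T" and m: "m > (0::nat)"
  shows "(\<integral>\<^sup>+t. \<phi> (real m * t) * indicator {0<..<T} t \<partial>lborel) = (\<integral>\<^sup>+t. \<phi> t * indicator {0<..<T} t \<partial>lborel)"
proof -
  let ?J = "\<integral>\<^sup>+t. \<phi> t * indicator {0<..<T} t \<partial>lborel"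
  have per': "\<phi> (t + real k * T) = \<phi> t" for t and k :: nat
  proof (induction k)
    case (Suc k)
    have "\<phi> (t + real (Suc k) * T) = \<phi> ((t + real k * T) + T)" by (simp add: algebra_simps)
    then show ?case using Suc by (simp only: per)
  qed simp
  have "(\<integral>\<^sup>+t. \<phi> t * indicator {0<..<real k * T} t \<partial>lborel) = of_nat k * ?J" for k
  proof (induction k)
    case (Suc k)
    have "(\<integral>\<^sup>+t. \<phi> t * indicator {0<..<real (Suc k) * T} t \<partial>lborel) =
       (\<integral>\<^sup>+t. \<phi> t * indicator {0<..<real k * T} t \<partial>lborel) + (\<integral>\<^sup>+t. \<phi> t * indicator {0 + real k * T<..<T + real k * T} t \<partial>lborel)"
      using T nn_integral_Ioo_split[of \<phi> 0 "real k * T" "real (Suc k) * T"] by (simp add: algebra_simps)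
    also have "(\<integral>\<^sup>+t. \<phi> t * indicator {0 + real k * T<..<T + real k * T} t \<partial>lborel) = ?J"
      by (subst nn_integral_Ioo_shift[symmetric]) (simp_all add: per')
    finally show ?case using Suc by (simp add: algebra_simps)
  qed simp
  from this[of m] have "of_nat m * ?J = (\<integral>\<^sup>+t. \<phi> t * indicator {0<..<real m * T} t \<partial>lborel)" by simp
  also have "\<dots> = ennreal (real m) * (\<integral>\<^sup>+t. \<phi> (real m * t) * indicator {0<..<T} t \<partial>lborel)"
    using m by (subst nn_integral_real_affine[of _ "real m" 0]) (auto simp: indicator_def zero_less_mult_iff intro!: arg_cong[where f="(*) _"] nn_integral_cong)
  finally show ?thesis using m by (simp add: ennreal_mult_cancel_left ennreal_of_nat_eq_real_of_nat)
qed

lemma nn_integral_rotate: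
  fixes F :: "complex \<Rightarrow> ennreal"
  assumes [measurable]: "F \<in> borel_measurable borel" and c: "cmod c = 1"
  shows "(\<integral>\<^sup>+z. F (c * z) \<partial>lborel) = (\<integral>\<^sup>+z. F z \<partial>lborel)"
proof -
  define \<theta> where "\<theta> = Arg2pi c"
  have \<theta>: "0 \<le> \<theta>" "\<theta> \<le> 2*pi" "c = cis \<theta>"
    using Arg2pi_ge_0[of c] Arg2pi_lt_2pi[of c] Arg2pi_eq[of c] c by (auto simp: \<theta>_def cis_conv_exp)
  have [measurable]: "(\<lambda>t. rcis r t) \<in> borel_measurable borel" for r
    unfolding rcis_def by (intro borel_measurable_continuous_onI continuous_intros)
  have "(\<integral>\<^sup>+t. F (c * rcis r t) * indicator {0<..<2*pi} t \<partial>lborel) = (\<integral>\<^sup>+t. F (rcis r t) * indicator {0<..<2*pi} t \<partial>lborel)" for r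
  proof -
    have "F (c * rcis r t) = F (rcis r (t + \<theta>))" for t by (simp add: \<theta>(3) rcis_def cis_mult[symmetric] mult_ac)
    moreover have "rcis r (t + 2 * pi) = rcis r t" for t by (simp add: rcis_def cis_mult[symmetric])
    ultimately show ?thesis using \<theta> nn_integral_periodic_shift[of "\<lambda>t. F (rcis r t)" "2*pi" \<theta>] by simp
  qed
  then show ?thesis by (simp add: nn_integral_polar)
qed

text \<open>Since \<open>0 powr a = 0\<close> for every \<open>a\<close>, even for
  \<open>a = 0\<close>, the density vanishes at the origin; this explains the many steps that
  discard that point as a null set. Negative exponents are allowed because
  \<open>radial_energy_le\<close> may pass through one.\<close>

definition disc_measure :: "real \<Rightarrow> complex measure" where
  "disc_measure a = density lborel (\<lambda>z. ennreal (indicator (ball 0 1) z * norm z powr a))"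

lemma borel_measurable_norm_powr [measurable]: "(\<lambda>z::complex. norm z powr a) \<in> borel_measurable borel"
  by (rule powr_real_measurable) simp_all

lemma sets_ball_borel [measurable, simp]: "ball (c::complex) r \<in> sets borel"
  by simp

lemma measurable_disc_density [measurable]:
  "(\<lambda>z::complex. ennreal (indicator (ball 0 1) z * norm z powr a)) \<in> borel_measurable borel"
  by measurable

lemma sets_disc_measure [simp, measurable_cong]: "sets (disc_measure a) = sets borel"
  and space_disc_measure [simp]: "space (disc_measure a) = UNIV"
  unfolding disc_measure_def by simp_all

lemma nn_integral_disc_measure:
  assumes [measurable]: "f \<in> borel_measurable borel"
  shows "(\<integral>\<^sup>+z. f z \<partial>disc_measure a) = (\<integral>\<^sup>+z. ennreal (norm z powr a) * f z * indicator (ball 0 1) z \<partial>lborel)"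
  unfolding disc_measure_def
  by (subst nn_integral_density) (auto intro!: nn_integral_cong simp: indicator_def)

lemma AE_disc_measure: "AE z in disc_measure a. z \<in> ball 0 1"
  unfolding disc_measure_def by (subst AE_density) (auto simp: indicator_def)

lemma AE_disc_measure_neq: "AE z in disc_measure a. z \<noteq> x"
  unfolding disc_measure_def by (subst AE_density) (auto intro!: eventually_mono[OF AE_lborel_singleton[of x]])

text \<open>Radial half of the covering map. Substitution is applied to indicator functions only;
  the resulting equality of two measures extends it to every \<open>ennreal\<close>-valued
  integrand.\<close>

lemma nn_integral_power_substitution:
  fixes \<psi> :: "real \<Rightarrow> ennreal"
  assumes [measurable]: "\<psi> \<in> borel_measurable borel" and m: "m > (0::nat)"
  shows "(\<integral>\<^sup>+r. \<psi> (r^m) * ennreal (real m * r^(m-1)) * indicator {0..1} r \<partial>lborel) = (\<integral>\<^sup>+r. \<psi> r * indicator {0..1} r \<partial>lborel)"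
proof -
  let ?w = "\<lambda>r::real. ennreal (real m * r^(m-1)) * indicator {0..1} r"
  have "distr (density lborel ?w) borel (\<lambda>r. r^m) = density lborel (indicator {0..1})"
  proof (rule measure_eqI)
    fix A assume "A \<in> sets (distr (density lborel ?w) borel (\<lambda>r. r^m))"
    then have A [measurable]: "A \<in> sets borel" by simp
    have "emeasure (distr (density lborel ?w) borel (\<lambda>r. r^m)) A = (\<integral>\<^sup>+r. indicator A r \<partial>distr (density lborel ?w) borel (\<lambda>r. r^m))" by simp
    also have "\<dots> = (\<integral>\<^sup>+r. ?w r * indicator A (r^m) \<partial>lborel)"
      by (subst nn_integral_distr, measurable, subst nn_integral_density) simp_all
    also have "\<dots> = (\<integral>\<^sup>+r. indicat_real A (r^m) * (real m * r^(m-1)) * indicator {0..1} r \<partial>lborel)"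
      by (rule nn_integral_cong) (auto simp: indicator_def)
    also have "\<dots> = (\<integral>\<^sup>+r. indicat_real A r * indicator {0^m..1^m} r \<partial>lborel)"
      using m by (intro nn_integral_substitution[symmetric] DERIV_cong[OF DERIV_pow]) (auto intro!: continuous_intros simp: set_borel_measurable_def)
    also have "\<dots> = (\<integral>\<^sup>+r. indicator {0..1} r * indicator A r \<partial>lborel)"
      using m by (intro nn_integral_cong) (auto simp: indicator_def power_0_left)
    also have "\<dots> = emeasure (density lborel (indicator {0..1})) A"
      by (simp add: emeasure_density)
    finally show "emeasure (distr (density lborel ?w) borel (\<lambda>r. r^m)) A = emeasure (density lborel (indicator {0..1})) A" .
  qed simp
  then have "(\<integral>\<^sup>+r. \<psi> r \<partial>distr (density lborel ?w) borel (\<lambda>r. r^m)) = (\<integral>\<^sup>+r. \<psi> r \<partial>density lborel (indicator {0..1}))" by simp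
  then show ?thesis
    by (simp add: nn_integral_distr nn_integral_density mult_ac)
qed

text \<open>The angular average is unchanged by t -> m t, and the substitution \<rho> = r^m turns
  r^(a+1) dr into (1/m) \<rho>^((a+2)/m - 1) d\<rho>. This is the origin of the exponent (a+2)/m -
  2.\<close>

lemma nn_integral_disc_power:
  fixes F :: "complex \<Rightarrow> ennreal"
  assumes [measurable]: "F \<in> borel_measurable borel" and m: "m > (0::nat)"
  shows "(\<integral>\<^sup>+z. F (z ^ m) \<partial>disc_measure a) = ennreal (1 / real m) * (\<integral>\<^sup>+z. F z \<partial>disc_measure ((a + 2) / real m - 2))"
proof -
  have [measurable]: "(\<lambda>t. rcis r t) \<in> borel_measurable borel" for r
    unfolding rcis_def by (intro borel_measurable_continuous_onI continuous_intros)
  define b where "b = (a + 2) / real m - 2"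
  define \<Phi> where "\<Phi> r = (\<integral>\<^sup>+t. F (rcis r t) * indicator {0<..<2*pi} t \<partial>lborel)" for r
  have [measurable]: "\<Phi> \<in> borel_measurable borel"
  proof -
    have "(\<lambda>p. rcis (fst p) (snd p)) \<in> borel_measurable (borel \<Otimes>\<^sub>M borel)"
      using measurable_rcis by (simp add: case_prod_beta cong: measurable_cong_sets)
    note [measurable] = this
    have "(\<lambda>p. F (rcis (fst p) (snd p)) * indicator {0<..<2*pi} (snd p)) \<in> borel_measurable (borel \<Otimes>\<^sub>M lborel)"
      by measurable
    then show ?thesis unfolding \<Phi>_def by (intro lborel.borel_measurable_nn_integral) (simp add: case_prod_beta)
  qed
  have "(\<integral>\<^sup>+z. F (z ^ m) \<partial>disc_measure a) = (\<integral>\<^sup>+r. \<Phi> (r^m) * ennreal (r powr (a+1)) * indicator {0<..<1} r \<partial>lborel)"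
  proof -
    have "(\<integral>\<^sup>+t. ennreal (norm (rcis r t) powr a) * F (rcis r t ^ m) * indicator (ball 0 1) (rcis r t) * indicator {0<..<2*pi} t \<partial>lborel) * (ennreal r * indicator {0<..} r)
      = \<Phi> (r^m) * ennreal (r powr (a+1)) * indicator {0<..<1} r" for r
    proof (cases "0 < r \<and> r < 1")
      case True
      have "rcis (r^m) (t + 2 * pi) = rcis (r^m) t" for t by (simp add: rcis_def cis_mult[symmetric])
      then have "(\<integral>\<^sup>+t. F (rcis (r^m) (real m * t)) * indicator {0<..<2*pi} t \<partial>lborel) = \<Phi> (r^m)"
        using nn_integral_periodic_scale[of "\<lambda>t. F (rcis (r^m) t)" "2*pi" m] m by (simp add: \<Phi>_def)
      moreover have "ennreal (r powr a) * ennreal r = ennreal (r powr (a+1))"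
        using True by (simp add: powr_add ennreal_mult)
      ultimately show ?thesis using True
        by (simp add: DeMoivre2 mult.assoc nn_integral_cmult) (metis mult.commute mult.assoc)
    qed (auto simp: indicator_def)
    note eq = this
    show ?thesis by (subst nn_integral_disc_measure, measurable, subst nn_integral_polar, measurable) (rule nn_integral_cong, rule eq)
  qed
  also have "\<dots> = ennreal (1 / real m) * (\<integral>\<^sup>+r. (\<Phi> (r^m) * ennreal ((r^m) powr (b+1))) * ennreal (real m * r^(m-1)) * indicator {0..1} r \<partial>lborel)"
  proof (subst nn_integral_cmult[symmetric], measurable, rule nn_integral_cong_AE)
    show "AE r in lborel. \<Phi> (r^m) * ennreal (r powr (a+1)) * indicator {0<..<1} r =
      ennreal (1 / real m) * ((\<Phi> (r^m) * ennreal ((r^m) powr (b+1))) * ennreal (real m * r^(m-1)) * indicator {0..1} r)"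
      using AE_lborel_singleton[of 0] AE_lborel_singleton[of 1]
    proof eventually_elim
      case (elim r)
      show ?case
      proof (cases "0 < r \<and> r < 1")
        case True
        have e: "a + 1 = real m * (b + 1) + (real m - 1)" using m by (simp add: b_def field_simps)
        have "(r^m) powr (b+1) * r^(m-1) = r powr (a+1)"
          unfolding e using True m by (simp add: powr_realpow[symmetric] powr_powr powr_add[symmetric] of_nat_diff)
        then have "ennreal (r powr (a+1)) = ennreal (1 / real m) * ennreal ((r^m) powr (b+1)) * ennreal (real m * r^(m-1))"
          using True m by (simp add: ennreal_mult[symmetric] field_simps)
        then show ?thesis using True by (simp add: mult_ac)
      qed (use elim in \<open>auto simp: indicator_def\<close>)
    qed
  qed
  also have "(\<integral>\<^sup>+r. (\<Phi> (r^m) * ennreal ((r^m) powr (b+1))) * ennreal (real m * r^(m-1)) * indicator {0..1} r \<partial>lborel)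
     = (\<integral>\<^sup>+r. (\<Phi> r * ennreal (r powr (b+1))) * indicator {0..1} r \<partial>lborel)"
    using m by (intro nn_integral_power_substitution[of "\<lambda>r. \<Phi> r * ennreal (r powr (b+1))"]) simp_all
  also have "\<dots> = (\<integral>\<^sup>+z. F z \<partial>disc_measure b)"
  proof -
    have "(\<integral>\<^sup>+t. ennreal (norm (rcis r t) powr b) * F (rcis r t) * indicator (ball 0 1) (rcis r t) * indicator {0<..<2*pi} t \<partial>lborel) * (ennreal r * indicator {0<..} r)
      = \<Phi> r * ennreal (r powr (b+1)) * indicator {0<..<1} r" for r
    proof (cases "0 < r \<and> r < 1")
      case True
      have e: "ennreal (r powr (b+1)) = ennreal (r powr b) * ennreal r"
        using True by (simp add: powr_add ennreal_mult)
      show ?thesis using True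
        by (simp add: \<Phi>_def mult.assoc nn_integral_cmult e) (simp only: mult_ac)
    qed (auto simp: indicator_def)
    note eq = this
    have "(\<integral>\<^sup>+r. (\<Phi> r * ennreal (r powr (b+1))) * indicator {0..1} r \<partial>lborel) = (\<integral>\<^sup>+r. (\<Phi> r * ennreal (r powr (b+1))) * indicator {0<..<1} r \<partial>lborel)"
      by (intro nn_integral_cong_AE eventually_mono[OF eventually_conj[OF AE_lborel_singleton[of 0] AE_lborel_singleton[of 1]]]) (auto simp: indicator_def)
    also have "\<dots> = (\<integral>\<^sup>+z. F z \<partial>disc_measure b)"
      by (subst nn_integral_disc_measure, measurable, subst nn_integral_polar, measurable) (rule nn_integral_cong, rule eq[symmetric])
    finally show ?thesis .
  qed
  finally show ?thesis by (simp add: b_def)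
qed

text \<open>Translation moves the singularity to the origin, the disc stays inside the ball of
  radius 2, and in polar coordinates the integrand is r^(1-s), integrable at 0 for s < 2. All later
  kernel estimates are reduced to this one.\<close>

lemma disc_kernel_integral:
  assumes "s < 2"
  obtains C where "C > 0" "\<And>x. cmod x \<le> 1 \<Longrightarrow> (\<integral>\<^sup>+y. ennreal (cmod (x - y) powr (-s)) \<partial>disc_measure 0) \<le> ennreal C"
proof -
  have [measurable]: "(\<lambda>t. rcis r t) \<in> borel_measurable borel" for r
    unfolding rcis_def by (intro borel_measurable_continuous_onI continuous_intros)
  define C where "C = 2 * pi * (2 powr (2 - s) / (2 - s))"
  have C: "(\<integral>\<^sup>+y. ennreal (cmod y powr (-s)) * indicator (ball 0 2) y \<partial>lborel) = ennreal C"
  proof -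
    have "((\<lambda>r::real. r powr (1 - s)) has_integral (2 powr (1 - s + 1) / (1 - s + 1))) {0..2}"
      using assms by (intro has_integral_powr_from_0) auto
    from nn_integral_has_integral_lebesgue'[OF _ this]
    have I: "(\<integral>\<^sup>+r. ennreal (r powr (1 - s)) * indicator {0..2} r \<partial>lborel) = ennreal (2 powr (2 - s) / (2 - s))"
      by (simp add: algebra_simps)
    have "(\<integral>\<^sup>+t. (ennreal (norm (rcis r t) powr (-s)) * indicator (ball 0 2) (rcis r t)) * indicator {0<..<2*pi} t \<partial>lborel) * (ennreal r * indicator {0<..} r)
      = ennreal (2*pi) * (ennreal (r powr (1 - s)) * indicator {0<..<2} r)" for r
    proof (cases "0 < r \<and> r < 2")
      case True
      then have "ennreal (r powr (-s)) * ennreal r = ennreal (r powr (1 - s))"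
        by (simp add: powr_add[of r "-s" 1, simplified] ennreal_mult)
      then show ?thesis using True by (simp add: nn_integral_cmult) (metis mult.commute mult.assoc)
    qed (auto simp: indicator_def)
    note eq = this
    have "(\<integral>\<^sup>+y. ennreal (cmod y powr (-s)) * indicator (ball 0 2) y \<partial>lborel) = (\<integral>\<^sup>+r. ennreal (2*pi) * (ennreal (r powr (1 - s)) * indicator {0<..<2} r) \<partial>lborel)"
      by (subst nn_integral_polar, measurable) (rule nn_integral_cong, rule eq)
    also have "\<dots> = ennreal (2*pi) * (\<integral>\<^sup>+r. ennreal (r powr (1 - s)) * indicator {0..2} r \<partial>lborel)"
      by (subst nn_integral_cmult, simp, rule arg_cong[where f="(*) _"],
        intro nn_integral_cong_AE eventually_mono[OF eventually_conj[OF AE_lborel_singleton[of 0] AE_lborel_singleton[of 2]]]) (auto simp: indicator_def)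
    finally show ?thesis using assms unfolding I C_def by (subst ennreal_mult) auto
  qed
  have "(\<integral>\<^sup>+y. ennreal (cmod (x - y) powr (-s)) \<partial>disc_measure 0) \<le> ennreal C" if x: "cmod x \<le> 1" for x
  proof -
    have "(\<integral>\<^sup>+y. ennreal (cmod (x - y) powr (-s)) \<partial>disc_measure 0) \<le> (\<integral>\<^sup>+y. ennreal (cmod (-x + y) powr (-s)) * indicator (ball 0 2) (-x + y) \<partial>lborel)"
      apply (subst nn_integral_disc_measure, measurable)
      apply (rule nn_integral_mono)
      subgoal for y using x norm_triangle_ineq4[of x y] by (auto simp: indicator_def norm_minus_commute)
      done
    also have "\<dots> = (\<integral>\<^sup>+y. ennreal (cmod y powr (-s)) * indicator (ball 0 2) y \<partial>distr lborel borel ((+) (-x)))"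
      by (subst nn_integral_distr) auto
    also have "\<dots> = ennreal C" unfolding lborel_distr_plus by (rule C)
    finally show ?thesis .
  qed
  moreover have "C > 0" using assms by (simp add: C_def)
  ultimately show ?thesis using that by blast
qed

section \<open>The Green function of the disc\<close>

text \<open>The Dirichlet Green function of minus the Laplacian on the unit disc. The value 0 on the
  diagonal stands in for infinity: it keeps the function real and nonnegative, and the diagonal is a
  null set in every integral.\<close>

definition green :: "complex \<Rightarrow> complex \<Rightarrow> real" where
  "green x y = (if x = y then 0 else (ln (cmod (1 - x * cnj y)) - ln (cmod (x - y))) / (2 * pi))"

lemma green_commute: "green x y = green y x"
proof -
  have "cmod (1 - x * cnj y) = cmod (cnj (1 - x * cnj y))" by (rule complex_mod_cnj[symmetric])
  then show ?thesis by (simp add: green_def norm_minus_commute mult.commute)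
qed

lemma borel_measurable_cnj [measurable]: "cnj \<in> borel_measurable borel"
  by (intro borel_measurable_continuous_onI continuous_intros)

lemma measurable_green [measurable]: "(\<lambda>p. green (fst p) (snd p)) \<in> borel_measurable (borel \<Otimes>\<^sub>M borel)"
  unfolding green_def by measurable

text \<open>All sign properties of the Green function come from this identity: the last product is
  nonnegative on the closed disc, positive inside and zero when x lies on the circle. It also gives
  the form of G used for positive semidefiniteness.\<close>

lemma cmod_one_minus_squared:
  "(cmod (1 - x * cnj y))\<^sup>2 = (cmod (x - y))\<^sup>2 + (1 - (cmod x)\<^sup>2) * (1 - (cmod y)\<^sup>2)"
  unfolding cmod_power2 by (simp add: power2_eq_square algebra_simps)

lemma cmod_diff_le_one_minus:
  assumes "cmod x \<le> 1" "cmod y \<le> 1"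
  shows "cmod (x - y) \<le> cmod (1 - x * cnj y)"
proof (rule power2_le_imp_le)
  have "(1 - (cmod x)\<^sup>2) * (1 - (cmod y)\<^sup>2) \<ge> 0"
    using assms by (intro mult_nonneg_nonneg) (auto simp: abs_square_le_1)
  then show "(cmod (x - y))\<^sup>2 \<le> (cmod (1 - x * cnj y))\<^sup>2" by (simp add: cmod_one_minus_squared)
qed simp

lemma green_nonneg: "cmod x \<le> 1 \<Longrightarrow> cmod y \<le> 1 \<Longrightarrow> 0 \<le> green x y"
  using cmod_diff_le_one_minus[of x y] ln_mono[of "cmod (x - y)" "cmod (1 - x * cnj y)"]
  by (auto simp: green_def)

lemma green_pos:
  assumes "cmod x < 1" "cmod y < 1" "x \<noteq> y"
  shows "0 < green x y"
proof -
  have "(1 - (cmod x)\<^sup>2) * (1 - (cmod y)\<^sup>2) > 0"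
    using assms by (intro mult_pos_pos) (auto simp: abs_square_less_1)
  then have "(cmod (x - y))\<^sup>2 < (cmod (1 - x * cnj y))\<^sup>2" unfolding cmod_one_minus_squared by linarith
  then have "cmod (x - y) < cmod (1 - x * cnj y)" by (rule power2_less_imp_less) simp
  moreover have "0 < cmod (x - y)" using assms by simp
  ultimately have "ln (cmod (x - y)) < ln (cmod (1 - x * cnj y))" by (metis ln_less_cancel_iff less_trans)
  then show ?thesis using assms by (simp add: green_def)
qed

lemma green_boundary:
  assumes "cmod x = 1"
  shows "green x y = 0"
  using cmod_one_minus_squared[of x y] assms by (simp add: green_def)

text \<open>Trades the logarithm for an arbitrarily small power, so that estimates of the Green
  function become estimates of Riesz kernels. The exponent will be 1/(p+1).\<close>

lemma ln_add_one_le_powr: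
  fixes t :: real
  assumes t: "0 \<le> t" and \<gamma>: "0 < \<gamma>" "\<gamma> \<le> 1"
  shows "ln (1 + t) \<le> t powr \<gamma> / \<gamma>"
proof (cases "t \<le> 1")
  case True
  have "t \<le> t powr \<gamma>" using powr_mono'[of \<gamma> 1 t] True t \<gamma> by simp
  also have "\<dots> \<le> t powr \<gamma> / \<gamma>" using \<gamma> by (simp add: field_simps mult_left_le_one_le)
  finally show ?thesis using ln_add_one_self_le_self[OF t] by linarith
next
  case False
  then have t1: "t > 1" by simp
  have "ln (1 + t) \<le> ln (2 * t)" using t1 by simp
  also have "\<dots> = ln 2 + ln t" using t1 by (simp add: ln_mult)
  also have "\<dots> \<le> 1 + ln t" using ln_2_less_1 by simp
  also have "ln t = ln (t powr \<gamma>) / \<gamma>" using t1 \<gamma> by (simp add: ln_powr)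
  also have "\<dots> \<le> (t powr \<gamma> - 1) / \<gamma>" using t1 \<gamma> by (intro divide_right_mono ln_le_minus_one) auto
  also have "1 + (t powr \<gamma> - 1) / \<gamma> \<le> t powr \<gamma> / \<gamma>" using \<gamma> by (simp add: field_simps)
  finally show ?thesis by simp
qed

text \<open>The increment of the logarithm is at most ln (1 + d / min A B), so its Hoelder constant
  blows up only like a small negative power of the smaller argument.\<close>

lemma ln_diff_le_powr:
  fixes A B d :: real
  assumes AB: "0 < A" "0 < B" and d: "\<bar>A - B\<bar> \<le> d" and \<gamma>: "0 < \<gamma>" "\<gamma> \<le> 1"
  shows "\<bar>ln A - ln B\<bar> \<le> d powr \<gamma> / \<gamma> * (A powr (-\<gamma>) + B powr (-\<gamma>))"
proof -
  have *: "ln B - ln A \<le> d powr \<gamma> / \<gamma> * A powr (-\<gamma>)" if "0 < A" "A \<le> B" "B - A \<le> d" for A B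
  proof -
    have "ln B - ln A = ln (B / A)" using that by (simp add: ln_div)
    also have "\<dots> \<le> ln (1 + d / A)" using that by (simp add: field_simps)
    also have "\<dots> \<le> (d / A) powr \<gamma> / \<gamma>" using that \<gamma> by (intro ln_add_one_le_powr) auto
    also have "\<dots> = d powr \<gamma> / \<gamma> * A powr (-\<gamma>)" using that by (simp add: powr_divide powr_minus_divide)
    finally show ?thesis .
  qed
  have n: "0 \<le> d powr \<gamma> / \<gamma> * A powr (-\<gamma>)" "0 \<le> d powr \<gamma> / \<gamma> * B powr (-\<gamma>)" using \<gamma> by auto
  show ?thesis
  proof (cases "A \<le> B")
    case True
    then show ?thesis using *[of A B] AB d n by (simp add: distrib_left)
  next
    case False
    then show ?thesis using *[of B A] AB d n by (simp add: distrib_left)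
  qed
qed

lemma green_le_powr:
  assumes "cmod x \<le> 1" "cmod y \<le> 1" "x \<noteq> y" and \<gamma>: "0 < \<gamma>" "\<gamma> \<le> 1"
  shows "green x y \<le> 1 / (pi * \<gamma>) * cmod (x - y) powr (-\<gamma>)"
proof -
  have n2: "cmod (1 - x * cnj y) \<le> 2"
    using norm_triangle_ineq4[of 1 "x * cnj y"] assms mult_le_one[of "cmod x" "cmod y"] by (simp add: norm_mult)
  have pos: "cmod (x - y) > 0" "cmod (1 - x * cnj y) > 0"
    using assms cmod_diff_le_one_minus[of x y] by (auto intro: less_le_trans[of 0 "cmod (x-y)"])
  have "green x y \<le> (ln 2 - ln (cmod (x - y))) / (2 * pi)"
    using assms n2 pos by (auto simp: green_def divide_right_mono)
  also have "ln 2 - ln (cmod (x - y)) = ln (2 / cmod (x - y))" using pos by (simp add: ln_div)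
  also have "\<dots> \<le> ln (1 + 2 / cmod (x - y))" using pos by (subst ln_le_cancel_iff) (auto intro: add_pos_pos)
  also have "\<dots> \<le> (2 / cmod (x - y)) powr \<gamma> / \<gamma>" using \<gamma> by (intro ln_add_one_le_powr) auto
  also have "\<dots> = 2 powr \<gamma> * cmod (x - y) powr (-\<gamma>) / \<gamma>" by (simp add: powr_divide powr_minus_divide)
  also have "\<dots> \<le> 2 * cmod (x - y) powr (-\<gamma>) / \<gamma>"
    using \<gamma> powr_mono[of \<gamma> 1 2] by (intro divide_right_mono mult_right_mono) auto
  finally show ?thesis using \<gamma> by (simp add: field_simps)
qed

text \<open>Both arguments |x - y| and |1 - x * cnj y| change by at most |x - x'|, and the second is
  never smaller than the first. The regular part of G is therefore controlled by the same bound as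
  the singular part.\<close>

lemma green_diff_le_powr:
  assumes x: "cmod x \<le> 1" "cmod x' \<le> 1" "cmod y \<le> 1" "x \<noteq> y" "x' \<noteq> y" and \<gamma>: "0 < \<gamma>" "\<gamma> \<le> 1"
  shows "\<bar>green x y - green x' y\<bar> \<le>
    1 / (pi * \<gamma>) * cmod (x - x') powr \<gamma> * (cmod (x - y) powr (-\<gamma>) + cmod (x' - y) powr (-\<gamma>))"
proof -
  let ?d = "cmod (x - x')" and ?A = "cmod (1 - x * cnj y)" and ?B = "cmod (1 - x' * cnj y)"
  let ?s = "cmod (x - y) powr (-\<gamma>) + cmod (x' - y) powr (-\<gamma>)"
  have pos: "cmod (x - y) > 0" "cmod (x' - y) > 0" "?A > 0" "?B > 0"
    and le: "cmod (x - y) \<le> ?A" "cmod (x' - y) \<le> ?B"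
    using x cmod_diff_le_one_minus[of x y] cmod_diff_le_one_minus[of x' y]
    by (auto intro: less_le_trans[of 0 "cmod (x-y)"] less_le_trans[of 0 "cmod (x'-y)"])
  have 1: "\<bar>ln (cmod (x - y)) - ln (cmod (x' - y))\<bar> \<le> ?d powr \<gamma> / \<gamma> * ?s"
    using pos \<gamma> norm_triangle_ineq3[of "x - y" "x' - y"] by (intro ln_diff_le_powr) auto
  have "\<bar>?A - ?B\<bar> \<le> cmod ((x' - x) * cnj y)" using norm_triangle_ineq3[of "1 - x * cnj y" "1 - x' * cnj y"] by (simp add: algebra_simps)
  also have "\<dots> \<le> ?d" using x by (simp add: norm_mult norm_minus_commute mult_left_le)
  finally have "\<bar>ln ?A - ln ?B\<bar> \<le> ?d powr \<gamma> / \<gamma> * (?A powr (-\<gamma>) + ?B powr (-\<gamma>))"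
    using pos \<gamma> by (intro ln_diff_le_powr) auto
  also have "\<dots> \<le> ?d powr \<gamma> / \<gamma> * ?s"
    using pos le \<gamma> by (intro mult_left_mono add_mono powr_mono2') auto
  finally have 2: "\<bar>ln ?A - ln ?B\<bar> \<le> ?d powr \<gamma> / \<gamma> * ?s" .
  have "\<bar>green x y - green x' y\<bar> = \<bar>(ln ?A - ln ?B) - (ln (cmod (x - y)) - ln (cmod (x' - y)))\<bar> / (2 * pi)"
    using x by (simp add: green_def diff_divide_distrib[symmetric] algebra_simps)
  also have "\<dots> \<le> (2 * (?d powr \<gamma> / \<gamma> * ?s)) / (2 * pi)" using 1 2 by (intro divide_right_mono) auto
  also have "\<dots> = 1 / (pi * \<gamma>) * ?d powr \<gamma> * ?s" by simp
  finally show ?thesis .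
qed

lemma nn_integral_disc_measure_mono_weight:
  assumes [measurable]: "f \<in> borel_measurable borel" and a: "0 \<le> a"
  shows "(\<integral>\<^sup>+z. f z \<partial>disc_measure a) \<le> (\<integral>\<^sup>+z. f z \<partial>disc_measure 0)"
  unfolding nn_integral_disc_measure[OF assms(1)]
proof (rule nn_integral_mono_AE)
  show "AE z in lborel. ennreal (cmod z powr a) * f z * indicator (ball 0 1) z \<le> ennreal (cmod z powr 0) * f z * indicator (ball 0 1) z"
    using AE_lborel_singleton[of 0]
  proof eventually_elim
    case (elim z)
    have "ennreal (cmod z powr a) \<le> ennreal (cmod z powr 0)" if "z \<in> ball 0 1"
      using that elim a by (intro ennreal_leI powr_mono') auto
    then show ?case by (cases "z \<in> ball 0 1") (auto intro: mult_right_mono simp del: powr_zero_eq_one)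
  qed
qed

lemma finite_measure_disc_measure: "0 \<le> a \<Longrightarrow> finite_measure (disc_measure a)"
proof (rule finite_measureI)
  assume a: "0 \<le> a"
  have "emeasure (disc_measure a) UNIV = (\<integral>\<^sup>+z. 1 \<partial>disc_measure a)" by simp
  also have "\<dots> \<le> (\<integral>\<^sup>+z. 1 \<partial>disc_measure 0)" by (intro nn_integral_disc_measure_mono_weight a) simp
  also have "\<dots> \<le> (\<integral>\<^sup>+z. indicator (ball 0 1) (z::complex) \<partial>lborel)"
    unfolding nn_integral_disc_measure[of "\<lambda>_. 1" 0, OF borel_measurable_const]
    by (rule nn_integral_mono) (auto simp: indicator_def)
  also have "\<dots> < \<infinity>" by (simp add: emeasure_ball)
  finally show "emeasure (disc_measure a) (space (disc_measure a)) \<noteq> \<infinity>" by simp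
qed

lemma disc_kernel_integrable:
  assumes "s < 2"
  obtains C where "C > 0" "\<And>a x. 0 \<le> a \<Longrightarrow> cmod x \<le> 1 \<Longrightarrow> integrable (disc_measure a) (\<lambda>y. cmod (x - y) powr (-s))"
    "\<And>a x. 0 \<le> a \<Longrightarrow> cmod x \<le> 1 \<Longrightarrow> (\<integral>y. cmod (x - y) powr (-s) \<partial>disc_measure a) \<le> C"
proof -
  obtain C where C: "C > 0" "\<And>x. cmod x \<le> 1 \<Longrightarrow> (\<integral>\<^sup>+y. ennreal (cmod (x - y) powr (-s)) \<partial>disc_measure 0) \<le> ennreal C"
    using disc_kernel_integral[OF assms] by blast
  have m: "(\<lambda>y. cmod (x - y) powr (-s)) \<in> borel_measurable borel" for x by measurable
  have b: "(\<integral>\<^sup>+y. ennreal (cmod (x - y) powr (-s)) \<partial>disc_measure a) \<le> ennreal C" if "0 \<le> a" "cmod x \<le> 1" for a x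
    by (rule order_trans[OF nn_integral_disc_measure_mono_weight C(2)]) (use that m in simp_all)
  have i: "integrable (disc_measure a) (\<lambda>y. cmod (x - y) powr (-s))" if "0 \<le> a" "cmod x \<le> 1" for a x
    using b[OF that] by (intro integrableI_bounded) (auto simp: less_top[symmetric] top_unique m)
  moreover have "(\<integral>y. cmod (x - y) powr (-s) \<partial>disc_measure a) \<le> C" if "0 \<le> a" "cmod x \<le> 1" for a x
    using b[OF that] C(1) nn_integral_eq_integral[OF i[OF that]] by (simp add: ennreal_le_iff)
  ultimately show ?thesis using that C(1) by blast
qed

section \<open>The energy form\<close>

text \<open>Bounded Borel functions on the whole plane rather than classes in an Lq space:
  integrability is then a matter of domination, and maximizers remain in this class because
  potentials are bounded on the disc.\<close>

definition bdd_borel :: "(complex \<Rightarrow> real) \<Rightarrow> bool" where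
  "bdd_borel h \<longleftrightarrow> h \<in> borel_measurable borel \<and> (\<exists>B. \<forall>x. \<bar>h x\<bar> \<le> B)"

definition potential :: "real \<Rightarrow> (complex \<Rightarrow> real) \<Rightarrow> complex \<Rightarrow> real" where
  "potential a h x = (\<integral>y. green x y * h y \<partial>disc_measure a)"

definition energy :: "real \<Rightarrow> (complex \<Rightarrow> real) \<Rightarrow> (complex \<Rightarrow> real) \<Rightarrow> real" where
  "energy a f g = (\<integral>x. f x * potential a g x \<partial>disc_measure a)"

lemma bdd_borel_measurable [measurable_dest]: "bdd_borel h \<Longrightarrow> h \<in> borel_measurable borel"
  by (simp add: bdd_borel_def)

lemma bdd_borelE:
  assumes "bdd_borel h" obtains B where "B \<ge> 0" "\<And>x. \<bar>h x\<bar> \<le> B"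
  using assms unfolding bdd_borel_def by (metis abs_ge_zero order_trans)

lemma bdd_borel_linear: "bdd_borel f \<Longrightarrow> bdd_borel g \<Longrightarrow> bdd_borel (\<lambda>x. f x + t * g x)"
proof -
  assume f: "bdd_borel f" and g: "bdd_borel g"
  from f obtain B where B: "\<And>x. \<bar>f x\<bar> \<le> B" by (metis bdd_borelE)
  from g obtain C where C: "\<And>x. \<bar>g x\<bar> \<le> C" by (metis bdd_borelE)
  have "\<bar>f x + t * g x\<bar> \<le> B + \<bar>t\<bar> * C" for x
    using B[of x] mult_left_mono[OF C[of x], of "\<bar>t\<bar>"] abs_triangle_ineq[of "f x" "t * g x"] by (simp add: abs_mult)
  then show ?thesis using f g unfolding bdd_borel_def by (auto intro!: borel_measurable_add borel_measurable_times)
qed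

lemma bdd_borel_const [simp]: "bdd_borel (\<lambda>_. c)" by (auto simp: bdd_borel_def)

lemma measurable_green2 [measurable]: "green x \<in> borel_measurable borel"
  using measurable_compose[OF _ measurable_green, of "\<lambda>y. (x, y)" borel] by simp

context
  fixes a :: real
  assumes a: "0 \<le> a"
begin

interpretation finite_measure "disc_measure a" by (rule finite_measure_disc_measure[OF a])
interpretation P: pair_sigma_finite "disc_measure a" "disc_measure a" ..

lemma integrable_green: "cmod x \<le> 1 \<Longrightarrow> integrable (disc_measure a) (green x)"
  and green_integral_bounded: "\<exists>C. \<forall>x. cmod x \<le> 1 \<longrightarrow> (\<integral>y. green x y \<partial>disc_measure a) \<le> C"
proof -
  obtain C where C: "\<And>x. cmod x \<le> 1 \<Longrightarrow> integrable (disc_measure a) (\<lambda>y. cmod (x - y) powr (-1))"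
    "\<And>x. cmod x \<le> 1 \<Longrightarrow> (\<integral>y. cmod (x - y) powr (-1) \<partial>disc_measure a) \<le> C"
    using disc_kernel_integrable[of 1] a by (metis one_less_numeral_iff semiring_norm(76))
  have ae: "AE y in disc_measure a. 0 \<le> green x y \<and> green x y \<le> 1 / pi * cmod (x - y) powr (-1)" if "cmod x \<le> 1" for x
    using AE_disc_measure AE_disc_measure_neq[of x]
    by eventually_elim (use that green_le_powr[of x _ 1] green_nonneg[of x] in auto)
  show i: "integrable (disc_measure a) (green x)" if "cmod x \<le> 1" for x
  proof (rule Bochner_Integration.integrable_bound)
    show "integrable (disc_measure a) (\<lambda>y. 1 / pi * cmod (x - y) powr (-1))"
      using C(1)[OF that] by (rule integrable_mult_right)
    show "AE y in disc_measure a. norm (green x y) \<le> norm (1 / pi * cmod (x - y) powr (-1))"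
      using ae[OF that] by eventually_elim (smt (verit) real_norm_def)
  qed measurable
  have "(\<integral>y. green x y \<partial>disc_measure a) \<le> 1 / pi * C" if "cmod x \<le> 1" for x
  proof -
    have "(\<integral>y. green x y \<partial>disc_measure a) \<le> (\<integral>y. 1 / pi * cmod (x - y) powr (-1) \<partial>disc_measure a)"
      using ae[OF that] by (intro integral_mono_AE i that integrable_mult_right C(1)) auto
    also have "\<dots> = 1 / pi * (\<integral>y. cmod (x - y) powr (-1) \<partial>disc_measure a)" by (rule integral_mult_right_zero)
    also have "\<dots> \<le> 1 / pi * C" using C(2)[OF that] by (rule mult_left_mono) simp
    finally show ?thesis .
  qed
  then show "\<exists>C. \<forall>x. cmod x \<le> 1 \<longrightarrow> (\<integral>y. green x y \<partial>disc_measure a) \<le> C" by blast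
qed

lemma integrable_green_mult:
  assumes h: "bdd_borel h" and x: "cmod x \<le> 1"
  shows "integrable (disc_measure a) (\<lambda>y. green x y * h y)"
proof -
  obtain B where B: "B \<ge> 0" "\<And>x. \<bar>h x\<bar> \<le> B" using bdd_borelE[OF h] by blast
  have [measurable]: "h \<in> borel_measurable borel" using h by measurable
  show ?thesis
    by (rule Bochner_Integration.integrable_bound[OF integrable_mult_right[OF integrable_green[OF x], of B]])
      (auto simp: abs_mult mult.commute[of B] intro!: AE_I2 mult_left_mono order_trans[OF B(2)])
qed

lemma AE_pair_ball: "AE p in disc_measure a \<Otimes>\<^sub>M disc_measure a. fst p \<in> ball 0 1 \<and> snd p \<in> ball 0 1 \<and> fst p \<noteq> snd p"
proof (rule P.AE_pair_measure)
  show "AE x in disc_measure a. AE y in disc_measure a. fst (x,y) \<in> ball 0 1 \<and> snd (x,y) \<in> ball 0 1 \<and> fst (x,y) \<noteq> snd (x,y)"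
    using AE_disc_measure
  proof eventually_elim
    case (elim x)
    show ?case using AE_disc_measure AE_disc_measure_neq[of x] by eventually_elim (use elim in auto)
  qed
qed measurable

lemma integrable_pair_bounded:
  fixes A :: "complex \<times> complex \<Rightarrow> real"
  assumes "A \<in> borel_measurable (borel \<Otimes>\<^sub>M borel)" "\<And>x y. x \<in> ball 0 1 \<Longrightarrow> y \<in> ball 0 1 \<Longrightarrow> \<bar>A (x,y)\<bar> \<le> B"
  shows "integrable (disc_measure a \<Otimes>\<^sub>M disc_measure a) A"
proof -
  have "finite_measure (disc_measure a \<Otimes>\<^sub>M disc_measure a)"
    by (rule finite_measure_pair_measure) (rule finite_measure_disc_measure[OF a])+
  then show ?thesis
    by (rule finite_measure.integrable_const_bound[where B=B])
      (use assms in \<open>auto intro: eventually_mono[OF AE_pair_ball] cong: measurable_cong_sets\<close>)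
qed

lemma integrable_green_pair:
  assumes f: "bdd_borel f" and g: "bdd_borel g"
  shows "integrable (disc_measure a \<Otimes>\<^sub>M disc_measure a) (\<lambda>p. green (fst p) (snd p) * f (fst p) * g (snd p))"
proof (rule P.Fubini_integrable)
  have [measurable]: "f \<in> borel_measurable borel" "g \<in> borel_measurable borel" using f g by measurable
  obtain B where B: "B \<ge> 0" "\<And>x. \<bar>f x\<bar> \<le> B" using bdd_borelE[OF f] by blast
  obtain D where D: "D \<ge> 0" "\<And>x. \<bar>g x\<bar> \<le> D" using bdd_borelE[OF g] by blast
  obtain C where C: "\<And>x. cmod x \<le> 1 \<Longrightarrow> (\<integral>y. green x y \<partial>disc_measure a) \<le> C" using green_integral_bounded by blast
  show m [measurable]: "(\<lambda>p. green (fst p) (snd p) * f (fst p) * g (snd p)) \<in> borel_measurable (disc_measure a \<Otimes>\<^sub>M disc_measure a)"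
    by measurable
  show "AE x in disc_measure a. integrable (disc_measure a) (\<lambda>y. green (fst (x,y)) (snd (x,y)) * f (fst (x,y)) * g (snd (x,y)))"
    using AE_disc_measure
  proof eventually_elim
    case (elim x)
    then show ?case using integrable_mult_right[OF integrable_green_mult[OF g, of x], of "f x"] by (simp add: mult_ac)
  qed
  show "integrable (disc_measure a) (\<lambda>x. \<integral>y. norm (green (fst (x,y)) (snd (x,y)) * f (fst (x,y)) * g (snd (x,y))) \<partial>disc_measure a)"
  proof (rule integrable_const_bound[where B="C * (B * D)"])
    show "AE x in disc_measure a. norm (\<integral>y. norm (green (fst (x,y)) (snd (x,y)) * f (fst (x,y)) * g (snd (x,y))) \<partial>disc_measure a) \<le> C * (B * D)"
      using AE_disc_measure
    proof eventually_elim
      case (elim x)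
      then have x: "cmod x \<le> 1" by simp
      have "(\<integral>y. norm (green x y * f x * g y) \<partial>disc_measure a) \<le> (\<integral>y. green x y * (B * D) \<partial>disc_measure a)"
      proof (rule integral_mono_AE)
        show "integrable (disc_measure a) (\<lambda>y. norm (green x y * f x * g y))"
          using integrable_norm[OF integrable_mult_right[OF integrable_green_mult[OF g x], of "f x"]] by (simp add: mult_ac)
        show "integrable (disc_measure a) (\<lambda>y. green x y * (B * D))" using integrable_green[OF x] by simp
        show "AE y in disc_measure a. norm (green x y * f x * g y) \<le> green x y * (B * D)"
          using AE_disc_measure
        proof eventually_elim
          case (elim y)
          then have "0 \<le> green x y" using x by (intro green_nonneg) auto
          then show ?case by (simp add: abs_mult mult.assoc) (intro mult_left_mono mult_mono B D, auto)
        qed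
      qed
      also have "\<dots> \<le> C * (B * D)" using C[OF x] B D by (simp add: mult_right_mono)
      finally show ?case by (simp add: integral_nonneg_AE)
    qed
  qed measurable
qed

lemma energy_pair:
  assumes f: "bdd_borel f" and g: "bdd_borel g"
  shows "energy a f g = (\<integral>p. green (fst p) (snd p) * f (fst p) * g (snd p) \<partial>(disc_measure a \<Otimes>\<^sub>M disc_measure a))"
proof -
  have "(\<integral>p. green (fst p) (snd p) * f (fst p) * g (snd p) \<partial>(disc_measure a \<Otimes>\<^sub>M disc_measure a)) = (\<integral>x. (\<integral>y. green x y * f x * g y \<partial>disc_measure a) \<partial>disc_measure a)"
    using P.integral_fst'[OF integrable_green_pair[OF f g]] by simp
  also have "\<dots> = energy a f g"
    unfolding energy_def potential_def
    by (intro Bochner_Integration.integral_cong refl) (simp add: mult_ac flip: integral_mult_right_zero)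
  finally show ?thesis by simp
qed

lemma energy_commute:
  assumes f: "bdd_borel f" and g: "bdd_borel g"
  shows "energy a f g = energy a g f"
proof -
  have "energy a f g = (\<integral>(x,y). green y x * f y * g x \<partial>(disc_measure a \<Otimes>\<^sub>M disc_measure a))"
    unfolding energy_pair[OF f g] using P.integral_product_swap[of "\<lambda>p. green (fst p) (snd p) * f (fst p) * g (snd p)"] integrable_green_pair[OF f g]
    by (simp add: case_prod_beta)
  also have "\<dots> = energy a g f"
    unfolding energy_pair[OF g f] by (intro Bochner_Integration.integral_cong refl) (auto simp: green_commute mult_ac)
  finally show ?thesis .
qed

lemma energy_linear:
  assumes f: "bdd_borel f" and g: "bdd_borel g" and h: "bdd_borel h"
  shows "energy a (\<lambda>x. f x + t * g x) h = energy a f h + t * energy a g h"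
proof -
  have "energy a (\<lambda>x. f x + t * g x) h = (\<integral>p. green (fst p) (snd p) * f (fst p) * h (snd p) + t * (green (fst p) (snd p) * g (fst p) * h (snd p)) \<partial>(disc_measure a \<Otimes>\<^sub>M disc_measure a))"
    unfolding energy_pair[OF bdd_borel_linear[OF f g] h] by (intro Bochner_Integration.integral_cong refl) (simp add: algebra_simps)
  also have "\<dots> = energy a f h + t * energy a g h"
    unfolding energy_pair[OF f h] energy_pair[OF g h]
    by (subst Bochner_Integration.integral_add) (auto intro!: integrable_green_pair f g h integrable_mult_right)
  finally show ?thesis .
qed

end

section \<open>Positive semidefiniteness of the energy\<close>

text \<open>Kernels whose quadratic form is visibly a finite sum of squares. Recording this
  structure, instead of positivity itself, makes closure under products elementary.\<close>

inductive feature_kernel :: "(complex \<Rightarrow> complex \<Rightarrow> real) \<Rightarrow> bool" where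
  fk_zero: "feature_kernel (\<lambda>x y. 0)"
| fk_add: "feature_kernel A \<Longrightarrow> \<phi> \<in> borel_measurable borel \<Longrightarrow> (\<And>x. x \<in> ball 0 1 \<Longrightarrow> \<bar>\<phi> x\<bar> \<le> B) \<Longrightarrow>
    feature_kernel (\<lambda>x y. A x y + \<phi> x * \<phi> y)"

lemma fk_plus: "feature_kernel B \<Longrightarrow> feature_kernel A \<Longrightarrow> feature_kernel (\<lambda>x y. A x y + B x y)"
proof (induction rule: feature_kernel.induct)
  case (fk_add B \<phi> C)
  from feature_kernel.fk_add[OF fk_add.IH[OF fk_add.prems] fk_add.hyps(2,3)]
  show ?case by (simp add: add.assoc)
qed simp

lemma fk_feature: "\<phi> \<in> borel_measurable borel \<Longrightarrow> (\<And>x. x \<in> ball 0 1 \<Longrightarrow> \<bar>\<phi> x\<bar> \<le> B) \<Longrightarrow> feature_kernel (\<lambda>x y. \<phi> x * \<phi> y)"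
  using fk_add[OF fk_zero, of \<phi> B] by simp

lemma fk_mult_feature:
  assumes "feature_kernel A" "\<phi> \<in> borel_measurable borel" "\<And>x. x \<in> ball 0 1 \<Longrightarrow> \<bar>\<phi> x\<bar> \<le> B"
  shows "feature_kernel (\<lambda>x y. A x y * (\<phi> x * \<phi> y))"
  using assms(1)
proof (induction rule: feature_kernel.induct)
  case fk_zero
  then show ?case by (simp add: feature_kernel.fk_zero)
next
  case (fk_add A \<psi> C)
  have "feature_kernel (\<lambda>x y. A x y * (\<phi> x * \<phi> y) + (\<psi> x * \<phi> x) * (\<psi> y * \<phi> y))"
  proof (rule feature_kernel.fk_add[OF fk_add.IH])
    show "(\<lambda>x. \<psi> x * \<phi> x) \<in> borel_measurable borel" using assms(2) fk_add.hyps(2) by measurable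
    show "\<bar>\<psi> x * \<phi> x\<bar> \<le> C * B" if "x \<in> ball 0 1" for x
      using fk_add.hyps(3)[OF that] assms(3)[OF that] unfolding abs_mult by (intro mult_mono) auto
  qed
  then show ?case by (simp add: algebra_simps)
qed

text \<open>A product of two features is again a feature, so the Schur product theorem reduces to
  distributivity for these kernels.\<close>

lemma fk_mult: "feature_kernel B \<Longrightarrow> feature_kernel A \<Longrightarrow> feature_kernel (\<lambda>x y. A x y * B x y)"
proof (induction rule: feature_kernel.induct)
  case fk_zero
  then show ?case by (simp add: feature_kernel.fk_zero)
next
  case (fk_add B \<phi> C)
  from fk_plus[OF fk_mult_feature[OF fk_add.prems fk_add.hyps(2,3)] fk_add.IH[OF fk_add.prems]]
  show ?case by (simp add: algebra_simps)
qed

lemma fk_power: "feature_kernel A \<Longrightarrow> feature_kernel (\<lambda>x y. A x y ^ k)"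
proof (induction k)
  case 0
  show ?case using fk_feature[of "\<lambda>_. 1" 1] by simp
next
  case (Suc k)
  then show ?case using fk_mult[of "\<lambda>x y. A x y ^ k" A] by simp
qed

lemma fk_scale: "feature_kernel A \<Longrightarrow> c \<ge> 0 \<Longrightarrow> feature_kernel (\<lambda>x y. c * A x y)"
  using fk_mult_feature[of A "\<lambda>_. sqrt c" "sqrt c"] by (simp add: mult.commute)

lemma fk_sum: "finite I \<Longrightarrow> (\<And>i. i \<in> I \<Longrightarrow> feature_kernel (A i)) \<Longrightarrow> feature_kernel (\<lambda>x y. \<Sum>i\<in>I. A i x y)"
proof (induction rule: finite_induct)
  case empty
  show ?case by (simp add: fk_zero)
next
  case (insert i I)
  then show ?case using fk_plus[of "\<lambda>x y. \<Sum>i\<in>I. A i x y" "A i"] by simp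
qed

lemma fk_Re:
  assumes "w \<in> borel_measurable borel" "\<And>x. x \<in> ball 0 1 \<Longrightarrow> cmod (w x) \<le> B"
  shows "feature_kernel (\<lambda>x y. Re (w x * cnj (w y)))"
proof -
  have "feature_kernel (\<lambda>x y. Re (w x) * Re (w y))" "feature_kernel (\<lambda>x y. Im (w x) * Im (w y))"
    using assms by (auto intro!: fk_feature[where B=B] intro: order_trans[OF abs_Re_le_cmod] order_trans[OF abs_Im_le_cmod])
  from fk_plus[OF this(2,1)] show ?thesis by simp
qed

lemma fk_measurable: "feature_kernel A \<Longrightarrow> (\<lambda>p. A (fst p) (snd p)) \<in> borel_measurable (borel \<Otimes>\<^sub>M borel)"
proof (induction rule: feature_kernel.induct)
  case (fk_add A \<phi> B)
  note [measurable] = fk_add.hyps(2) fk_add.IH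
  show ?case by measurable
qed simp

lemma fk_bounded: "feature_kernel A \<Longrightarrow> \<exists>B. \<forall>x\<in>ball 0 1. \<forall>y\<in>ball 0 1. \<bar>A x y\<bar> \<le> B"
proof (induction rule: feature_kernel.induct)
  case (fk_add A \<phi> C)
  then obtain B where B: "\<forall>x\<in>ball 0 1. \<forall>y\<in>ball 0 1. \<bar>A x y\<bar> \<le> B" by blast
  have "\<bar>A x y + \<phi> x * \<phi> y\<bar> \<le> B + C * C" if "x \<in> ball 0 1" "y \<in> ball 0 1" for x y
  proof -
    have "\<bar>\<phi> x * \<phi> y\<bar> \<le> C * C"
      using fk_add.hyps(3)[OF that(1)] fk_add.hyps(3)[OF that(2)] unfolding abs_mult by (intro mult_mono) auto
    then show ?thesis using B that abs_triangle_ineq[of "A x y" "\<phi> x * \<phi> y"] by fastforce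
  qed
  then show ?case by blast
qed auto

text \<open>With \<open>\<tau> x y = (1 - |x|\<^sup>2) (1 - |y|\<^sup>2) / |1 - x * cnj y|\<^sup>2\<close> the Green function is
  \<open>- ln (1 - \<tau>) / (4 * pi)\<close>; expanding the logarithm and the geometric series for
  \<open>1 / (1 - x * cnj y)\<close> exhibits it as a limit of feature kernels.\<close>

definition szego_part :: "nat \<Rightarrow> complex \<Rightarrow> complex \<Rightarrow> real" where
  "szego_part J x y = (cmod (\<Sum>j<J. (x * cnj y) ^ j))\<^sup>2"

definition green_ratio :: "complex \<Rightarrow> complex \<Rightarrow> real" where
  "green_ratio x y = (1 - (cmod x)\<^sup>2) * (1 - (cmod y)\<^sup>2) / (cmod (1 - x * cnj y))\<^sup>2"

lemma fk_szego_part: "feature_kernel (szego_part J)"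
proof -
  have "szego_part J = (\<lambda>x y. \<Sum>j<J. \<Sum>l<J. Re ((x ^ j * cnj x ^ l) * cnj (y ^ j * cnj y ^ l)))"
  proof (intro ext)
    fix x y
    let ?S = "\<Sum>j<J. (x * cnj y) ^ j"
    have "complex_of_real (szego_part J x y) = ?S * cnj ?S"
      unfolding szego_part_def by (rule complex_norm_square)
    also have "\<dots> = (\<Sum>j<J. \<Sum>l<J. (x ^ j * cnj x ^ l) * cnj (y ^ j * cnj y ^ l))"
      by (simp add: sum_product power_mult_distrib mult_ac)
    finally show "szego_part J x y = (\<Sum>j<J. \<Sum>l<J. Re ((x ^ j * cnj x ^ l) * cnj (y ^ j * cnj y ^ l)))"
      by (metis (no_types, lifting) Re_complex_of_real Re_sum sum.cong)
  qed
  moreover have "feature_kernel (\<lambda>x y. \<Sum>j<J. \<Sum>l<J. Re ((x ^ j * cnj x ^ l) * cnj (y ^ j * cnj y ^ l)))"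
  proof (intro fk_sum fk_Re[where B=1] finite_lessThan)
    show "(\<lambda>x. x ^ j * cnj x ^ l) \<in> borel_measurable borel" for j l by measurable
    show "cmod (x ^ j * cnj x ^ l) \<le> 1" if "x \<in> ball 0 1" for x j l
      using that by (auto simp: norm_mult norm_power intro!: mult_le_one power_le_one)
  qed
  ultimately show ?thesis by simp
qed

lemma fk_weight: "feature_kernel (\<lambda>x y. (1 - (cmod x)\<^sup>2) * (1 - (cmod y)\<^sup>2))"
  by (rule fk_feature[where B=1]) (auto simp: abs_square_le_1 abs_le_iff intro: order_trans[of _ 1])

text \<open>The bound 1, uniform in J, is what dominated convergence needs. With r = |x| |y| the
  geometric sum is at most 1 / (1 - r), and (1 - |x|^2) (1 - |y|^2) <= (1 - r)^2 because (|x| -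
  |y|)^2 >= 0.\<close>

lemma szego_part_bound:
  assumes "cmod x < 1" "cmod y < 1"
  shows "0 \<le> (1 - (cmod x)\<^sup>2) * (1 - (cmod y)\<^sup>2) * szego_part J x y"
    and "(1 - (cmod x)\<^sup>2) * (1 - (cmod y)\<^sup>2) * szego_part J x y \<le> 1"
proof -
  let ?a = "cmod x" and ?b = "cmod y"
  define r where "r = ?a * ?b"
  have r: "0 \<le> r" "r < 1" using assms mult_strict_mono[of ?a 1 ?b 1] by (auto simp: r_def)
  have "cmod (\<Sum>j<J. (x * cnj y) ^ j) \<le> (\<Sum>j<J. r ^ j)"
    by (rule order_trans[OF norm_sum]) (simp add: r_def norm_mult norm_power)
  also have "\<dots> = (1 - r ^ J) / (1 - r)" using r by (simp add: sum_gp_strict)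
  also have "\<dots> \<le> 1 / (1 - r)" using r by (intro divide_right_mono) auto
  finally have "cmod (\<Sum>j<J. (x * cnj y) ^ j) \<le> 1 / (1 - r)" .
  then have "szego_part J x y \<le> (1 / (1 - r))\<^sup>2" unfolding szego_part_def by (intro power_mono) auto
  then have "szego_part J x y * (1 - r)\<^sup>2 \<le> (1 / (1 - r))\<^sup>2 * (1 - r)\<^sup>2" by (rule mult_right_mono) simp
  then have s: "szego_part J x y * (1 - r)\<^sup>2 \<le> 1" using r by (simp add: power_divide)
  have w0: "0 \<le> (1 - ?a\<^sup>2) * (1 - ?b\<^sup>2)" using assms by (intro mult_nonneg_nonneg) (auto simp: abs_square_le_1)
  have "(1 - ?a\<^sup>2) * (1 - ?b\<^sup>2) \<le> (1 - r)\<^sup>2"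
    using zero_le_power2[of "?a - ?b"] by (simp add: r_def power2_eq_square algebra_simps)
  then have "(1 - ?a\<^sup>2) * (1 - ?b\<^sup>2) * szego_part J x y \<le> (1 - r)\<^sup>2 * szego_part J x y"
    by (rule mult_right_mono) (simp add: szego_part_def)
  then show "(1 - ?a\<^sup>2) * (1 - ?b\<^sup>2) * szego_part J x y \<le> 1" using s by (simp add: mult.commute)
  show "0 \<le> (1 - ?a\<^sup>2) * (1 - ?b\<^sup>2) * szego_part J x y"
    using w0 by (rule mult_nonneg_nonneg) (simp add: szego_part_def)
qed

lemma szego_part_tendsto:
  assumes "cmod x < 1" "cmod y < 1"
  shows "(\<lambda>J. (1 - (cmod x)\<^sup>2) * (1 - (cmod y)\<^sup>2) * szego_part J x y) \<longlonglongrightarrow> green_ratio x y"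
proof -
  have "cmod (x * cnj y) < 1" using assms mult_strict_mono[of "cmod x" 1 "cmod y" 1] by (simp add: norm_mult)
  then have "(\<lambda>J. \<Sum>j<J. (x * cnj y) ^ j) \<longlonglongrightarrow> 1 / (1 - x * cnj y)"
    using geometric_sums[of "x * cnj y"] by (simp add: sums_def)
  then have "(\<lambda>J. (1 - (cmod x)\<^sup>2) * (1 - (cmod y)\<^sup>2) * szego_part J x y) \<longlonglongrightarrow> (1 - (cmod x)\<^sup>2) * (1 - (cmod y)\<^sup>2) * (cmod (1 / (1 - x * cnj y)))\<^sup>2"
    unfolding szego_part_def by (intro tendsto_intros)
  then show ?thesis by (simp add: green_ratio_def norm_divide power_divide)
qed

text \<open>By \<open>cmod_one_minus_squared\<close>, 1 - \<open>green_ratio x y\<close> is |x -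
  y|^2 / |1 - x * cnj y|^2, so the logarithm series applies. Its index may start at 0 because
  division by \<open>real 0\<close> yields 0 and the extra term vanishes.\<close>

lemma green_ratio_series:
  assumes "cmod x < 1" "cmod y < 1" "x \<noteq> y"
  shows "0 \<le> green_ratio x y" "(\<lambda>k. green_ratio x y ^ k / real k) sums (4 * pi * green x y)"
proof -
  have p: "(1 - (cmod x)\<^sup>2) * (1 - (cmod y)\<^sup>2) > 0" using assms by (intro mult_pos_pos) (auto simp: abs_square_less_1)
  let ?d = "(cmod (1 - x * cnj y))\<^sup>2"
  have xy: "(cmod (x - y))\<^sup>2 > 0" using assms by simp
  have d: "?d > 0" using cmod_one_minus_squared[of x y] p xy by linarith
  show 0: "0 \<le> green_ratio x y" using p d by (simp add: green_ratio_def)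
  have one: "1 - green_ratio x y = (cmod (x - y))\<^sup>2 / ?d"
  proof -
    have "(1 - (cmod x)\<^sup>2) * (1 - (cmod y)\<^sup>2) = ?d - (cmod (x - y))\<^sup>2" using cmod_one_minus_squared[of x y] by linarith
    then show ?thesis unfolding green_ratio_def using d by (simp only: diff_divide_distrib) simp
  qed
  then have lt: "green_ratio x y < 1" using d xy by (smt (verit) divide_pos_pos)
  have "4 * pi * green x y = - ln (1 - green_ratio x y)"
  proof -
    have "ln ((cmod (x - y))\<^sup>2 / ?d) = 2 * ln (cmod (x - y)) - 2 * ln (cmod (1 - x * cnj y))"
      using d xy by (simp add: ln_div ln_realpow)
    then show ?thesis unfolding one using assms by (simp add: green_def)
  qed
  moreover have "(\<lambda>k. - (green_ratio x y ^ k / real k)) sums ln (1 - green_ratio x y)"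
    using ln_series'[of "- green_ratio x y"] 0 lt by simp
  ultimately show "(\<lambda>k. green_ratio x y ^ k / real k) sums (4 * pi * green x y)"
    using sums_minus by fastforce
qed

context
  fixes a :: real
  assumes a: "0 \<le> a"
begin

interpretation finite_measure "disc_measure a" by (rule finite_measure_disc_measure[OF a])
interpretation P: pair_sigma_finite "disc_measure a" "disc_measure a" ..

text \<open>By Fubini each feature contributes the square of the integral of \<phi> h.\<close>

lemma feature_kernel_psd:
  assumes "feature_kernel A" and h: "bdd_borel h"
  shows "0 \<le> (\<integral>p. A (fst p) (snd p) * h (fst p) * h (snd p) \<partial>(disc_measure a \<Otimes>\<^sub>M disc_measure a))"
  using assms(1)
proof (induction rule: feature_kernel.induct)
  case (fk_add A \<phi> B)
  have [measurable]: "h \<in> borel_measurable borel" using h by measurable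
  obtain D where D: "D \<ge> 0" "\<And>x. \<bar>h x\<bar> \<le> D" using bdd_borelE[OF h] by blast
  note [measurable] = fk_add.hyps(2) fk_measurable[OF fk_add.hyps(1)]
  obtain C where C: "\<And>x y. x \<in> ball 0 1 \<Longrightarrow> y \<in> ball 0 1 \<Longrightarrow> \<bar>A x y\<bar> \<le> C" using fk_bounded[OF fk_add.hyps(1)] by blast
  have i1: "integrable (disc_measure a \<Otimes>\<^sub>M disc_measure a) (\<lambda>p. A (fst p) (snd p) * h (fst p) * h (snd p))"
  proof (rule integrable_pair_bounded[OF a])
    show "\<bar>A (fst (x,y)) (snd (x,y)) * h (fst (x,y)) * h (snd (x,y))\<bar> \<le> C * D * D" if "x \<in> ball 0 1" "y \<in> ball 0 1" for x y
    proof -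
      have "0 \<le> C" using C[OF that] by linarith
      then show ?thesis using C[OF that] D by (simp add: abs_mult) (intro mult_mono, auto)
    qed
  qed measurable
  have i2: "integrable (disc_measure a \<Otimes>\<^sub>M disc_measure a) (\<lambda>p. (\<phi> (fst p) * h (fst p)) * (\<phi> (snd p) * h (snd p)))"
  proof (rule integrable_pair_bounded[OF a])
    show "\<bar>(\<phi> (fst (x,y)) * h (fst (x,y))) * (\<phi> (snd (x,y)) * h (snd (x,y)))\<bar> \<le> (B * D) * (B * D)" if "x \<in> ball 0 1" "y \<in> ball 0 1" for x y
    proof -
      have "0 \<le> B" using fk_add.hyps(3)[OF that(1)] by linarith
      then show ?thesis using fk_add.hyps(3)[OF that(1)] fk_add.hyps(3)[OF that(2)] D
        by (simp add: abs_mult) (intro mult_mono mult_nonneg_nonneg, auto)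
    qed
  qed measurable
  have e2: "(\<integral>p. (\<phi> (fst p) * h (fst p)) * (\<phi> (snd p) * h (snd p)) \<partial>(disc_measure a \<Otimes>\<^sub>M disc_measure a)) = (\<integral>x. \<phi> x * h x \<partial>disc_measure a) * (\<integral>x. \<phi> x * h x \<partial>disc_measure a)"
    using P.integral_fst'[OF i2] by simp
  have "(\<integral>p. (A (fst p) (snd p) + \<phi> (fst p) * \<phi> (snd p)) * h (fst p) * h (snd p) \<partial>(disc_measure a \<Otimes>\<^sub>M disc_measure a))
     = (\<integral>p. A (fst p) (snd p) * h (fst p) * h (snd p) + (\<phi> (fst p) * h (fst p)) * (\<phi> (snd p) * h (snd p)) \<partial>(disc_measure a \<Otimes>\<^sub>M disc_measure a))"
    by (intro Bochner_Integration.integral_cong refl) (simp add: algebra_simps)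
  also have "\<dots> = (\<integral>p. A (fst p) (snd p) * h (fst p) * h (snd p) \<partial>(disc_measure a \<Otimes>\<^sub>M disc_measure a)) + (\<integral>x. \<phi> x * h x \<partial>disc_measure a) * (\<integral>x. \<phi> x * h x \<partial>disc_measure a)"
    by (simp only: Bochner_Integration.integral_add[OF i1 i2] e2)
  finally show ?case using fk_add.IH by simp
qed simp

lemma psd_limit:
  fixes A :: "nat \<Rightarrow> complex \<Rightarrow> complex \<Rightarrow> real"
  assumes psd: "\<And>i. 0 \<le> (\<integral>p. A i (fst p) (snd p) * h (fst p) * h (snd p) \<partial>(disc_measure a \<Otimes>\<^sub>M disc_measure a))"
    and h: "bdd_borel h"
    and m: "\<And>i. (\<lambda>p. A i (fst p) (snd p)) \<in> borel_measurable (borel \<Otimes>\<^sub>M borel)" "(\<lambda>p. K (fst p) (snd p)) \<in> borel_measurable (borel \<Otimes>\<^sub>M borel)"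
    and W: "integrable (disc_measure a \<Otimes>\<^sub>M disc_measure a) (\<lambda>p. W p)"
    and lim: "\<And>x y. x \<in> ball 0 1 \<Longrightarrow> y \<in> ball 0 1 \<Longrightarrow> x \<noteq> y \<Longrightarrow> (\<lambda>i. A i x y) \<longlonglongrightarrow> K x y"
    and dom: "\<And>i x y. x \<in> ball 0 1 \<Longrightarrow> y \<in> ball 0 1 \<Longrightarrow> x \<noteq> y \<Longrightarrow> \<bar>A i x y * h x * h y\<bar> \<le> W (x,y)"
  shows "0 \<le> (\<integral>p. K (fst p) (snd p) * h (fst p) * h (snd p) \<partial>(disc_measure a \<Otimes>\<^sub>M disc_measure a))"
proof -
  have [measurable]: "h \<in> borel_measurable borel" using h by measurable
  note [measurable] = m
  have "(\<lambda>i. \<integral>p. A i (fst p) (snd p) * h (fst p) * h (snd p) \<partial>(disc_measure a \<Otimes>\<^sub>M disc_measure a)) \<longlonglongrightarrow>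
     (\<integral>p. K (fst p) (snd p) * h (fst p) * h (snd p) \<partial>(disc_measure a \<Otimes>\<^sub>M disc_measure a))"
  proof (rule integral_dominated_convergence[where w=W])
    show "AE p in disc_measure a \<Otimes>\<^sub>M disc_measure a. (\<lambda>i. A i (fst p) (snd p) * h (fst p) * h (snd p)) \<longlonglongrightarrow> K (fst p) (snd p) * h (fst p) * h (snd p)"
      using AE_pair_ball[OF a] by eventually_elim (intro tendsto_mult tendsto_const lim, auto)
    show "AE p in disc_measure a \<Otimes>\<^sub>M disc_measure a. norm (A i (fst p) (snd p) * h (fst p) * h (snd p)) \<le> W p" for i
      using AE_pair_ball[OF a] by eventually_elim (use dom in force)
  qed (use W in measurable)
  then show ?thesis by (rule LIMSEQ_le_const) (use psd in auto)
qed

lemma energy_nonneg: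
  assumes h: "bdd_borel h"
  shows "0 \<le> energy a h h"
proof -
  have [measurable]: "h \<in> borel_measurable borel" using h by measurable
  obtain D where D: "D \<ge> 0" "\<And>x. \<bar>h x\<bar> \<le> D" using bdd_borelE[OF h] by blast
  have DD: "\<bar>h x * h y\<bar> \<le> D * D" for x y using D unfolding abs_mult by (intro mult_mono) auto
  let ?w = "\<lambda>x y. (1 - (cmod x)\<^sup>2) * (1 - (cmod y)\<^sup>2)"
  let ?AJ = "\<lambda>K J x y. \<Sum>k<K. 1 / real k * (?w x y * szego_part J x y) ^ k"
  let ?A = "\<lambda>K x y. \<Sum>k<K. 1 / real k * green_ratio x y ^ k"
  have mr [measurable]: "(\<lambda>p. green_ratio (fst p) (snd p)) \<in> borel_measurable (borel \<Otimes>\<^sub>M borel)"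
    unfolding green_ratio_def by measurable
  have fk: "feature_kernel (?AJ K J)" for K J
    by (intro fk_sum fk_scale fk_power fk_mult[OF fk_szego_part fk_weight] finite_lessThan) simp
  \<comment> \<open>First limit, J to infinity in the geometric series with K fixed: every summand
    lies between 0 and 1, so a constant dominates.\<close>
  have 1: "0 \<le> (\<integral>p. ?A K (fst p) (snd p) * h (fst p) * h (snd p) \<partial>(disc_measure a \<Otimes>\<^sub>M disc_measure a))" for K
  proof (rule psd_limit[OF feature_kernel_psd[OF fk h] h fk_measurable[OF fk], where W="\<lambda>_. real K * (D * D)"])
    show "(\<lambda>p. ?A K (fst p) (snd p)) \<in> borel_measurable (borel \<Otimes>\<^sub>M borel)" by measurable
    show "integrable (disc_measure a \<Otimes>\<^sub>M disc_measure a) (\<lambda>_. real K * (D * D))"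
      by (rule integrable_pair_bounded[OF a, where B="real K * (D * D)"]) (use D in auto)
    fix x y :: complex assume xy: "x \<in> ball 0 1" "y \<in> ball 0 1" "x \<noteq> y"
    have "(\<lambda>J. ?w x y * szego_part J x y) \<longlonglongrightarrow> green_ratio x y"
      using xy by (intro szego_part_tendsto) simp_all
    then have "(\<lambda>J. 1 / real k * (?w x y * szego_part J x y) ^ k) \<longlonglongrightarrow> 1 / real k * green_ratio x y ^ k" for k
      by (rule tendsto_mult[OF tendsto_const tendsto_power])
    then show "(\<lambda>J. ?AJ K J x y) \<longlonglongrightarrow> ?A K x y" by (rule tendsto_sum)
    have "\<bar>?AJ K J x y\<bar> \<le> real K" for J
    proof -
      have "\<bar>1 / real k * (?w x y * szego_part J x y) ^ k\<bar> \<le> 1" for k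
      proof -
        define t where "t = ?w x y * szego_part J x y"
        have t: "0 \<le> t" "t \<le> 1" using szego_part_bound[of x y J] xy by (simp_all add: t_def)
        have "1 / real k \<le> 1" by (cases k) (simp_all add: divide_simps)
        then have "1 / real k * t ^ k \<le> 1" by (rule mult_le_one) (simp_all add: t power_le_one)
        moreover have "0 \<le> 1 / real k * t ^ k" using t by simp
        ultimately show ?thesis unfolding t_def[symmetric] by linarith
      qed
      then have "\<bar>?AJ K J x y\<bar> \<le> (\<Sum>k<K. 1)" by (intro order_trans[OF sum_abs] sum_mono)
      then show ?thesis by simp
    qed
    then show "\<bar>?AJ K J x y * h x * h y\<bar> \<le> real K * (D * D)" for J
      using mult_mono[OF _ DD[of x y], of "\<bar>?AJ K J x y\<bar>" "real K"] by (simp add: abs_mult mult.assoc)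
  qed
  \<comment> \<open>Second limit, K to infinity in the logarithm series: its terms are nonnegative,
    so the partial sums are dominated by the Green function itself, which is integrable over
    pairs.\<close>
  have "0 \<le> (\<integral>p. (4 * pi * green (fst p) (snd p)) * h (fst p) * h (snd p) \<partial>(disc_measure a \<Otimes>\<^sub>M disc_measure a))"
  proof (rule psd_limit[OF 1 h, where W="\<lambda>p. (4 * pi) * (green (fst p) (snd p) * \<bar>h (fst p)\<bar> * \<bar>h (snd p)\<bar>)"])
    have "bdd_borel (\<lambda>x. \<bar>h x\<bar>)" using D unfolding bdd_borel_def by auto
    then show "integrable (disc_measure a \<Otimes>\<^sub>M disc_measure a) (\<lambda>p. (4 * pi) * (green (fst p) (snd p) * \<bar>h (fst p)\<bar> * \<bar>h (snd p)\<bar>))"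
      by (intro integrable_mult_right integrable_green_pair[OF a])
    fix x y :: complex assume xy: "x \<in> ball 0 1" "y \<in> ball 0 1" "x \<noteq> y"
    have s: "0 \<le> green_ratio x y" "(\<lambda>k. green_ratio x y ^ k / real k) sums (4 * pi * green x y)"
      using green_ratio_series xy by auto
    then show "(\<lambda>K. ?A K x y) \<longlonglongrightarrow> 4 * pi * green x y" by (simp add: sums_def)
    have "?A K x y \<le> 4 * pi * green x y" for K
      using sum_le_suminf[OF sums_summable[OF s(2)], of "{..<K}"] s by (simp add: sums_iff)
    moreover have "0 \<le> ?A K x y" for K using s(1) by (intro sum_nonneg) simp
    ultimately have "\<bar>?A K x y\<bar> * (\<bar>h x\<bar> * \<bar>h y\<bar>) \<le> 4 * pi * green x y * (\<bar>h x\<bar> * \<bar>h y\<bar>)" for K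
      by (intro mult_right_mono) auto
    then show "\<bar>?A K x y * h x * h y\<bar> \<le> 4 * pi * (green (fst (x,y)) (snd (x,y)) * \<bar>h (fst (x,y))\<bar> * \<bar>h (snd (x,y))\<bar>)" for K
      by (simp add: abs_mult mult.assoc)
  qed measurable
  also have "\<dots> = 4 * pi * energy a h h"
    unfolding energy_pair[OF a h h] by (simp add: mult.assoc)
  finally show ?thesis using pi_gt_zero by (auto simp: zero_le_mult_iff)
qed

lemma energy_Cauchy_Schwarz:
  assumes f: "bdd_borel f" and g: "bdd_borel g"
  shows "(energy a f g)\<^sup>2 \<le> energy a f f * energy a g g"
proof -
  have q: "0 \<le> energy a f f + 2 * t * energy a f g + t\<^sup>2 * energy a g g" for t
  proof -
    note l = bdd_borel_linear[OF f g, of t]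
    have "energy a (\<lambda>x. f x + t * g x) (\<lambda>x. f x + t * g x) = energy a f (\<lambda>x. f x + t * g x) + t * energy a g (\<lambda>x. f x + t * g x)"
      by (rule energy_linear[OF a f g l])
    also have "energy a f (\<lambda>x. f x + t * g x) = energy a f f + t * energy a f g"
      using energy_commute[OF a f l] energy_linear[OF a f g f, of t] energy_commute[OF a g f] by simp
    also have "energy a g (\<lambda>x. f x + t * g x) = energy a f g + t * energy a g g"
      using energy_commute[OF a g l] energy_linear[OF a f g g, of t] by simp
    finally show ?thesis using energy_nonneg[OF l] by (simp add: algebra_simps power2_eq_square)
  qed
  show ?thesis
  proof (cases "energy a g g = 0")
    case True
    have "energy a f g = 0"
    proof (rule ccontr)
      assume n: "energy a f g \<noteq> 0"
      \<comment> \<open>The form is only known to be semidefinite. If g has zero energy, the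
        polynomial in t is affine, and this t would give it the value -1.\<close>
      have "2 * (- (energy a f f + 1) / (2 * energy a f g)) * energy a f g = - (energy a f f + 1)" using n by (simp add: field_simps)
      then show False using q[of "- (energy a f f + 1) / (2 * energy a f g)"] True by simp
    qed
    then show ?thesis using True by simp
  next
    case False
    then have gp: "energy a g g > 0" using energy_nonneg[OF g] by simp
    have "0 \<le> energy a f f - (energy a f g)\<^sup>2 / energy a g g"
      using q[of "- energy a f g / energy a g g"] gp by (simp add: field_simps power2_eq_square)
    then show ?thesis using gp by (simp add: field_simps)
  qed
qed

end

section \<open>The constrained maximization problem\<close>

definition admissible :: "(complex \<Rightarrow> real) \<Rightarrow> bool" where
  "admissible h \<longleftrightarrow> bdd_borel h \<and> (\<forall>x. 0 \<le> h x)"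

text \<open>The exponent 1 + 1/p is conjugate to p + 1, so for h = u^p the integrand is
  u^(p+1).\<close>

definition mass :: "real \<Rightarrow> real \<Rightarrow> (complex \<Rightarrow> real) \<Rightarrow> real" where
  "mass a p h = (\<integral>x. h x powr (1 + 1/p) \<partial>disc_measure a)"

definition max_energy :: "real \<Rightarrow> real \<Rightarrow> real" where
  "max_energy a p = Sup {energy a h h | h. admissible h \<and> mass a p h \<le> 1}"

lemma admissible_bdd: "admissible h \<Longrightarrow> bdd_borel h"
  and admissible_nonneg: "admissible h \<Longrightarrow> 0 \<le> h x"
  by (simp_all add: admissible_def)

lemma admissible_measurable [measurable_dest]: "admissible h \<Longrightarrow> h \<in> borel_measurable borel"
  by (simp add: admissible_def bdd_borel_def)

lemma admissibleE:
  assumes "admissible h" obtains B where "B \<ge> 0" "\<And>x. 0 \<le> h x" "\<And>x. h x \<le> B"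
  using assms bdd_borelE[of h] unfolding admissible_def by (metis abs_of_nonneg)

lemma admissibleI: "h \<in> borel_measurable borel \<Longrightarrow> (\<And>x. 0 \<le> h x) \<Longrightarrow> (\<And>x. h x \<le> B) \<Longrightarrow> admissible h"
  unfolding admissible_def bdd_borel_def by (metis abs_of_nonneg)

lemma admissible_powr: "admissible h \<Longrightarrow> 0 \<le> s \<Longrightarrow> admissible (\<lambda>x. h x powr s)"
proof -
  assume h: "admissible h" and s: "0 \<le> s"
  obtain B where B: "B \<ge> 0" "\<And>x. 0 \<le> h x" "\<And>x. h x \<le> B" using admissibleE[OF h] by blast
  have [measurable]: "h \<in> borel_measurable borel" using h by measurable
  show ?thesis using B s by (intro admissibleI[where B="B powr s"] powr_mono2) auto
qed

lemma admissible_scale: "admissible h \<Longrightarrow> 0 \<le> c \<Longrightarrow> admissible (\<lambda>x. c * h x)"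
proof -
  assume h: "admissible h" and c: "0 \<le> c"
  obtain B where B: "B \<ge> 0" "\<And>x. 0 \<le> h x" "\<And>x. h x \<le> B" using admissibleE[OF h] by blast
  have [measurable]: "h \<in> borel_measurable borel" using h by measurable
  show ?thesis using B c by (intro admissibleI[where B="c * B"]) (auto intro: mult_left_mono)
qed

lemma admissible_const: "0 \<le> c \<Longrightarrow> admissible (\<lambda>_. c)"
  by (simp add: admissible_def)

lemma mass_scale: "0 \<le> c \<Longrightarrow> admissible h \<Longrightarrow> mass a p (\<lambda>x. c * h x) = c powr (1 + 1/p) * mass a p h"
  unfolding mass_def by (simp add: powr_mult admissible_nonneg)

text \<open>The density is positive on the disc except at the origin, so the null sets do not depend
  on the exponent.\<close>

lemma AE_disc_measure_iff: "(AE z in disc_measure a. P z) \<longleftrightarrow> (AE z in lborel. z \<in> ball 0 1 \<longrightarrow> P z)"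
proof -
  have "(AE z in disc_measure a. P z) \<longleftrightarrow> (AE z in lborel. z \<in> ball 0 1 \<and> z \<noteq> 0 \<longrightarrow> P z)"
    unfolding disc_measure_def by (subst AE_density) (auto simp: indicator_def intro!: AE_cong)
  also have "\<dots> \<longleftrightarrow> (AE z in lborel. z \<in> ball 0 1 \<longrightarrow> P z)"
  proof
    assume "AE z in lborel. z \<in> ball 0 1 \<and> z \<noteq> 0 \<longrightarrow> P z"
    then show "AE z in lborel. z \<in> ball 0 1 \<longrightarrow> P z"
      using AE_lborel_singleton[of 0] by eventually_elim auto
  qed (auto elim: eventually_mono)
  finally show ?thesis .
qed

lemma not_AE_disc_measure_False: "\<not> (AE z in disc_measure a. False)"
proof
  assume "AE z in disc_measure a. False"
  then have "AE z in (lborel :: complex measure). z \<notin> ball 0 1" by (simp add: AE_disc_measure_iff)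
  then have "emeasure lborel (ball (0::complex) 1) = 0"
    by (subst (asm) AE_iff_measurable[of "ball 0 1"]) auto
  then show False by (simp add: emeasure_ball unit_ball_vol_2)
qed

context
  fixes a p :: real
  assumes a: "0 \<le> a" and p: "1 < p"
begin

interpretation finite_measure "disc_measure a" by (rule finite_measure_disc_measure[OF a])

lemma integrable_admissible: "admissible h \<Longrightarrow> integrable (disc_measure a) h"
proof -
  assume h: "admissible h"
  obtain B where B: "B \<ge> 0" "\<And>x. 0 \<le> h x" "\<And>x. h x \<le> B" using admissibleE[OF h] by blast
  have [measurable]: "h \<in> borel_measurable borel" using h by measurable
  show ?thesis using B by (intro integrable_const_bound[where B=B]) auto
qed

lemma exponent_pos: "0 < 1 + 1/p"
  using p by (simp add: add_pos_pos)

lemma young_conjugate: "0 \<le> s \<Longrightarrow> 0 \<le> t \<Longrightarrow> s * t \<le> s powr (p+1) / (p+1) + t powr (1 + 1/p) / (1 + 1/p)"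
  using p by (intro Youngs_inequality) (auto simp: field_simps)

lemma mass_nonneg: "0 \<le> mass a p h"
  unfolding mass_def by (intro integral_nonneg_AE) auto

text \<open>The source of compactness. The bounds involve h only through its mass, hence are uniform
  along a maximizing sequence. The exponent 1/(p+1) is chosen for Young's inequality: the (p+1)-th
  power of |x - y|^(-1/(p+1)) is |x - y|^(-1), which is integrable.\<close>

lemma potential_hoelder:
  "\<exists>C>0. \<forall>h. admissible h \<longrightarrow>
     (\<forall>x x'. cmod x \<le> 1 \<longrightarrow> cmod x' \<le> 1 \<longrightarrow> \<bar>potential a h x - potential a h x'\<bar> \<le> C * (1 + mass a p h) * cmod (x - x') powr (1/(p+1))) \<and>
     (\<forall>x. cmod x \<le> 1 \<longrightarrow> 0 \<le> potential a h x \<and> potential a h x \<le> C * (1 + mass a p h))"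
proof -
  define \<gamma> where "\<gamma> = 1 / (p + 1)"
  have \<gamma>: "0 < \<gamma>" "\<gamma> \<le> 1" using p by (auto simp: \<gamma>_def)
  obtain C where C: "C > 0" "\<And>x. cmod x \<le> 1 \<Longrightarrow> integrable (disc_measure a) (\<lambda>y. cmod (x - y) powr (-1))"
    "\<And>x. cmod x \<le> 1 \<Longrightarrow> (\<integral>y. cmod (x - y) powr (-1) \<partial>disc_measure a) \<le> C"
    using disc_kernel_integrable[of 1] a by (metis one_less_numeral_iff semiring_norm(76))
  define c where "c = 1 / (pi * \<gamma>)"
  have c: "c > 0" using \<gamma> by (simp add: c_def)
  define D where "D = 2 * c * (C + 1)"
  have D: "D > 0" using c C by (simp add: D_def)
  have yb: "cmod (x - y) powr (-\<gamma>) * h y \<le> cmod (x - y) powr (-1) + h y powr (1+1/p)" if "admissible h" for h x y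
  proof -
    have "cmod (x - y) powr (-\<gamma>) * h y \<le> (cmod (x - y) powr (-\<gamma>)) powr (p+1) / (p+1) + h y powr (1+1/p) / (1+1/p)"
      using that by (intro young_conjugate) (auto simp: admissible_nonneg)
    also have "(cmod (x - y) powr (-\<gamma>)) powr (p+1) = cmod (x - y) powr (-1)" using p by (simp add: powr_powr \<gamma>_def)
    also have "cmod (x - y) powr (-1) / (p+1) + h y powr (1+1/p) / (1+1/p) \<le> cmod (x - y) powr (-1) / 1 + h y powr (1+1/p) / 1"
      using p exponent_pos by (intro add_mono divide_left_mono) auto
    finally show ?thesis by simp
  qed
  have i: "integrable (disc_measure a) (\<lambda>y. cmod (x - y) powr (-1) + h y powr (1+1/p))" if "admissible h" "cmod x \<le> 1" for h x
    using that p by (intro Bochner_Integration.integrable_add C(2) integrable_admissible admissible_powr) auto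
  have ib: "(\<integral>y. cmod (x - y) powr (-1) + h y powr (1+1/p) \<partial>disc_measure a) \<le> C + mass a p h" if "admissible h" "cmod x \<le> 1" for h x
  proof -
    have "integrable (disc_measure a) (\<lambda>y. h y powr (1+1/p))"
      using that(1) exponent_pos by (intro integrable_admissible admissible_powr) auto
    from Bochner_Integration.integral_add[OF C(2)[OF that(2)] this] C(3)[OF that(2)]
    show ?thesis unfolding mass_def by linarith
  qed
  have CD: "C + mass a p h \<le> (C + 1) * (1 + mass a p h)" for h
    using C(1) mass_nonneg[of h] by (simp add: algebra_simps)
  have 1: "\<bar>potential a h x - potential a h x'\<bar> \<le> D * (1 + mass a p h) * cmod (x - x') powr \<gamma>"
    if h: "admissible h" and x: "cmod x \<le> 1" "cmod x' \<le> 1" for h x x'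
  proof -
    let ?d = "cmod (x - x') powr \<gamma>"
    let ?g = "\<lambda>x y. cmod (x - y) powr (-1) + h y powr (1+1/p)"
    note ig = integrable_green_mult[OF a admissible_bdd[OF h]]
    have "\<bar>potential a h x - potential a h x'\<bar> = \<bar>\<integral>y. green x y * h y - green x' y * h y \<partial>disc_measure a\<bar>"
      unfolding potential_def using ig x by simp
    also have "\<dots> \<le> (\<integral>y. \<bar>green x y * h y - green x' y * h y\<bar> \<partial>disc_measure a)" by (rule integral_abs_bound)
    also have "\<dots> \<le> (\<integral>y. c * ?d * (?g x y + ?g x' y) \<partial>disc_measure a)"
    proof (rule integral_mono_AE)
      show "integrable (disc_measure a) (\<lambda>y. \<bar>green x y * h y - green x' y * h y\<bar>)" using ig x by auto
      show "integrable (disc_measure a) (\<lambda>y. c * ?d * (?g x y + ?g x' y))"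
        by (rule integrable_mult_right, rule Bochner_Integration.integrable_add; rule i[OF h]; rule x)
      show "AE y in disc_measure a. \<bar>green x y * h y - green x' y * h y\<bar> \<le> c * ?d * (?g x y + ?g x' y)"
        using AE_disc_measure AE_disc_measure_neq[of x] AE_disc_measure_neq[of x']
      proof eventually_elim
        case (elim y)
        have h0: "0 \<le> h y" using h by (simp add: admissible_nonneg)
        have "\<bar>green x y * h y - green x' y * h y\<bar> = \<bar>green x y - green x' y\<bar> * h y"
          using h0 by (simp add: abs_mult left_diff_distrib[symmetric])
        also have "\<dots> \<le> (c * ?d * (cmod (x - y) powr (-\<gamma>) + cmod (x' - y) powr (-\<gamma>))) * h y"
          unfolding c_def using elim x \<gamma> h0 by (intro mult_right_mono green_diff_le_powr) auto
        also have "\<dots> = c * ?d * (cmod (x - y) powr (-\<gamma>) * h y + cmod (x' - y) powr (-\<gamma>) * h y)" by (simp add: algebra_simps)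
        also have "\<dots> \<le> c * ?d * (?g x y + ?g x' y)"
          using c by (intro mult_left_mono add_mono yb[OF h]) auto
        finally show ?case .
      qed
    qed
    also have "\<dots> = c * ?d * ((\<integral>y. ?g x y \<partial>disc_measure a) + (\<integral>y. ?g x' y \<partial>disc_measure a))"
      by (simp only: integral_mult_right_zero Bochner_Integration.integral_add[OF i[OF h x(1)] i[OF h x(2)]])
    also have "\<dots> \<le> c * ?d * ((C + 1) * (1 + mass a p h) + (C + 1) * (1 + mass a p h))"
      using c by (intro mult_left_mono add_mono order_trans[OF ib[OF h] CD] x) auto
    also have "\<dots> = D * (1 + mass a p h) * ?d" by (simp add: D_def algebra_simps)
    finally show ?thesis .
  qed
  have 2: "0 \<le> potential a h x" if h: "admissible h" and x: "cmod x \<le> 1" for h x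
  proof -
    have "AE y in disc_measure a. 0 \<le> green x y * h y"
      using AE_disc_measure by eventually_elim (use x h in \<open>auto intro!: mult_nonneg_nonneg green_nonneg simp: admissible_nonneg\<close>)
    then show ?thesis unfolding potential_def by (rule integral_nonneg_AE)
  qed
  have 3: "potential a h x \<le> D * (1 + mass a p h)" if h: "admissible h" and x: "cmod x \<le> 1" for h x
  proof -
    have "potential a h x \<le> (\<integral>y. c * (cmod (x - y) powr (-1) + h y powr (1+1/p)) \<partial>disc_measure a)"
      unfolding potential_def
    proof (rule integral_mono_AE)
      show "integrable (disc_measure a) (\<lambda>y. green x y * h y)" by (rule integrable_green_mult[OF a admissible_bdd[OF h] x])
      show "integrable (disc_measure a) (\<lambda>y. c * (cmod (x - y) powr (-1) + h y powr (1+1/p)))"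
        using i[OF h x] by (rule integrable_mult_right)
      show "AE y in disc_measure a. green x y * h y \<le> c * (cmod (x - y) powr (-1) + h y powr (1+1/p))"
        using AE_disc_measure AE_disc_measure_neq[of x]
      proof eventually_elim
        case (elim y)
        have h0: "0 \<le> h y" using h by (simp add: admissible_nonneg)
        have "green x y * h y \<le> (c * cmod (x - y) powr (-\<gamma>)) * h y"
          unfolding c_def using elim x \<gamma> h0 by (intro mult_right_mono green_le_powr) auto
        also have "\<dots> \<le> c * (cmod (x - y) powr (-1) + h y powr (1+1/p))"
          using c yb[OF h, of x y] by (simp add: mult.assoc)
        finally show ?case .
      qed
    qed
    also have "\<dots> = c * (\<integral>y. cmod (x - y) powr (-1) + h y powr (1+1/p) \<partial>disc_measure a)" by simp
    also have "\<dots> \<le> c * ((C + 1) * (1 + mass a p h))"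
      using c by (intro mult_left_mono order_trans[OF ib[OF h x] CD]) auto
    also have "\<dots> \<le> 2 * (c * ((C + 1) * (1 + mass a p h)))"
      using c C(1) mass_nonneg[of h] by (simp add: mult_nonneg_nonneg)
    also have "\<dots> = D * (1 + mass a p h)" by (simp add: D_def)
    finally show ?thesis .
  qed
  show ?thesis using D 1 2 3 by (intro exI[of _ D]) (auto simp: \<gamma>_def)
qed

lemma measurable_potential [measurable]: "bdd_borel h \<Longrightarrow> potential a h \<in> borel_measurable borel"
proof -
  assume "bdd_borel h"
  then have [measurable]: "h \<in> borel_measurable borel" by measurable
  have "(\<lambda>p. green (fst p) (snd p) * h (snd p)) \<in> borel_measurable (borel \<Otimes>\<^sub>M disc_measure a)" by measurable
  then show ?thesis unfolding potential_def
    by (intro borel_measurable_lebesgue_integral) (simp add: case_prod_beta)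
qed

lemma integrable_mult_bounded:
  assumes "bdd_borel f" "bdd_borel g"
  shows "integrable (disc_measure a) (\<lambda>x. f x * g x)"
proof -
  obtain B where B: "B \<ge> 0" "\<And>x. \<bar>f x\<bar> \<le> B" using bdd_borelE[OF assms(1)] by blast
  obtain C where C: "C \<ge> 0" "\<And>x. \<bar>g x\<bar> \<le> C" using bdd_borelE[OF assms(2)] by blast
  have [measurable]: "f \<in> borel_measurable borel" "g \<in> borel_measurable borel" using assms by measurable
  show ?thesis using B C by (intro integrable_const_bound[where B="B * C"]) (auto simp: abs_mult intro!: AE_I2 mult_mono)
qed

text \<open>The bounds on the potential hold on the closed disc only. Cutting it off there yields a
  function bounded on the whole plane, and \<open>disc_measure\<close> does not see the
  change.\<close>

lemma potential_disc_admissible: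
  assumes h: "admissible h"
  shows "admissible (\<lambda>x. indicator (ball 0 1) x * potential a h x)"
proof -
  obtain C where C: "C > 0" "\<forall>x. cmod x \<le> 1 \<longrightarrow> 0 \<le> potential a h x \<and> potential a h x \<le> C * (1 + mass a p h)"
    using potential_hoelder h by meson
  have [measurable]: "potential a h \<in> borel_measurable borel" using admissible_bdd[OF h] by measurable
  show ?thesis
  proof (rule admissibleI)
    show "(\<lambda>x. indicator (ball 0 1) x * potential a h x) \<in> borel_measurable borel" by measurable
    show "indicator (ball 0 1) x * potential a h x \<le> C * (1 + mass a p h)" for x
      using C mass_nonneg[of h] by (auto simp: indicator_def)
  qed (use C in \<open>auto simp: indicator_def\<close>)
qed

lemma energy_bounded: "bdd_above {energy a h h | h. admissible h \<and> mass a p h \<le> 1}"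
proof -
  obtain C where C: "C > 0" "\<And>h x. admissible h \<Longrightarrow> cmod x \<le> 1 \<Longrightarrow> 0 \<le> potential a h x \<and> potential a h x \<le> C * (1 + mass a p h)"
    using potential_hoelder by meson
  have "energy a h h \<le> 2 * C * (measure (disc_measure a) UNIV + 1)" if h: "admissible h" "mass a p h \<le> 1" for h
  proof -
    have i: "integrable (disc_measure a) (\<lambda>x. 1 + h x powr (1+1/p))"
      using h p by (intro Bochner_Integration.integrable_add integrable_admissible admissible_powr admissible_const) auto
    have i2: "integrable (disc_measure a) (\<lambda>x. h x * potential a h x)"
    proof -
      have [measurable]: "h \<in> borel_measurable borel" "potential a h \<in> borel_measurable borel"
        using h(1) measurable_potential[OF admissible_bdd] by (auto simp: admissible_def bdd_borel_def)
      have "integrable (disc_measure a) (\<lambda>x. h x * (indicator (ball 0 1) x * potential a h x))"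
        by (intro integrable_mult_bounded admissible_bdd h potential_disc_admissible)
      then show ?thesis
      proof (rule integrable_cong_AE_imp)
        show "AE x in disc_measure a. h x * (indicator (ball 0 1) x * potential a h x) = h x * potential a h x"
          using AE_disc_measure by eventually_elim auto
      qed measurable
    qed
    have "energy a h h \<le> (\<integral>x. (2 * C) * (1 + h x powr (1+1/p)) \<partial>disc_measure a)"
      unfolding energy_def
    proof (rule integral_mono_AE[OF i2])
      show "integrable (disc_measure a) (\<lambda>x. (2 * C) * (1 + h x powr (1+1/p)))" using i by (rule integrable_mult_right)
      show "AE x in disc_measure a. h x * potential a h x \<le> (2 * C) * (1 + h x powr (1+1/p))"
        using AE_disc_measure
      proof eventually_elim
        case (elim x)
        have h0: "0 \<le> h x" using h by (simp add: admissible_nonneg)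
        have "potential a h x \<le> C * (1 + mass a p h)" using C(2)[OF h(1)] elim by simp
        also have "\<dots> \<le> C * 2" using C(1) h(2) by (intro mult_left_mono) auto
        finally have 1: "potential a h x \<le> 2 * C" by simp
        have "1 * h x \<le> 1 powr (p+1) / (p+1) + h x powr (1+1/p) / (1+1/p)" using young_conjugate[of 1 "h x"] h0 by simp
        also have "\<dots> \<le> 1 / 1 + h x powr (1+1/p) / 1" using p exponent_pos by (intro add_mono divide_left_mono) auto
        finally have "h x \<le> 1 + h x powr (1+1/p)" by simp
        then have "h x * potential a h x \<le> (1 + h x powr (1+1/p)) * (2 * C)" using 1 C(2)[OF h(1)] elim h0
          by (intro mult_mono) auto
        then show ?case by (simp add: mult.commute)
      qed
    qed
    also have "\<dots> = 2 * C * (measure (disc_measure a) UNIV + mass a p h)"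
      using h p unfolding mass_def by (simp add: Bochner_Integration.integral_add integrable_admissible admissible_powr admissible_const)
    also have "\<dots> \<le> 2 * C * (measure (disc_measure a) UNIV + 1)" using C(1) h by (intro mult_left_mono add_mono) auto
    finally show ?thesis .
  qed
  then show ?thesis by (intro bdd_aboveI[of _ "2 * C * (measure (disc_measure a) UNIV + 1)"]) auto
qed

lemma energy_le_max: "admissible h \<Longrightarrow> mass a p h \<le> 1 \<Longrightarrow> energy a h h \<le> max_energy a p"
  unfolding max_energy_def using energy_bounded by (intro cSup_upper) auto

lemma potential_pos:
  assumes h: "admissible h" "\<not> (AE y in disc_measure a. h y = 0)" and x: "cmod x < 1"
  shows "0 < potential a h x"
proof (rule ccontr)
  assume n: "\<not> 0 < potential a h x"
  have nn: "AE y in disc_measure a. 0 \<le> green x y * h y"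
    using AE_disc_measure by eventually_elim (use x h in \<open>auto intro!: mult_nonneg_nonneg green_nonneg simp: admissible_nonneg\<close>)
  note ig = integrable_green_mult[OF a admissible_bdd[OF h(1)], of x]
  have "0 \<le> potential a h x" unfolding potential_def using nn by (rule integral_nonneg_AE)
  then have "(\<integral>y. green x y * h y \<partial>disc_measure a) = 0" using n by (simp add: potential_def)
  then have "AE y in disc_measure a. green x y * h y = 0"
    using integral_nonneg_eq_0_iff_AE[OF ig nn] x by simp
  then have "AE y in disc_measure a. h y = 0" using AE_disc_measure AE_disc_measure_neq[of x]
  proof eventually_elim
    case (elim y)
    then show ?case using green_pos[of x y] x by auto
  qed
  then show False using h by simp
qed

lemma max_energy_pos: "0 < max_energy a p"
proof -
  \<comment> \<open>A constant competitor: since c <= 1, its mass is at most c times the total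
    measure, which is below 1.\<close>
  define c where "c = 1 / (measure (disc_measure a) UNIV + 1)"
  have m0: "0 \<le> measure (disc_measure a) UNIV" by simp
  have c: "0 < c" "c \<le> 1" using m0 unfolding c_def by (simp_all add: add_nonneg_pos)
  have ac: "admissible (\<lambda>_. c)" using c by (intro admissible_const) auto
  have "mass a p (\<lambda>_. c) = c powr (1 + 1/p) * measure (disc_measure a) UNIV" by (simp add: mass_def)
  also have "\<dots> \<le> c powr 1 * measure (disc_measure a) UNIV" using c p by (intro mult_right_mono powr_mono') auto
  also have "\<dots> \<le> 1" using divide_le_eq_1_pos[of "measure (disc_measure a) UNIV + 1" "measure (disc_measure a) UNIV"] m0 by (simp add: c_def add_nonneg_pos)
  finally have m: "mass a p (\<lambda>_. c) \<le> 1" .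
  have nz: "\<not> (AE y in disc_measure a. (\<lambda>_. c) y = 0)" using c not_AE_disc_measure_False[of a] by simp
  have pp: "AE x in disc_measure a. 0 < c * potential a (\<lambda>_. c) x"
    using AE_disc_measure by eventually_elim (use potential_pos[OF ac nz] c in auto)
  have i: "integrable (disc_measure a) (\<lambda>x. c * potential a (\<lambda>_. c) x)"
  proof -
    have "integrable (disc_measure a) (\<lambda>x. c * (indicator (ball 0 1) x * potential a (\<lambda>_. c) x))"
      by (intro integrable_mult_right integrable_admissible potential_disc_admissible ac)
    then show ?thesis
    proof (rule integrable_cong_AE_imp)
      show "AE x in disc_measure a. c * (indicator (ball 0 1) x * potential a (\<lambda>_. c) x) = c * potential a (\<lambda>_. c) x"
        using AE_disc_measure by eventually_elim auto
    qed measurable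
  qed
  have "energy a (\<lambda>_. c) (\<lambda>_. c) \<noteq> 0"
  proof
    assume "energy a (\<lambda>_. c) (\<lambda>_. c) = 0"
    moreover have "AE x in disc_measure a. 0 \<le> c * potential a (\<lambda>_. c) x" using pp by eventually_elim simp
    ultimately have "AE x in disc_measure a. c * potential a (\<lambda>_. c) x = 0"
      using integral_nonneg_eq_0_iff_AE[OF i] unfolding energy_def by blast
    then have "AE x in disc_measure a. False" using pp by eventually_elim auto
    then show False using not_AE_disc_measure_False by blast
  qed
  then have "0 < energy a (\<lambda>_. c) (\<lambda>_. c)" using energy_nonneg[OF a, of "\<lambda>_. c"] by simp
  then show ?thesis using energy_le_max[OF ac m] by linarith
qed

end

section \<open>Ground states\<close>

context
  fixes a p :: real
  assumes a: "0 \<le> a" and p: "1 < p"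
begin

interpretation finite_measure "disc_measure a" by (rule finite_measure_disc_measure[OF a])

lemma hoelder_mass_le_one:
  assumes f: "admissible f" "mass a p f \<le> 1" and u: "admissible u"
  shows "(\<integral>x. f x * u x \<partial>disc_measure a) \<le> (\<integral>x. u x powr (p+1) \<partial>disc_measure a) powr (1/(p+1))"
proof -
  define I where "I = (\<integral>x. u x powr (p+1) \<partial>disc_measure a)"
  have iu: "integrable (disc_measure a) (\<lambda>x. u x powr (p+1))"
    using u p by (intro integrable_admissible[OF a p] admissible_powr) auto
  have if': "integrable (disc_measure a) (\<lambda>x. f x powr (1+1/p))"
    using f exponent_pos[OF a p] by (intro integrable_admissible[OF a p] admissible_powr) auto
  have I0: "0 \<le> I" unfolding I_def by (intro integral_nonneg_AE) auto
  show ?thesis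
  proof (cases "I = 0")
    case True
    have "AE x in disc_measure a. u x powr (p+1) = 0"
      using True integral_nonneg_eq_0_iff_AE[OF iu] by (simp add: I_def)
    then have "AE x in disc_measure a. f x * u x = 0" by eventually_elim simp
    then have "(\<integral>x. f x * u x \<partial>disc_measure a) = 0" by (rule integral_eq_zero_AE)
    then show ?thesis by simp
  next
    case False
    define N where "N = I powr (1/(p+1))"
    have N: "N > 0" "N powr (p+1) = I" using False I0 p by (auto simp: N_def powr_powr)
    have "(\<integral>x. f x * u x \<partial>disc_measure a) \<le> (\<integral>x. N * (u x powr (p+1) / I / (p+1) + f x powr (1+1/p) / (1+1/p)) \<partial>disc_measure a)"
    proof (rule integral_mono)
      show "integrable (disc_measure a) (\<lambda>x. f x * u x)"
        by (intro integrable_mult_bounded[OF a p] admissible_bdd f u)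
      show "integrable (disc_measure a) (\<lambda>x. N * (u x powr (p+1) / I / (p+1) + f x powr (1+1/p) / (1+1/p)))"
        using iu if' by (intro integrable_mult_right Bochner_Integration.integrable_add integrable_divide)
      fix x
      have "(u x / N) * f x \<le> (u x / N) powr (p+1) / (p+1) + f x powr (1 + 1/p) / (1 + 1/p)"
        using N by (intro young_conjugate[OF a p]) (auto simp: admissible_nonneg u f)
      also have "(u x / N) powr (p+1) = u x powr (p+1) / I" using N by (simp add: powr_divide admissible_nonneg u)
      finally show "f x * u x \<le> N * (u x powr (p+1) / I / (p+1) + f x powr (1+1/p) / (1+1/p))"
        using N by (simp add: field_simps)
    qed
    also have "\<dots> = N * ((\<integral>x. u x powr (p+1) \<partial>disc_measure a) / I / (p+1) + mass a p f / (1+1/p))"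
      unfolding mass_def using iu if' by simp
    also have "\<dots> \<le> N * (1 / (p+1) + 1 / (1+1/p))"
      using N f False p exponent_pos[OF a p] by (intro mult_left_mono add_mono divide_right_mono) (auto simp: I_def[symmetric])
    also have "1 / (p+1) + 1 / (1+1/p) = 1" using p by (simp add: field_simps)
    finally show ?thesis by (simp add: N_def I_def)
  qed
qed

lemma maximizing_sequence:
  obtains h where "\<And>k::nat. admissible (h k)" "\<And>k. mass a p (h k) \<le> 1" "(\<lambda>k. energy a (h k) (h k)) \<longlonglongrightarrow> max_energy a p"
proof -
  let ?M = "max_energy a p"
  let ?S = "{energy a h h | h. admissible h \<and> mass a p h \<le> 1}"
  have ne: "?S \<noteq> {}" using admissible_const[of 0] by (auto simp: mass_def intro!: exI[of _ "\<lambda>_. 0"])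
  have "\<exists>h. admissible h \<and> mass a p h \<le> 1 \<and> ?M - 1 / real (Suc k) < energy a h h" for k
  proof -
    have "?M - 1 / real (Suc k) < Sup ?S" by (simp add: max_energy_def)
    then show ?thesis using less_cSup_iff[OF ne energy_bounded[OF a p]] by blast
  qed
  then obtain h where h: "\<And>k. admissible (h k)" "\<And>k. mass a p (h k) \<le> 1" "\<And>k. ?M - 1 / real (Suc k) < energy a (h k) (h k)"
    by metis
  have "(\<lambda>k. energy a (h k) (h k)) \<longlonglongrightarrow> ?M"
  proof (rule tendsto_sandwich[OF _ _ _ tendsto_const])
    show "\<forall>\<^sub>F k in sequentially. ?M - 1 / real (Suc k) \<le> energy a (h k) (h k)" by (intro always_eventually allI less_imp_le h(3))
    show "\<forall>\<^sub>F k in sequentially. energy a (h k) (h k) \<le> ?M" using energy_le_max[OF a p h(1,2)] by auto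
    have "(\<lambda>k. ?M - 1 / real (Suc k)) \<longlonglongrightarrow> ?M - 0"
      by (intro tendsto_diff tendsto_const) (use LIMSEQ_inverse_real_of_nat in \<open>simp add: inverse_eq_divide\<close>)
    then show "(\<lambda>k. ?M - 1 / real (Suc k)) \<longlonglongrightarrow> ?M" by simp
  qed
  then show ?thesis using that h by blast
qed

text \<open>Arzela-Ascoli is applied after the Green operator: only the potentials converge, and
  nothing is claimed about the densities themselves.\<close>

lemma potential_sequence_compact:
  assumes h: "\<And>k::nat. admissible (h k)" "\<And>k. mass a p (h k) \<le> 1"
  obtains u r where "admissible u" "strict_mono (r::nat \<Rightarrow> nat)"
    "\<forall>e>0. \<exists>N. \<forall>n\<ge>N. \<forall>x\<in>ball 0 1. \<bar>potential a (h (r n)) x - u x\<bar> < e"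
proof -
  obtain C where C: "C > 0"
    "\<And>h x x'. admissible h \<Longrightarrow> cmod x \<le> 1 \<Longrightarrow> cmod x' \<le> 1 \<Longrightarrow> \<bar>potential a h x - potential a h x'\<bar> \<le> C * (1 + mass a p h) * cmod (x - x') powr (1/(p+1))"
    "\<And>h x. admissible h \<Longrightarrow> cmod x \<le> 1 \<Longrightarrow> 0 \<le> potential a h x \<and> potential a h x \<le> C * (1 + mass a p h)"
    using potential_hoelder[OF a p] by meson
  have b: "0 \<le> potential a (h k) x" "potential a (h k) x \<le> 2 * C" if "cmod x \<le> 1" for k x
  proof -
    show "0 \<le> potential a (h k) x" using C(3)[OF h(1) that] by blast
    have "potential a (h k) x \<le> C * (1 + mass a p (h k))" using C(3)[OF h(1) that] by blast
    also have "\<dots> \<le> C * 2" using C(1) h(2)[of k] by (intro mult_left_mono) auto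
    finally show "potential a (h k) x \<le> 2 * C" by simp
  qed
  have hl: "\<bar>potential a (h k) x - potential a (h k) x'\<bar> \<le> 2 * C * cmod (x - x') powr (1/(p+1))" if "cmod x \<le> 1" "cmod x' \<le> 1" for k x x'
  proof -
    have "\<bar>potential a (h k) x - potential a (h k) x'\<bar> \<le> C * (1 + mass a p (h k)) * cmod (x - x') powr (1/(p+1))"
      using C(2)[OF h(1) that] .
    also have "\<dots> \<le> C * 2 * cmod (x - x') powr (1/(p+1))" using C(1) h(2)[of k] by (intro mult_right_mono mult_left_mono) auto
    finally show ?thesis by (simp add: mult.commute)
  qed
  obtain g r where g: "continuous_on (cball (0::complex) 1) g" "strict_mono (r::nat \<Rightarrow> nat)"
    "\<And>e. 0 < e \<Longrightarrow> \<exists>N. \<forall>n x. n \<ge> N \<and> x \<in> cball 0 1 \<longrightarrow> norm (potential a (h (r n)) x - g x) < e"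
  proof (rule Arzela_Ascoli[of "cball (0::complex) 1" "\<lambda>k. potential a (h k)" "2 * C"])
    show "norm (potential a (h k) x) \<le> 2 * C" if "x \<in> cball 0 1" for k x using b[of x k] that by simp
    fix x :: complex and e :: real assume x: "x \<in> cball 0 1" and e: "0 < e"
    \<comment> \<open>Solves 2 C d^(1/(p+1)) = e/2, where 2 C is the common Hoelder
      constant.\<close>
    define d where "d = (e / (4 * C)) powr (p+1)"
    have d: "d > 0" using e C(1) by (simp add: d_def)
    have "norm (potential a (h k) x - potential a (h k) y) < e" if "y \<in> cball 0 1" "norm (x - y) < d" for k y
    proof -
      have "cmod (x - y) powr (1/(p+1)) \<le> d powr (1/(p+1))" using that p by (intro powr_mono2) auto
      also have "\<dots> = e / (4 * C)" using e C(1) p by (simp add: d_def powr_powr)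
      finally have "2 * C * cmod (x - y) powr (1/(p+1)) \<le> 2 * C * (e / (4 * C))" using C(1) by (intro mult_left_mono) auto
      also have "\<dots> < e" using e C(1) by (simp add: field_simps)
      finally show ?thesis using hl[of x y k] x that by simp
    qed
    then show "\<exists>d. 0 < d \<and> (\<forall>n y. y \<in> cball 0 1 \<and> norm (x - y) < d \<longrightarrow> norm (potential a (h n) x - potential a (h n) y) < e)"
      using d by blast
  qed auto
  define u where "u = (\<lambda>x. indicator (ball 0 1) x * g x)"
  have lim: "(\<lambda>n. potential a (h (r n)) x) \<longlonglongrightarrow> g x" if "x \<in> ball 0 1" for x
    unfolding LIMSEQ_iff using g(3) that by (metis ball_subset_cball subsetD)
  have "admissible u"
  proof (rule admissibleI)
    have "continuous_on (ball 0 1) g" using g(1) ball_subset_cball by (rule continuous_on_subset)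
    from borel_measurable_continuous_on_indicator[OF _ this]
    show "u \<in> borel_measurable borel" by (simp add: u_def)
    show "0 \<le> u x" for x
      using LIMSEQ_le_const[OF lim[of x], of 0] b(1) by (auto simp: u_def indicator_def)
    show "u x \<le> 2 * C" for x
      using LIMSEQ_le_const2[OF lim[of x], of "2 * C"] b(2) C(1) by (auto simp: u_def indicator_def)
  qed
  moreover have "\<exists>N. \<forall>n\<ge>N. \<forall>x\<in>ball 0 1. \<bar>potential a (h (r n)) x - u x\<bar> < e" if "0 < e" for e
  proof -
    obtain N where N: "\<And>n x. n \<ge> N \<and> x \<in> cball 0 1 \<Longrightarrow> norm (potential a (h (r n)) x - g x) < e" using g(3)[OF \<open>0 < e\<close>] by blast
    have "\<bar>potential a (h (r n)) x - u x\<bar> < e" if "n \<ge> N" "x \<in> ball 0 1" for n x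
      using N[of n x] that by (simp add: u_def)
    then show ?thesis by blast
  qed
  ultimately show ?thesis using that g(2) by blast
qed

text \<open>Uniform convergence of the potentials is paired with a bound on the integrals of |f n|.
  The f n may vary because the lemma is used twice: with a constant sequence, and with f n = h n to
  identify the limit of the energies.\<close>

lemma integral_mult_potential_tendsto:
  assumes f: "\<And>n. bdd_borel (f n)" "\<And>n. (\<integral>x. \<bar>f n x\<bar> \<partial>disc_measure a) \<le> D" and h: "\<And>n. admissible (h n)" and u: "admissible u"
    and lim: "\<And>e. 0 < e \<Longrightarrow> \<exists>N. \<forall>n\<ge>N. \<forall>x\<in>ball 0 1. \<bar>potential a (h n) x - u x\<bar> < e"
  shows "(\<lambda>n. energy a (f n) (h n) - (\<integral>x. f n x * u x \<partial>disc_measure a)) \<longlonglongrightarrow> 0"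
proof (rule LIMSEQ_I)
  fix e :: real assume e: "0 < e"
  have D0: "0 \<le> D" using f(2)[of 0] by (rule order_trans[rotated]) (intro integral_nonneg_AE, auto)
  define e' where "e' = e / (2 * (D + 1))"
  have e': "0 < e'" using e D0 by (simp add: e'_def)
  obtain N where N: "\<forall>n\<ge>N. \<forall>x\<in>ball 0 1. \<bar>potential a (h n) x - u x\<bar> < e'" using lim[OF e'] by blast
  have "norm (energy a (f n) (h n) - (\<integral>x. f n x * u x \<partial>disc_measure a) - 0) < e" if n: "n \<ge> N" for n
  proof -
    let ?v = "\<lambda>x. indicator (ball 0 1) x * potential a (h n) x"
    have v: "admissible ?v" by (rule potential_disc_admissible[OF a p h])
    have [measurable]: "f n \<in> borel_measurable borel" "potential a (h n) \<in> borel_measurable borel"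
      using f(1) admissible_bdd[OF h] measurable_potential[OF a p] by (auto simp: bdd_borel_def)
    have ev: "energy a (f n) (h n) = (\<integral>x. f n x * ?v x \<partial>disc_measure a)"
      unfolding energy_def
    proof (rule integral_cong_AE)
      show "AE x in disc_measure a. f n x * potential a (h n) x = f n x * (indicator (ball 0 1) x * potential a (h n) x)"
        using AE_disc_measure by eventually_elim auto
    qed measurable
    have i1: "integrable (disc_measure a) (\<lambda>x. f n x * ?v x)" "integrable (disc_measure a) (\<lambda>x. f n x * u x)"
      by (intro integrable_mult_bounded[OF a p] f(1) admissible_bdd v u)+
    have i2: "integrable (disc_measure a) (\<lambda>x. \<bar>f n x\<bar> * e')"
      using integrable_norm[OF integrable_mult_bounded[OF a p f(1)[of n] bdd_borel_const[of 1]]] by simp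
    have "\<bar>energy a (f n) (h n) - (\<integral>x. f n x * u x \<partial>disc_measure a)\<bar> = \<bar>\<integral>x. f n x * ?v x - f n x * u x \<partial>disc_measure a\<bar>"
      unfolding ev using i1 by simp
    also have "\<dots> \<le> (\<integral>x. \<bar>f n x * ?v x - f n x * u x\<bar> \<partial>disc_measure a)" by (rule integral_abs_bound)
    also have "\<dots> \<le> (\<integral>x. \<bar>f n x\<bar> * e' \<partial>disc_measure a)"
    proof (rule integral_mono_AE)
      show "AE x in disc_measure a. \<bar>f n x * ?v x - f n x * u x\<bar> \<le> \<bar>f n x\<bar> * e'"
        using AE_disc_measure
      proof eventually_elim
        case (elim x)
        then have "\<bar>potential a (h n) x - u x\<bar> \<le> e'" using N n by (meson less_imp_le)
        then have "\<bar>f n x\<bar> * \<bar>potential a (h n) x - u x\<bar> \<le> \<bar>f n x\<bar> * e'" by (rule mult_left_mono) simp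
        then show ?case using elim by (simp add: right_diff_distrib[symmetric] abs_mult)
      qed
    qed (use i1 i2 in auto)
    also have "\<dots> = (\<integral>x. \<bar>f n x\<bar> \<partial>disc_measure a) * e'" by simp
    also have "\<dots> \<le> D * e'" using f(2)[of n] e' by (intro mult_right_mono) auto
    also have "\<dots> < e" using e D0 by (simp add: e'_def field_simps add_nonneg_pos)
    finally show ?thesis by simp
  qed
  then show "\<exists>N. \<forall>n\<ge>N. norm (energy a (f n) (h n) - (\<integral>x. f n x * u x \<partial>disc_measure a) - 0) < e" by blast
qed

lemma integral_le_of_mass:
  assumes "admissible h" "mass a p h \<le> 1"
  shows "(\<integral>x. \<bar>h x\<bar> \<partial>disc_measure a) \<le> measure (disc_measure a) UNIV + 1"
proof -
  have i: "integrable (disc_measure a) (\<lambda>x. h x powr (1+1/p))"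
    using assms exponent_pos[OF a p] by (intro integrable_admissible[OF a p] admissible_powr) auto
  have "(\<integral>x. \<bar>h x\<bar> \<partial>disc_measure a) \<le> (\<integral>x. 1 + h x powr (1+1/p) \<partial>disc_measure a)"
  proof (rule integral_mono)
    show "integrable (disc_measure a) (\<lambda>x. \<bar>h x\<bar>)" using integrable_admissible[OF a p assms(1)] by simp
    show "integrable (disc_measure a) (\<lambda>x. 1 + h x powr (1+1/p))" using i by simp
    fix x
    have h0: "0 \<le> h x" using assms by (simp add: admissible_nonneg)
    have "1 * h x \<le> 1 powr (p+1) / (p+1) + h x powr (1+1/p) / (1+1/p)" using young_conjugate[OF a p, of 1 "h x"] h0 by simp
    also have "\<dots> \<le> 1 / 1 + h x powr (1+1/p) / 1" using p exponent_pos[OF a p] by (intro add_mono divide_left_mono) auto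
    finally show "\<bar>h x\<bar> \<le> 1 + h x powr (1+1/p)" using h0 by simp
  qed
  also have "\<dots> = measure (disc_measure a) UNIV + mass a p h" using i by (simp add: mass_def)
  finally show ?thesis using assms by simp
qed

text \<open>By the Cauchy--Schwarz inequality for the energy, the limit \<open>u\<close> of the potentials of a maximizing
  sequence satisfies \<open>\<parallel>u\<parallel>\<^sup>2 \<le> M * energy h h \<le> M\<^sup>2\<close> for the normalized power \<open>h\<close> of \<open>u\<close>; equality
  forces \<open>u\<close> to be the potential of \<open>h\<close>, so no weak compactness is needed.\<close>

proposition maximizer_exists:
  obtains u where "admissible u" "(\<integral>x. u x powr (p+1) \<partial>disc_measure a) = max_energy a p powr (p+1)"
    "\<And>x. x \<in> ball 0 1 \<Longrightarrow> potential a (\<lambda>y. u y powr p) x = max_energy a p powr p * u x"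
proof -
  let ?M = "max_energy a p"
  have M: "0 < ?M" by (rule max_energy_pos[OF a p])
  obtain h0 where h0: "\<And>k::nat. admissible (h0 k)" "\<And>k. mass a p (h0 k) \<le> 1" "(\<lambda>k. energy a (h0 k) (h0 k)) \<longlonglongrightarrow> ?M"
    using maximizing_sequence by blast
  obtain u r where u: "admissible u" "strict_mono (r::nat \<Rightarrow> nat)"
    "\<forall>e>0. \<exists>N. \<forall>n\<ge>N. \<forall>x\<in>ball 0 1. \<bar>potential a (h0 (r n)) x - u x\<bar> < e"
    using potential_sequence_compact[of h0, OF h0(1,2)] by metis
  define h where "h = (\<lambda>n. h0 (r n))"
  have h: "\<And>k. admissible (h k)" "\<And>k. mass a p (h k) \<le> 1" "(\<lambda>k. energy a (h k) (h k)) \<longlonglongrightarrow> ?M"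
    using h0 LIMSEQ_subseq_LIMSEQ[OF h0(3) u(2)] by (auto simp: h_def o_def)
  have conv: "\<exists>N. \<forall>n\<ge>N. \<forall>x\<in>ball 0 1. \<bar>potential a (h n) x - u x\<bar> < e" if "0 < e" for e
    using u(3) that by (simp add: h_def)
  have fixed: "(\<lambda>n. energy a f (h n)) \<longlonglongrightarrow> (\<integral>x. f x * u x \<partial>disc_measure a)" if "bdd_borel f" for f
    using integral_mult_potential_tendsto[of "\<lambda>_. f", OF that order_refl h(1) u(1) conv] by (simp add: LIM_zero_iff)
  define I where "I = (\<integral>x. u x powr (p+1) \<partial>disc_measure a)"
  define N where "N = I powr (1/(p+1))"
  have I0: "0 \<le> I" unfolding I_def by (intro integral_nonneg_AE) auto
  \<comment> \<open>Up to a null sequence the energies equal the integrals of h n times u, and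
    Hoelder's inequality bounds these by N, the (p+1)-norm of u.\<close>
  have MN: "?M \<le> N"
  proof -
    have "(\<lambda>n. energy a (h n) (h n) - (\<integral>x. h n x * u x \<partial>disc_measure a)) \<longlonglongrightarrow> 0"
      by (rule integral_mult_potential_tendsto[OF admissible_bdd[OF h(1)] integral_le_of_mass[OF h(1,2)] h(1) u(1) conv])
    from tendsto_diff[OF h(3) this] have "(\<lambda>n. \<integral>x. h n x * u x \<partial>disc_measure a) \<longlonglongrightarrow> ?M" by simp
    then show ?thesis
      by (rule LIMSEQ_le_const2) (use hoelder_mass_le_one[OF h(1,2) u(1)] in \<open>auto simp: N_def I_def\<close>)
  qed
  then have N: "0 < N" using M by linarith
  have Ip: "I = N powr (p+1)" using p I0 by (simp add: N_def powr_powr)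
  then have I: "0 < I" using N by simp
  \<comment> \<open>The density for which Hoelder's inequality against u is an equality: it has unit
    mass, and its pairing with u equals N.\<close>
  define g where "g = (\<lambda>x. (1 / N powr p) * u x powr p)"
  have g: "admissible g" unfolding g_def using u(1) p by (intro admissible_scale admissible_powr) auto
  have mg: "mass a p g = 1"
  proof -
    have "p * (1 + 1/p) = p + 1" using p by (simp add: field_simps)
    then have "mass a p (\<lambda>x. u x powr p) = I" unfolding mass_def powr_powr I_def by simp
    moreover have "mass a p g = (1 / N powr p) powr (1 + 1/p) * mass a p (\<lambda>x. u x powr p)"
      unfolding g_def using u(1) p by (intro mass_scale admissible_powr) auto
    ultimately have "mass a p g = (1 / N powr p) powr (1 + 1/p) * I" by simp
    also have "(1 / N powr p) powr (1 + 1/p) = 1 / N powr (p+1)"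
      using \<open>p * (1 + 1/p) = p + 1\<close> by (simp add: powr_divide powr_powr)
    finally show ?thesis using Ip I by simp
  qed
  have gu: "(\<integral>x. g x * u x \<partial>disc_measure a) = N"
  proof -
    have "g x * u x = (1 / N powr p) * u x powr (p+1)" for x
      using admissible_nonneg[OF u(1), of x] p by (cases "u x = 0") (auto simp: g_def powr_add)
    then have "(\<integral>x. g x * u x \<partial>disc_measure a) = 1 / N powr p * N powr (p+1)" by (simp add: I_def Ip[symmetric])
    then show ?thesis using N by (simp add: powr_add)
  qed
  have bg: "bdd_borel g" and bh: "\<And>n. bdd_borel (h n)" using g h(1) by (auto intro: admissible_bdd)
  have gh: "(\<lambda>n. energy a g (h n)) \<longlonglongrightarrow> N" using fixed[OF bg] gu by simp
  have N2: "N\<^sup>2 \<le> energy a g g * ?M"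
  proof (rule LIMSEQ_le[OF tendsto_power[OF gh] tendsto_mult[OF tendsto_const h(3)]])
    show "\<exists>M. \<forall>n\<ge>M. (energy a g (h n))\<^sup>2 \<le> energy a g g * energy a (h n) (h n)"
      using energy_Cauchy_Schwarz[OF a bg bh] by blast
  qed
  have gM: "energy a g g \<le> ?M" using energy_le_max[OF a p g] mg by simp
  have "N\<^sup>2 \<le> ?M\<^sup>2" unfolding power2_eq_square[of ?M]
    by (rule order_trans[OF N2 mult_right_mono[OF gM]]) (use M in simp)
  then have "N \<le> ?M" by (rule power2_le_imp_le) (use M in simp)
  then have NM: "N = ?M" using MN by simp
  have "?M * ?M \<le> energy a g g * ?M" using N2 NM by (simp add: power2_eq_square)
  then have gg: "energy a g g = ?M" using M gM by simp
  \<comment> \<open>The h n need not converge in any function space, but their energy distance to g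
    tends to M - 2 M + M = 0.\<close>
  have dist: "(\<lambda>n. energy a (\<lambda>x. g x + (-1) * h n x) (\<lambda>x. g x + (-1) * h n x)) \<longlonglongrightarrow> 0"
  proof -
    have "energy a (\<lambda>x. g x + (-1) * h n x) (\<lambda>x. g x + (-1) * h n x) = energy a g g - 2 * energy a g (h n) + energy a (h n) (h n)" for n
    proof -
      note l = bdd_borel_linear[OF bg bh, of "-1" n]
      show ?thesis
        using energy_linear[OF a bg bh l, of "-1" n] energy_commute[OF a bg l] energy_commute[OF a bh l, of n]
          energy_linear[OF a bg bh bg, of "-1" n] energy_linear[OF a bg bh bh, of "-1" n n] energy_commute[OF a bh bg, of n] by simp
    qed
    moreover have "(\<lambda>n. energy a g g - 2 * energy a g (h n) + energy a (h n) (h n)) \<longlonglongrightarrow> ?M - 2 * ?M + ?M"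
      using gg gh NM h(3) by (intro tendsto_intros) auto
    ultimately show ?thesis by simp
  qed
  \<comment> \<open>By Cauchy-Schwarz, energy convergence of h n to g suffices to pass to the limit
    against any bounded f. The same pairing also tends to the integral of f u, so u is the potential
    of g in the weak sense.\<close>
  have eq: "energy a f g = (\<integral>x. f x * u x \<partial>disc_measure a)" if f: "bdd_borel f" for f
  proof -
    have "(\<lambda>n. (energy a f g - energy a f (h n))\<^sup>2) \<longlonglongrightarrow> 0"
    proof (rule tendsto_sandwich[OF _ _ tendsto_const])
      show "\<forall>\<^sub>F n in sequentially. (energy a f g - energy a f (h n))\<^sup>2 \<le> energy a f f * energy a (\<lambda>x. g x + (-1) * h n x) (\<lambda>x. g x + (-1) * h n x)"
      proof (rule always_eventually, rule allI)
        fix n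
        note l = bdd_borel_linear[OF bg bh, of "-1" n]
        have "energy a f (\<lambda>x. g x + (-1) * h n x) = energy a f g - energy a f (h n)"
          using energy_linear[OF a bg bh f, of "-1" n] energy_commute[OF a f l] energy_commute[OF a f bg] energy_commute[OF a f bh, of n] by simp
        then show "(energy a f g - energy a f (h n))\<^sup>2 \<le> energy a f f * energy a (\<lambda>x. g x + (-1) * h n x) (\<lambda>x. g x + (-1) * h n x)"
          using energy_Cauchy_Schwarz[OF a f l] by simp
      qed
      show "(\<lambda>n. energy a f f * energy a (\<lambda>x. g x + (-1) * h n x) (\<lambda>x. g x + (-1) * h n x)) \<longlonglongrightarrow> 0"
        using tendsto_mult[OF tendsto_const dist, of "energy a f f"] by simp
    qed simp
    moreover have "(\<lambda>n. (energy a f g - energy a f (h n))\<^sup>2) \<longlonglongrightarrow> (energy a f g - (\<integral>x. f x * u x \<partial>disc_measure a))\<^sup>2"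
      by (intro tendsto_intros fixed f)
    ultimately have "(energy a f g - (\<integral>x. f x * u x \<partial>disc_measure a))\<^sup>2 = 0" by (metis LIMSEQ_unique)
    then show ?thesis by simp
  qed
  define w where "w = (\<lambda>x. indicator (ball 0 1) x * potential a g x)"
  have w: "admissible w" unfolding w_def by (rule potential_disc_admissible[OF a p g])
  \<comment> \<open>Testing with the difference itself turns the weak identity into equality almost
    everywhere.\<close>
  define f where "f = (\<lambda>x. w x + (-1) * u x)"
  have f: "bdd_borel f" unfolding f_def by (intro bdd_borel_linear admissible_bdd w u(1))
  have [measurable]: "f \<in> borel_measurable borel" "potential a g \<in> borel_measurable borel" "w \<in> borel_measurable borel" "u \<in> borel_measurable borel"
    using f bg w u(1) measurable_potential[OF a p] by (auto simp: bdd_borel_def admissible_def)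
  have "energy a f g = (\<integral>x. f x * w x \<partial>disc_measure a)"
    unfolding energy_def
  proof (rule integral_cong_AE)
    show "AE x in disc_measure a. f x * potential a g x = f x * w x"
      using AE_disc_measure by eventually_elim (auto simp: w_def)
  qed measurable
  then have "(\<integral>x. f x * w x - f x * u x \<partial>disc_measure a) = 0"
    using eq[OF f] by (subst Bochner_Integration.integral_diff) (auto intro!: integrable_mult_bounded[OF a p] f admissible_bdd w u(1))
  then have "(\<integral>x. f x * f x \<partial>disc_measure a) = 0" by (simp add: f_def algebra_simps)
  then have "AE x in disc_measure a. f x * f x = 0"
    using integral_nonneg_eq_0_iff_AE[OF integrable_mult_bounded[OF a p f f]] by simp
  then have wu: "AE x in disc_measure a. w x = u x" by eventually_elim (simp add: f_def)
  show ?thesis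
  \<comment> \<open>The potential \<open>w\<close>, not the limit \<open>u\<close>, is the witness:
    they are known to agree only almost everywhere, while the equation is required at every point of
    the disc.\<close>
  proof (rule that[OF w])
    have "(\<integral>x. w x powr (p+1) \<partial>disc_measure a) = I" unfolding I_def
      using wu by (intro integral_cong_AE) (auto elim: eventually_mono)
    then show "(\<integral>x. w x powr (p+1) \<partial>disc_measure a) = ?M powr (p+1)" using Ip NM by simp
    fix x :: complex assume x: "x \<in> ball 0 1"
    have "potential a (\<lambda>y. w y powr p) x = (\<integral>y. N powr p * (green x y * g y) \<partial>disc_measure a)"
      unfolding potential_def
    proof (rule integral_cong_AE)
      show "AE y in disc_measure a. green x y * w y powr p = N powr p * (green x y * g y)"
        using wu by eventually_elim (use N in \<open>auto simp: g_def\<close>)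
    qed (auto simp: g_def)
    also have "\<dots> = N powr p * potential a g x" by (simp add: potential_def)
    finally show "potential a (\<lambda>y. w y powr p) x = ?M powr p * w x" using x NM by (simp add: w_def)
  qed
qed

lemma potential_scale: "potential a (\<lambda>y. c * h y) x = c * potential a h x"
  unfolding potential_def by (simp add: mult.left_commute[of _ c] flip: integral_mult_right_zero)

theorem ground_state_exists:
  obtains U where "admissible U" "(\<integral>x. U x powr (p+1) \<partial>disc_measure a) = max_energy a p powr (-(p+1)/(p-1))"
    "\<And>x. x \<in> ball 0 1 \<Longrightarrow> U x = potential a (\<lambda>y. U y powr p) x"
proof -
  let ?M = "max_energy a p"
  have M: "0 < ?M" by (rule max_energy_pos[OF a p])
  obtain u where u: "admissible u" "(\<integral>x. u x powr (p+1) \<partial>disc_measure a) = ?M powr (p+1)"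
    "\<And>x. x \<in> ball 0 1 \<Longrightarrow> potential a (\<lambda>y. u y powr p) x = ?M powr p * u x"
    using maximizer_exists by blast
  \<comment> \<open>The solution of s^(p-1) M^p = 1. Multiplying u by it removes the Lagrange
    multiplier M^p, because the two sides of the equation have degrees 1 and p.\<close>
  define s where "s = ?M powr (-p/(p-1))"
  have s: "0 < s" using M by (simp add: s_def)
  have "-p/(p-1) * p + p = -p/(p-1)" "-p/(p-1) * (p+1) + (p+1) = -(p+1)/(p-1)" using p by (auto simp: field_simps)
  then have sp: "s powr p * ?M powr p = s" "s powr (p+1) * ?M powr (p+1) = ?M powr (-(p+1)/(p-1))"
    by (simp_all add: s_def powr_powr powr_add[symmetric])
  show ?thesis
  proof (rule that[of "\<lambda>x. s * u x"])
    show "admissible (\<lambda>x. s * u x)" using u(1) s by (intro admissible_scale) auto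
    have "(s * u x) powr q = s powr q * u x powr q" for x q
      using s admissible_nonneg[OF u(1)] by (simp add: powr_mult)
    note e = this
    show "(\<integral>x. (s * u x) powr (p+1) \<partial>disc_measure a) = ?M powr (-(p+1)/(p-1))"
      unfolding e using sp(2) u(2) by simp
    fix x :: complex assume x: "x \<in> ball 0 1"
    show "s * u x = potential a (\<lambda>y. (s * u y) powr p) x"
      unfolding e potential_scale u(3)[OF x] using sp(1) by (metis mult.assoc)
  qed
qed

end

section \<open>Power maps and comparison of the maximal energies\<close>

text \<open>As polynomials in x both sides are monic of degree m and vanish at the m points obtained
  by rotating y. Their difference has degree below m, so these roots make it zero. The points are
  distinct only for y nonzero, hence the case distinction.\<close>

lemma prod_roots_unity_diff:
  fixes x y :: complex
  assumes m: "m > (0::nat)"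
  shows "(\<Prod>j<m. x - cis (2 * pi * real j / real m) * y) = x ^ m - y ^ m"
proof (cases "y = 0")
  case True
  then show ?thesis using m by simp
next
  case False
  let ?w = "\<lambda>j. cis (2 * pi * real j / real m)"
  define P where "P = (\<Prod>j<m. [:- (?w j * y), 1:])"
  define Q where "Q = monom 1 m - [:y ^ m:]"
  have b: "bij_betw ?w {..<m} {z. z ^ m = 1}" using Complex.bij_betw_roots_unity[OF m] .
  have dP: "degree P = m" unfolding P_def by (subst degree_prod_eq_sum_degree) auto
  have lP: "coeff P m = 1"
  proof -
    have "lead_coeff P = 1" unfolding P_def by (simp add: lead_coeff_prod)
    then show ?thesis using dP by simp
  qed
  have cQ: "coeff Q m = 1" using m by (cases m) (simp_all add: Q_def)
  have dQ: "degree Q \<le> m" unfolding Q_def by (intro degree_diff_le) (auto simp: degree_monom_le)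
  have "P - Q = 0"
  proof (rule ccontr)
    assume ne: "P - Q \<noteq> 0"
    have "degree (P - Q) \<le> m" using dP dQ by (intro degree_diff_le) auto
    moreover have "coeff (P - Q) m = 0" using lP cQ by simp
    ultimately have deg: "degree (P - Q) < m" using ne
      by (metis le_neq_implies_less leading_coeff_0_iff)
    have roots: "(\<lambda>j. ?w j * y) ` {..<m} \<subseteq> {z. poly (P - Q) z = 0}"
    proof clarify
      fix j assume j: "j < m"
      have "poly P (?w j * y) = 0" using j by (auto simp: P_def poly_prod)
      moreover have "(?w j) ^ m = 1" using b j by (auto simp: bij_betw_def)
      then have "poly Q (?w j * y) = 0" by (simp add: Q_def poly_monom power_mult_distrib)
      ultimately show "poly (P - Q) (?w j * y) = 0" by simp
    qed
    have "inj_on (\<lambda>j. ?w j * y) {..<m}" using b False by (auto simp: bij_betw_def inj_on_def)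
    then have "m = card ((\<lambda>j. ?w j * y) ` {..<m})" by (simp add: card_image)
    also have "\<dots> \<le> card {z. poly (P - Q) z = 0}" by (rule card_mono[OF poly_roots_finite[OF ne] roots])
    also have "\<dots> \<le> degree (P - Q)" by (rule card_poly_roots_bound[OF ne])
    finally show False using deg by simp
  qed
  then have "poly P x = poly Q x" by simp
  then show ?thesis by (simp add: P_def Q_def poly_prod poly_monom)
qed

lemma cis_root_unity: "m > 0 \<Longrightarrow> cis (2 * pi * real j / real m) ^ m = 1"
proof -
  assume "m > 0"
  then have "real m * (2 * pi * real j / real m) = 2 * pi * real j" by simp
  then have "cis (2 * pi * real j / real m) ^ m = cis (2 * pi * real j)" by (metis Complex.DeMoivre)
  then show ?thesis by (simp add: cis_multiple_2pi)
qed

text \<open>The factorization of x^m - y^m turns each of the two sums of logarithms into one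
  logarithm. The assumption \<open>x ^ m \<noteq> y ^ m\<close> keeps all terms away from the
  diagonal, where \<open>green\<close> has its default value.\<close>

lemma sum_green_rotations:
  assumes m: "m > (0::nat)" and xy: "x ^ m \<noteq> y ^ m" "cmod x < 1" "cmod y < 1"
  shows "(\<Sum>j<m. green x (cis (2 * pi * real j / real m) * y)) = green (x ^ m) (y ^ m)"
proof -
  let ?w = "\<lambda>j. cis (2 * pi * real j / real m)"
  have w: "(?w j) ^ m = 1" for j by (rule cis_root_unity[OF m])
  have ne: "x \<noteq> ?w j * y" for j using xy(1) w[of j] by (metis mult.left_neutral power_mult_distrib)
  have c: "cmod (1 - x * cnj (?w j * y)) = cmod (1 - ?w j * (cnj x * y))" for j
    by (subst complex_mod_cnj[symmetric]) (simp add: mult_ac)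
  have cp: "cmod (1 - ?w j * (cnj x * y)) \<noteq> 0" for j
  proof -
    have "cmod (?w j * (cnj x * y)) < 1" using xy mult_strict_mono[of "cmod x" 1 "cmod y" 1] by (simp add: norm_mult)
    then show ?thesis by auto
  qed
  have s1: "(\<Sum>j<m. ln (cmod (x - ?w j * y))) = ln (cmod (x ^ m - y ^ m))"
  proof -
    have "(\<Sum>j<m. ln (cmod (x - ?w j * y))) = ln (\<Prod>j<m. cmod (x - ?w j * y))"
      using ne by (subst ln_prod) auto
    then show ?thesis by (simp add: prod_norm prod_roots_unity_diff[OF m])
  qed
  have s2: "(\<Sum>j<m. ln (cmod (1 - x * cnj (?w j * y)))) = ln (cmod (1 - x ^ m * cnj (y ^ m)))"
  proof -
    have "(\<Sum>j<m. ln (cmod (1 - ?w j * (cnj x * y)))) = ln (\<Prod>j<m. cmod (1 - ?w j * (cnj x * y)))"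
      using cp by (subst ln_prod) auto
    also have "\<dots> = ln (cmod (1 ^ m - (cnj x * y) ^ m))" by (simp only: prod_norm prod_roots_unity_diff[OF m])
    also have "cmod (1 ^ m - (cnj x * y) ^ m) = cmod (1 - x ^ m * cnj (y ^ m))"
      by (subst complex_mod_cnj[symmetric]) (simp add: power_mult_distrib)
    finally show ?thesis unfolding c .
  qed
  have "(\<Sum>j<m. green x (?w j * y)) = (\<Sum>j<m. (ln (cmod (1 - x * cnj (?w j * y))) - ln (cmod (x - ?w j * y))) / (2 * pi))"
    using ne by (intro sum.cong) (auto simp: green_def)
  also have "\<dots> = (ln (cmod (1 - x ^ m * cnj (y ^ m))) - ln (cmod (x ^ m - y ^ m))) / (2 * pi)"
    unfolding s1[symmetric] s2[symmetric] by (simp add: sum_divide_distrib[symmetric] sum_subtractf)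
  also have "\<dots> = green (x ^ m) (y ^ m)" using xy by (simp add: green_def)
  finally show ?thesis .
qed

lemma nn_integral_disc_rotate:
  assumes [measurable]: "F \<in> borel_measurable borel" and c: "cmod c = 1"
  shows "(\<integral>\<^sup>+z. F (c * z) \<partial>disc_measure a) = (\<integral>\<^sup>+z. F z \<partial>disc_measure a)"
proof -
  have "(\<integral>\<^sup>+z. F (c * z) \<partial>disc_measure a) = (\<integral>\<^sup>+z. (\<lambda>z. ennreal (norm z powr a) * F z * indicator (ball 0 1) z) (c * z) \<partial>lborel)"
    by (subst nn_integral_disc_measure) (auto intro!: nn_integral_cong simp: norm_mult c indicator_def)
  also have "\<dots> = (\<integral>\<^sup>+z. F z \<partial>disc_measure a)"
    by (subst nn_integral_rotate[OF _ c]) (simp_all add: nn_integral_disc_measure)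
  finally show ?thesis .
qed

text \<open>F (y^m) is invariant under the rotations of order m, so the kernel may be averaged over
  them. This costs one factor 1/m; \<open>nn_integral_disc_power\<close> gives the other.\<close>

lemma nn_green_power:
  assumes [measurable]: "F \<in> borel_measurable borel" and m: "m > (0::nat)" and x: "cmod x < 1"
  shows "(\<integral>\<^sup>+y. ennreal (green x y) * F (y ^ m) \<partial>disc_measure a) =
    ennreal (1 / (real m)\<^sup>2) * (\<integral>\<^sup>+z. ennreal (green (x ^ m) z) * F z \<partial>disc_measure ((a + 2) / real m - 2))"
proof -
  let ?w = "\<lambda>j. cis (2 * pi * real j / real m)"
  let ?I = "\<integral>\<^sup>+y. ennreal (green x y) * F (y ^ m) \<partial>disc_measure a"
  have w: "(?w j) ^ m = 1" for j by (rule cis_root_unity[OF m])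
  have rot: "(\<integral>\<^sup>+y. ennreal (green x (?w j * y)) * F (y ^ m) \<partial>disc_measure a) = ?I" for j
    using nn_integral_disc_rotate[of "\<lambda>y. ennreal (green x y) * F (y ^ m)" "?w j" a] by (simp add: power_mult_distrib w)
  have "of_nat m * ?I = (\<Sum>j<m. \<integral>\<^sup>+y. ennreal (green x (?w j * y)) * F (y ^ m) \<partial>disc_measure a)"
    unfolding rot by simp
  also have "\<dots> = (\<integral>\<^sup>+y. (\<Sum>j<m. ennreal (green x (?w j * y)) * F (y ^ m)) \<partial>disc_measure a)"
    by (rule nn_integral_sum[symmetric]) measurable
  also have "\<dots> = (\<integral>\<^sup>+y. ennreal (green (x ^ m) (y ^ m)) * F (y ^ m) \<partial>disc_measure a)"
  proof (rule nn_integral_cong_AE)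
    have "finite {y. y ^ m = x ^ m}"
    proof -
      have "{y. y ^ m = x ^ m} = {y. poly (monom 1 m - [:x ^ m:]) y = 0}" by (simp add: poly_monom)
      moreover have "monom 1 m - [:x ^ m:] \<noteq> 0"
      proof
        assume "monom 1 m - [:x ^ m:] = 0"
        then have "coeff (monom 1 m - [:x ^ m:]) m = 0" by simp
        then show False using m by (cases m) auto
      qed
      ultimately show ?thesis using poly_roots_finite by metis
    qed
    then have "AE y in disc_measure a. \<forall>z\<in>{y. y ^ m = x ^ m}. y \<noteq> z"
      by (subst AE_finite_all) (auto intro: AE_disc_measure_neq)
    then show "AE y in disc_measure a. (\<Sum>j<m. ennreal (green x (?w j * y)) * F (y ^ m)) = ennreal (green (x ^ m) (y ^ m)) * F (y ^ m)"
      using AE_disc_measure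
    proof eventually_elim
      case (elim y)
      have "(\<Sum>j<m. ennreal (green x (?w j * y))) = ennreal (\<Sum>j<m. green x (?w j * y))"
        by (rule sum_ennreal) (use elim x in \<open>auto intro!: green_nonneg simp: norm_mult\<close>)
      also have "(\<Sum>j<m. green x (?w j * y)) = green (x ^ m) (y ^ m)"
        using elim x by (intro sum_green_rotations m) auto
      finally show ?case by (simp add: sum_distrib_right[symmetric])
    qed
  qed
  also have "\<dots> = ennreal (1 / real m) * (\<integral>\<^sup>+z. ennreal (green (x ^ m) z) * F z \<partial>disc_measure ((a + 2) / real m - 2))"
    using m by (intro nn_integral_disc_power[of "\<lambda>z. ennreal (green (x ^ m) z) * F z"]) measurable
  finally have e: "of_nat m * ?I = \<dots>" .
  have "?I = ennreal (1 / real m) * (of_nat m * ?I)"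
    using m by (simp add: ennreal_of_nat_eq_real_of_nat mult.assoc[symmetric] ennreal_mult[symmetric])
  also have "\<dots> = ennreal (1 / (real m)\<^sup>2) * (\<integral>\<^sup>+z. ennreal (green (x ^ m) z) * F z \<partial>disc_measure ((a + 2) / real m - 2))"
    unfolding e by (simp add: mult.assoc[symmetric] ennreal_mult[symmetric] power2_eq_square)
  finally show ?thesis .
qed

text \<open>An \<open>ennreal\<close>-valued energy makes sense for every weight exponent. This
  includes the negative ones that can occur halfway through \<open>radial_energy_le\<close>, where
  integrability is not known beforehand.\<close>

definition nn_energy :: "real \<Rightarrow> (complex \<Rightarrow> ennreal) \<Rightarrow> ennreal" where
  "nn_energy a F = (\<integral>\<^sup>+x. F x * (\<integral>\<^sup>+y. ennreal (green x y) * F y \<partial>disc_measure a) \<partial>disc_measure a)"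

lemma sigma_finite_disc_measure: "sigma_finite_measure (disc_measure a)"
  unfolding disc_measure_def
  by (subst sigma_finite_measure.sigma_finite_iff_density_finite[OF sigma_finite_lborel]) auto

lemma measurable_nn_potential:
  assumes [measurable]: "F \<in> borel_measurable borel"
  shows "(\<lambda>x. \<integral>\<^sup>+y. ennreal (green x y) * F y \<partial>disc_measure a) \<in> borel_measurable borel"
proof -
  interpret sigma_finite_measure "disc_measure a" by (rule sigma_finite_disc_measure)
  have "(\<lambda>p. ennreal (green (fst p) (snd p)) * F (snd p)) \<in> borel_measurable (borel \<Otimes>\<^sub>M disc_measure a)" by measurable
  then show ?thesis by (intro borel_measurable_nn_integral) (simp add: case_prod_beta)
qed

text \<open>Two factors 1/m come from the inner integral by \<open>nn_green_power\<close>, the third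
  from the outer one.\<close>

lemma nn_energy_power:
  assumes [measurable]: "F \<in> borel_measurable borel" and m: "m > (0::nat)"
  shows "nn_energy a (\<lambda>x. F (x ^ m)) = ennreal (1 / real m ^ 3) * nn_energy ((a + 2) / real m - 2) F"
proof -
  let ?b = "(a + 2) / real m - 2"
  let ?T = "\<lambda>x. \<integral>\<^sup>+z. ennreal (green x z) * F z \<partial>disc_measure ?b"
  have [measurable]: "?T \<in> borel_measurable borel" by (rule measurable_nn_potential) measurable
  have "nn_energy a (\<lambda>x. F (x ^ m)) = (\<integral>\<^sup>+x. F (x ^ m) * (ennreal (1 / (real m)\<^sup>2) * ?T (x ^ m)) \<partial>disc_measure a)"
    unfolding nn_energy_def
  proof (rule nn_integral_cong_AE)
    show "AE x in disc_measure a. F (x ^ m) * (\<integral>\<^sup>+y. ennreal (green x y) * F (y ^ m) \<partial>disc_measure a) = F (x ^ m) * (ennreal (1 / (real m)\<^sup>2) * ?T (x ^ m))"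
      using AE_disc_measure by eventually_elim (simp add: nn_green_power[OF assms])
  qed
  also have "\<dots> = (\<integral>\<^sup>+x. ennreal (1 / (real m)\<^sup>2) * (F (x ^ m) * ?T (x ^ m)) \<partial>disc_measure a)"
    by (simp add: mult_ac)
  also have "\<dots> = ennreal (1 / (real m)\<^sup>2) * (\<integral>\<^sup>+x. F (x ^ m) * ?T (x ^ m) \<partial>disc_measure a)"
    by (rule nn_integral_cmult) measurable
  also have "(\<integral>\<^sup>+x. F (x ^ m) * ?T (x ^ m) \<partial>disc_measure a) = ennreal (1 / real m) * nn_energy ?b F"
    unfolding nn_energy_def using m by (intro nn_integral_disc_power[of "\<lambda>x. F x * ?T x"]) measurable
  finally show ?thesis
    by (simp add: mult.assoc[symmetric] ennreal_mult[symmetric] power2_eq_square power3_eq_cube)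
qed

lemma nn_potential_eq:
  assumes a: "0 \<le> a" and h: "admissible h" and x: "cmod x \<le> 1"
  shows "(\<integral>\<^sup>+y. ennreal (green x y) * ennreal (h y) \<partial>disc_measure a) = ennreal (potential a h x)"
proof -
  have nn: "AE y in disc_measure a. 0 \<le> green x y * h y"
    using AE_disc_measure by eventually_elim (use x h in \<open>auto intro!: mult_nonneg_nonneg green_nonneg simp: admissible_nonneg\<close>)
  have "(\<integral>\<^sup>+y. ennreal (green x y) * ennreal (h y) \<partial>disc_measure a) = (\<integral>\<^sup>+y. ennreal (green x y * h y) \<partial>disc_measure a)"
    by (intro nn_integral_cong) (simp add: ennreal_mult'' admissible_nonneg[OF h])
  also have "\<dots> = ennreal (potential a h x)"
    unfolding potential_def by (rule nn_integral_eq_integral[OF integrable_green_mult[OF a admissible_bdd[OF h] x] nn])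
  finally show ?thesis .
qed

lemma nn_energy_eq:
  assumes a: "0 \<le> a" and h: "admissible h"
  shows "nn_energy a (\<lambda>x. ennreal (h x)) = ennreal (energy a h h)"
proof -
  have p: "1 < (2::real)" by simp
  let ?v = "\<lambda>x. indicator (ball 0 1) x * potential a h x"
  have v: "admissible ?v" by (rule potential_disc_admissible[OF a p h])
  have i: "integrable (disc_measure a) (\<lambda>x. h x * ?v x)"
    by (intro integrable_mult_bounded[OF a p] admissible_bdd h v)
  have [measurable]: "h \<in> borel_measurable borel" "potential a h \<in> borel_measurable borel"
    using h measurable_potential[OF a p admissible_bdd[OF h]] by (auto simp: admissible_def bdd_borel_def)
  have "nn_energy a (\<lambda>x. ennreal (h x)) = (\<integral>\<^sup>+x. ennreal (h x * ?v x) \<partial>disc_measure a)"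
    unfolding nn_energy_def
  proof (rule nn_integral_cong_AE)
    show "AE x in disc_measure a. ennreal (h x) * (\<integral>\<^sup>+y. ennreal (green x y) * ennreal (h y) \<partial>disc_measure a) = ennreal (h x * ?v x)"
      using AE_disc_measure by eventually_elim (auto simp: nn_potential_eq[OF a h] ennreal_mult' admissible_nonneg[OF h])
  qed
  also have "\<dots> = ennreal (\<integral>x. h x * ?v x \<partial>disc_measure a)"
    by (rule nn_integral_eq_integral[OF i]) (intro AE_I2 mult_nonneg_nonneg admissible_nonneg[OF h] admissible_nonneg[OF v])
  also have "(\<integral>x. h x * ?v x \<partial>disc_measure a) = energy a h h"
    unfolding energy_def
  proof (rule integral_cong_AE)
    show "AE x in disc_measure a. h x * ?v x = h x * potential a h x" using AE_disc_measure by eventually_elim simp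
  qed measurable
  finally show ?thesis .
qed

lemma nn_mass_eq:
  assumes a: "0 \<le> a" and p: "1 < p" and h: "admissible h"
  shows "(\<integral>\<^sup>+x. ennreal (h x powr (1+1/p)) \<partial>disc_measure a) = ennreal (mass a p h)"
  unfolding mass_def using exponent_pos[OF a p]
  by (intro nn_integral_eq_integral integrable_admissible[OF a p] admissible_powr h) auto

lemma energy_scale: 
  assumes "0 \<le> a"
  shows "energy a (\<lambda>x. c * h x) (\<lambda>x. c * h x) = c\<^sup>2 * energy a h h"
proof -
  have "potential a (\<lambda>x. c * h x) x = c * potential a h x" for x
    using potential_scale[OF assms, of 2 c h x] by simp
  then show ?thesis
    unfolding energy_def by (simp add: power2_eq_square mult_ac flip: integral_mult_right_zero)
qed

text \<open>Energy is homogeneous of degree 2 and mass of degree 1 + 1/p; the exponent 2 / (1 + 1/p)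
  is their quotient.\<close>

lemma energy_le_max_scaled:
  assumes a: "0 \<le> a" and p: "1 < p" and h: "admissible h" "mass a p h \<le> m" and m: "0 < m"
  shows "energy a h h \<le> m powr (2 / (1 + 1/p)) * max_energy a p"
proof -
  note q = exponent_pos[OF a p]
  define c where "c = m powr (- 1 / (1 + 1/p))"
  have c: "0 < c" using m by (simp add: c_def)
  have cq: "c powr (1 + 1/p) = 1 / m" proof -
    have "- 1 / (1 + 1/p) * (1 + 1/p) = -1" using q by simp
    then show ?thesis using m by (simp only: c_def powr_powr) (simp add: powr_minus_divide)
  qed
  have "mass a p (\<lambda>x. c * h x) = 1 / m * mass a p h" using mass_scale[of c h a p] c h cq by simp
  also have "\<dots> \<le> 1" using h m by (simp add: field_simps)
  finally have "energy a (\<lambda>x. c * h x) (\<lambda>x. c * h x) \<le> max_energy a p"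
    using c by (intro energy_le_max[OF a p] admissible_scale h) auto
  then have "c\<^sup>2 * energy a h h \<le> max_energy a p" by (simp add: energy_scale[OF a])
  moreover have "m powr (2 / (1 + 1/p)) * c\<^sup>2 = 1"
    using m c by (simp add: c_def power2_eq_square powr_add[symmetric])
  ultimately show ?thesis using m mult_left_mono[of "c\<^sup>2 * energy a h h" "max_energy a p" "m powr (2 / (1 + 1/p))"]
    by (simp add: mult.assoc[symmetric])
qed

section \<open>Comparing the maximal energies for different weights\<close>

lemma nn_integral_disc_weight:
  assumes [measurable]: "f \<in> borel_measurable borel"
  shows "(\<integral>\<^sup>+z. f z \<partial>disc_measure b) = (\<integral>\<^sup>+z. ennreal (norm z powr b) * f z \<partial>disc_measure 0)"
proof -
  have "(\<integral>\<^sup>+z. ennreal (norm z powr b) * f z \<partial>disc_measure 0) = (\<integral>\<^sup>+z. ennreal (norm z powr 0) * (ennreal (norm z powr b) * f z) * indicator (ball 0 1) z \<partial>lborel)"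
    by (rule nn_integral_disc_measure) measurable
  also have "\<dots> = (\<integral>\<^sup>+z. ennreal (norm z powr b) * f z * indicator (ball 0 1) z \<partial>lborel)"
    by (intro nn_integral_cong_AE eventually_mono[OF AE_lborel_singleton[of 0]]) (auto)
  finally show ?thesis by (simp add: nn_integral_disc_measure)
qed

lemma nn_energy_weight:
  assumes [measurable]: "F \<in> borel_measurable borel"
  shows "nn_energy b F = nn_energy 0 (\<lambda>x. ennreal (norm x powr b) * F x)"
  unfolding nn_energy_def
proof (subst nn_integral_disc_weight)
  have [measurable]: "(\<lambda>x. \<integral>\<^sup>+y. ennreal (green x y) * F y \<partial>disc_measure b) \<in> borel_measurable borel" by (rule measurable_nn_potential) measurable
  show "(\<lambda>x. F x * (\<integral>\<^sup>+y. ennreal (green x y) * F y \<partial>disc_measure b)) \<in> borel_measurable borel" by measurable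
  have "(\<integral>\<^sup>+y. ennreal (green x y) * F y \<partial>disc_measure b) = (\<integral>\<^sup>+y. ennreal (green x y) * (ennreal (norm y powr b) * F y) \<partial>disc_measure 0)" for x
    by (subst nn_integral_disc_weight) (auto intro!: nn_integral_cong simp: mult_ac)
  then show "(\<integral>\<^sup>+z. ennreal (norm z powr b) * (F z * (\<integral>\<^sup>+y. ennreal (green z y) * F y \<partial>disc_measure b)) \<partial>disc_measure 0)
    = (\<integral>\<^sup>+x. ennreal (norm x powr b) * F x * (\<integral>\<^sup>+y. ennreal (green x y) * (ennreal (norm y powr b) * F y) \<partial>disc_measure 0) \<partial>disc_measure 0)"
    by (simp add: mult.assoc)
qed

lemma nn_energy_cong:
  assumes "\<And>x. x \<in> ball 0 1 \<Longrightarrow> F x = G x"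
  shows "nn_energy a F = nn_energy a G"
proof -
  have "(\<integral>\<^sup>+y. ennreal (green x y) * F y \<partial>disc_measure a) = (\<integral>\<^sup>+y. ennreal (green x y) * G y \<partial>disc_measure a)" for x
    by (intro nn_integral_cong_AE eventually_mono[OF AE_disc_measure]) (simp add: assms)
  then show ?thesis unfolding nn_energy_def
    by (intro nn_integral_cong_AE eventually_mono[OF AE_disc_measure]) (simp add: assms)
qed

lemma max_energy_le:
  assumes a: "0 \<le> a" and p: "1 < p" and "\<And>h. admissible h \<Longrightarrow> mass a p h \<le> 1 \<Longrightarrow> energy a h h \<le> K"
  shows "max_energy a p \<le> K"
  unfolding max_energy_def
proof (rule cSup_least)
  show "{energy a h h | h. admissible h \<and> mass a p h \<le> 1} \<noteq> {}"
    using admissible_const[of 0] by (auto simp: mass_def intro!: exI[of _ "\<lambda>_. 0"])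
qed (use assms(3) in auto)

text \<open>Moving the weight into the density, h -> |x|^b h, preserves the energy. It does not
  increase the mass, because (|x|^b)^(1 + 1/p) <= |x|^b on the disc.\<close>

lemma max_energy_le_zero_weight:
  assumes b: "0 \<le> b" and p: "1 < p"
  shows "max_energy b p \<le> max_energy 0 p"
proof (rule max_energy_le[OF b p])
  fix h assume h: "admissible h" and mh: "mass b p h \<le> 1"
  have [measurable]: "h \<in> borel_measurable borel" using h by measurable
  define v where "v = (\<lambda>x. indicator (ball 0 1) x * (norm x powr b * h x))"
  obtain B where B: "B \<ge> 0" "\<And>x. 0 \<le> h x" "\<And>x. h x \<le> B" using admissibleE[OF h] by blast
  have w1: "norm x powr b \<le> 1" if "x \<in> ball 0 1" for x :: complex
    using that b powr_mono2[of b "norm x" 1] by simp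
  have v: "admissible v"
  proof (rule admissibleI)
    show "v \<in> borel_measurable borel" unfolding v_def by measurable
    show "v x \<le> B" for x
      using w1[of x] B mult_mono[of "norm x powr b" 1 "h x" B] by (auto simp: v_def indicator_def)
  qed (auto simp: v_def B indicator_def)
  have "ennreal (energy 0 v v) = nn_energy 0 (\<lambda>x. ennreal (v x))" by (rule nn_energy_eq[symmetric, OF _ v]) simp
  also have "\<dots> = nn_energy 0 (\<lambda>x. ennreal (norm x powr b) * ennreal (h x))"
    by (rule nn_energy_cong) (simp add: v_def ennreal_mult B)
  also have "\<dots> = nn_energy b (\<lambda>x. ennreal (h x))" by (rule nn_energy_weight[symmetric]) measurable
  also have "\<dots> = ennreal (energy b h h)" by (rule nn_energy_eq[OF b h])
  finally have e: "energy 0 v v = energy b h h"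
    using energy_nonneg[OF b admissible_bdd[OF h]] energy_nonneg[OF order_refl admissible_bdd[OF v]] by simp
  have "ennreal (mass 0 p v) = (\<integral>\<^sup>+x. ennreal (v x powr (1+1/p)) \<partial>disc_measure 0)"
    by (rule nn_mass_eq[symmetric, OF _ p v]) simp
  also have "\<dots> \<le> (\<integral>\<^sup>+x. ennreal (norm x powr b) * ennreal (h x powr (1+1/p)) \<partial>disc_measure 0)"
  proof (rule nn_integral_mono)
    fix x
    show "ennreal (v x powr (1+1/p)) \<le> ennreal (norm x powr b) * ennreal (h x powr (1+1/p))"
    proof (cases "x \<in> ball 0 1")
      case True
      have "(norm x powr b) powr (1+1/p) \<le> (norm x powr b) powr 1"
        using w1[OF True] p by (intro powr_mono') auto
      then have "v x powr (1+1/p) \<le> norm x powr b * h x powr (1+1/p)"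
        using True B by (auto simp: v_def powr_mult intro!: mult_right_mono)
      then show ?thesis by (simp add: ennreal_mult[symmetric] ennreal_leI)
    qed (simp add: v_def)
  qed
  also have "\<dots> = (\<integral>\<^sup>+x. ennreal (h x powr (1+1/p)) \<partial>disc_measure b)" by (rule nn_integral_disc_weight[symmetric]) measurable
  also have "\<dots> = ennreal (mass b p h)" by (rule nn_mass_eq[OF b p h])
  finally have "mass 0 p v \<le> mass b p h" using mass_nonneg[OF b p, of h] by (simp add: ennreal_le_iff)
  then show "energy b h h \<le> max_energy 0 p"
    using energy_le_max[OF order_refl p v] mh e by simp
qed

text \<open>Transplanting to the subdisc with centre \<open>3/4\<close> and radius \<open>1/4\<close>, where the weight is bounded
  below, only increases the Green function.\<close>

lemma green_subdisc:
  assumes x: "cmod x < 1" and y: "cmod y < 1"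
  shows "green x y \<le> green (3/4 + x/4) (3/4 + y/4)"
proof (cases "x = y")
  case True
  then show ?thesis by (simp add: green_def)
next
  case False
  let ?D = "1 - x * cnj y"
  have D: "cmod ?D > 0"
    using cmod_diff_le_one_minus[of x y] x y False by (auto intro: less_le_trans[of 0 "cmod (x-y)"])
  \<comment> \<open>The distance |x - y| shrinks by exactly 1/4, so it remains to show that |1 - x *
    cnj y| shrinks by no more. By \<open>id\<close> this says |1 + 3 w / 4| >= 1, for which Re w >=
    0 suffices.\<close>
  define w where "w = (1 - x) * (1 - cnj y) / ?D"
  have x1: "1 - x \<noteq> 0" and y1: "1 - cnj y \<noteq> 0" using x y by auto
  have id: "1 - (3/4 + x/4) * cnj (3/4 + y/4) = (?D + 3/4 * ((1 - x) * (1 - cnj y))) / 4"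
    by (simp add: field_simps)
  have Re_half: "Re (1 / (1 - z)) \<ge> 1/2" if "cmod z < 1" for z
  proof -
    have z: "1 - z \<noteq> 0" using that by auto
    have "(cmod (1 - z))\<^sup>2 = 1 - 2 * Re z + (cmod z)\<^sup>2" unfolding cmod_power2 by (simp add: power2_eq_square algebra_simps)
    moreover have "(cmod z)\<^sup>2 \<le> 1" using that by (simp add: abs_square_le_1)
    ultimately have "(cmod (1 - z))\<^sup>2 \<le> 2 * Re (1 - z)" by simp
    moreover have "Re (1 / (1 - z)) = Re (1 - z) / (cmod (1 - z))\<^sup>2"
      by (simp add: Re_divide cmod_power2)
    moreover have "0 < (cmod (1 - z))\<^sup>2" using z by simp
    ultimately show ?thesis by (simp only: pos_le_divide_eq)
  qed
  \<comment> \<open>The map z -> 1 / (1 - z) sends the disc into the half plane Re >= 1/2, so the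
    two terms outweigh the -1.\<close>
  have "1 / w = 1 / (1 - cnj y) + (1 / (1 - x) - 1)"
    using x1 y1 D by (simp add: w_def field_simps)
  then have "Re (1 / w) \<ge> 0" using Re_half[of "cnj y"] Re_half[of x] x y by simp
  moreover have "Re (1 / w) = Re w / (cmod w)\<^sup>2" by (simp add: Re_divide cmod_power2)
  ultimately have Rw: "Re w \<ge> 0" by (cases "w = 0") (auto simp: zero_le_divide_iff)
  have "?D + 3/4 * ((1 - x) * (1 - cnj y)) = ?D * (1 + 3/4 * w)"
    using D by (simp add: w_def field_simps)
  moreover have "1 \<le> cmod (1 + 3/4 * w)"
    using complex_Re_le_cmod[of "1 + 3/4 * w"] Rw by simp
  ultimately have "cmod ?D \<le> cmod (?D + 3/4 * ((1 - x) * (1 - cnj y)))"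
    using D by (simp add: norm_mult)
  then have "cmod ?D / 4 \<le> cmod (1 - (3/4 + x/4) * cnj (3/4 + y/4))" unfolding id by (simp add: norm_divide)
  then have l1: "ln (cmod ?D / 4) \<le> ln (cmod (1 - (3/4 + x/4) * cnj (3/4 + y/4)))" using D by (intro ln_mono) auto
  have "(3/4 + x/4) - (3/4 + y/4) = (x - y) / 4" by (simp add: field_simps)
  then have "cmod ((3/4 + x/4) - (3/4 + y/4)) = cmod (x - y) / 4" by (metis norm_divide norm_numeral)
  then have l2: "ln (cmod ((3/4 + x/4) - (3/4 + y/4))) = ln (cmod (x - y) / 4)" by (simp only:)
  have l3: "ln (cmod ?D / 4) - ln (cmod (x - y) / 4) = ln (cmod ?D) - ln (cmod (x - y))"
    using D False by (simp add: ln_div)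
  have "green (3/4 + x/4) (3/4 + y/4) =
      (ln (cmod (1 - (3/4 + x/4) * cnj (3/4 + y/4))) - ln (cmod ((3/4 + x/4) - (3/4 + y/4)))) / (2 * pi)"
    using False unfolding green_def by auto
  also have "\<dots> \<ge> (ln (cmod ?D) - ln (cmod (x - y))) / (2 * pi)"
    unfolding l2 using l1 l3 by (intro divide_right_mono) auto
  finally show ?thesis using False by (simp add: green_def)
qed

lemma nn_integral_subdisc:
  assumes [measurable]: "f \<in> borel_measurable borel"
  shows "(\<integral>\<^sup>+z. f z * indicator (ball (3/4) (1/4)) z \<partial>disc_measure 0) = ennreal (1/16) * (\<integral>\<^sup>+x. f (3/4 + x/4) \<partial>disc_measure 0)"
proof -
  have "(\<integral>\<^sup>+z. f z * indicator (ball (3/4) (1/4)) z \<partial>disc_measure 0) = (\<integral>\<^sup>+z. ennreal (norm z powr 0) * (f z * indicator (ball (3/4) (1/4)) z) * indicator (ball 0 1) z \<partial>lborel)"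
    by (rule nn_integral_disc_measure) measurable
  also have "\<dots> = (\<integral>\<^sup>+z. f z * indicator (ball (3/4) (1/4)) z \<partial>lborel)"
  proof (rule nn_integral_cong_AE)
    have "cmod z < 1" if "z \<in> ball (3/4) (1/4)" for z
    proof -
      have "cmod z \<le> cmod (3/4 :: complex) + cmod (z - 3/4)" by (metis add.commute diff_add_cancel norm_triangle_ineq)
      then show ?thesis using that by (simp add: dist_norm norm_minus_commute norm_divide)
    qed
    then show "AE z in lborel. ennreal (norm z powr 0) * (f z * indicator (ball (3/4) (1/4)) z) * indicator (ball 0 1) z = f z * indicator (ball (3/4) (1/4)) z"
      by (intro eventually_mono[OF AE_lborel_singleton[of 0]]) (auto simp: indicator_def)
  qed
  also have "\<dots> = (\<integral>\<^sup>+z. f z * indicator (ball (3/4) (1/4)) z \<partial>density (distr lborel borel (\<lambda>x. 3/4 + (1/4) *\<^sub>R x)) (\<lambda>_. ennreal (\<bar>1/4\<bar> ^ DIM(complex))))"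
    using lborel_affine[of "1/4" "3/4 :: complex"] by simp
  also have "\<dots> = ennreal (1/16) * (\<integral>\<^sup>+x. f (3/4 + (1/4) *\<^sub>R x) * indicator (ball (3/4) (1/4)) (3/4 + (1/4) *\<^sub>R x) \<partial>lborel)"
    by (subst nn_integral_density, simp, simp, subst nn_integral_distr, simp, simp, subst nn_integral_cmult)
      (auto simp: power2_eq_square)
  also have "(\<integral>\<^sup>+x. f (3/4 + (1/4) *\<^sub>R x) * indicator (ball (3/4) (1/4)) (3/4 + (1/4) *\<^sub>R x) \<partial>lborel) = (\<integral>\<^sup>+x. f (3/4 + x/4) \<partial>disc_measure 0)"
  proof (subst nn_integral_disc_measure)
    show "(\<integral>\<^sup>+x. f (3/4 + (1/4) *\<^sub>R x) * indicator (ball (3/4) (1/4)) (3/4 + (1/4) *\<^sub>R x) \<partial>lborel) =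
      (\<integral>\<^sup>+x. ennreal (norm x powr 0) * f (3/4 + x/4) * indicator (ball 0 1) x \<partial>lborel)"
      by (intro nn_integral_cong_AE eventually_mono[OF AE_lborel_singleton[of 0]])
        (auto simp: indicator_def dist_norm scaleR_conv_of_real norm_divide norm_mult)
  qed measurable
  finally show ?thesis .
qed

text \<open>Each of the two variables contributes the area factor 1/16, and
  \<open>green_subdisc\<close> points in the favourable direction.\<close>

lemma nn_energy_subdisc:
  assumes [measurable]: "F \<in> borel_measurable borel"
  shows "ennreal (1/256) * nn_energy 0 (\<lambda>x. F (3/4 + x/4)) \<le> nn_energy 0 (\<lambda>z. F z * indicator (ball (3/4) (1/4)) z)"
proof -
  let ?S = "ball (3/4) (1/4) :: complex set"
  have [measurable]: "(\<lambda>x. \<integral>\<^sup>+y. ennreal (green x y) * G y \<partial>disc_measure 0) \<in> borel_measurable borel" if [measurable]: "G \<in> borel_measurable borel" for G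
    by (rule measurable_nn_potential) measurable
  have inner: "(\<integral>\<^sup>+y. ennreal (green x y) * (F y * indicator ?S y) \<partial>disc_measure 0) = ennreal (1/16) * (\<integral>\<^sup>+y. ennreal (green x (3/4 + y/4)) * F (3/4 + y/4) \<partial>disc_measure 0)" for x
    using nn_integral_subdisc[of "\<lambda>y. ennreal (green x y) * F y"] by (simp add: mult.assoc)
  have mF [measurable]: "(\<lambda>x. F (3/4 + x/4)) \<in> borel_measurable borel" by measurable
  have mgF: "(\<lambda>x. \<integral>\<^sup>+y. ennreal (green x y) * (F y * indicator ?S y) \<partial>disc_measure 0) \<in> borel_measurable borel"
    by (rule measurable_nn_potential) measurable
  note [measurable] = mgF
  have "nn_energy 0 (\<lambda>z. F z * indicator ?S z) = (\<integral>\<^sup>+x. (F x * (\<integral>\<^sup>+y. ennreal (green x y) * (F y * indicator ?S y) \<partial>disc_measure 0)) * indicator ?S x \<partial>disc_measure 0)"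
    unfolding nn_energy_def by (intro nn_integral_cong) (simp add: mult_ac)
  also have "\<dots> = ennreal (1/16) * (\<integral>\<^sup>+x. F (3/4 + x/4) * (\<integral>\<^sup>+y. ennreal (green (3/4 + x/4) y) * (F y * indicator ?S y) \<partial>disc_measure 0) \<partial>disc_measure 0)"
    by (subst nn_integral_subdisc) simp_all
  finally have e: "nn_energy 0 (\<lambda>z. F z * indicator ?S z) = ennreal (1/16) * (\<integral>\<^sup>+x. F (3/4 + x/4) * (ennreal (1/16) * (\<integral>\<^sup>+y. ennreal (green (3/4 + x/4) (3/4 + y/4)) * F (3/4 + y/4) \<partial>disc_measure 0)) \<partial>disc_measure 0)"
    unfolding inner .
  have m1: "(\<lambda>x. \<integral>\<^sup>+y. ennreal (green x y) * F (3/4 + y/4) \<partial>disc_measure 0) \<in> borel_measurable borel"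
    by (rule measurable_nn_potential) measurable
  note [measurable] = m1
  have "ennreal (1/256) * nn_energy 0 (\<lambda>x. F (3/4 + x/4)) = ennreal (1/16) * (ennreal (1/16) * nn_energy 0 (\<lambda>x. F (3/4 + x/4)))"
    by (simp add: mult.assoc[symmetric] ennreal_mult[symmetric])
  also have "ennreal (1/16) * nn_energy 0 (\<lambda>x. F (3/4 + x/4)) = (\<integral>\<^sup>+x. F (3/4 + x/4) * (ennreal (1/16) * (\<integral>\<^sup>+y. ennreal (green x y) * F (3/4 + y/4) \<partial>disc_measure 0)) \<partial>disc_measure 0)"
    unfolding nn_energy_def by (subst nn_integral_cmult[symmetric]) (auto simp: mult_ac)
  also have "ennreal (1/16) * \<dots> \<le> nn_energy 0 (\<lambda>z. F z * indicator ?S z)"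
    unfolding e
  proof (intro mult_left_mono nn_integral_mono_AE)
    show "AE x in disc_measure 0. F (3/4 + x/4) * (ennreal (1/16) * (\<integral>\<^sup>+y. ennreal (green x y) * F (3/4 + y/4) \<partial>disc_measure 0))
       \<le> F (3/4 + x/4) * (ennreal (1/16) * (\<integral>\<^sup>+y. ennreal (green (3/4 + x/4) (3/4 + y/4)) * F (3/4 + y/4) \<partial>disc_measure 0))"
      using AE_disc_measure
    proof eventually_elim
      case (elim x)
      have "AE y in disc_measure 0. ennreal (green x y) * F (3/4 + y/4) \<le> ennreal (green (3/4 + x/4) (3/4 + y/4)) * F (3/4 + y/4)"
        using AE_disc_measure by eventually_elim (use elim in \<open>auto intro!: mult_right_mono ennreal_leI green_subdisc\<close>)
      then show ?case by (intro mult_left_mono nn_integral_mono_AE) auto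
    qed
  qed simp
  finally show ?thesis .
qed

text \<open>A competitor for weight 0 is shrunk to the small disc. The energy drops at most by 1/256
  and the mass is multiplied by at most K = 2^(b/p) / 16. Normalization raises K to the power 2 -
  2/(p+1), so 16^(-2) cancels 256 and only a factor to the power 1/(p+1) survives.\<close>

lemma max_energy_ge_subdisc:
  assumes b: "0 \<le> b" and p: "1 < p"
  shows "max_energy 0 p \<le> (256 * 2 powr (2 * b)) powr (1 / (p + 1)) * max_energy b p"
proof (rule max_energy_le[OF order_refl p])
  fix v assume v: "admissible v" and mv: "mass 0 p v \<le> 1"
  note q = exponent_pos[OF b p]
  have vm [measurable]: "v \<in> borel_measurable borel" using v by measurable
  let ?S = "ball (3/4) (1/4) :: complex set"
  obtain B where B: "B \<ge> 0" "\<And>x. 0 \<le> v x" "\<And>x. v x \<le> B" using admissibleE[OF v] by blast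
  have S: "1/2 \<le> cmod z" "cmod z < 1" if "z \<in> ?S" for z
  proof -
    have "cmod z \<le> cmod (3/4 :: complex) + cmod (z - 3/4)" by (metis add.commute diff_add_cancel norm_triangle_ineq)
    then show "cmod z < 1" using that by (simp add: dist_norm norm_minus_commute norm_divide)
    have "cmod (3/4 :: complex) \<le> cmod z + cmod (3/4 - z)" by (metis add.commute diff_add_cancel norm_triangle_ineq)
    then show "1/2 \<le> cmod z" using that by (simp add: dist_norm norm_divide)
  qed
  define F where "F = (\<lambda>z. v (4 * z - 3))"
  have [measurable]: "F \<in> borel_measurable borel" unfolding F_def by measurable
  have Fv: "F (3/4 + x/4) = v x" for x by (simp add: F_def)
  \<comment> \<open>Division by the weight makes |z|^b H equal to the transplanted function. It
    stays bounded since |z| >= 1/2 on the small disc.\<close>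
  define H where "H = (\<lambda>z. indicator ?S z * (norm z powr (-b) * F z))"
  have w: "norm z powr (-b) \<le> 2 powr b" if "z \<in> ?S" for z
  proof -
    have "norm z powr (-b) \<le> (1/2) powr (-b)" using S[OF that] b by (intro powr_mono2') auto
    then show ?thesis by (simp add: powr_divide powr_minus_divide)
  qed
  have H: "admissible H"
  proof (rule admissibleI)
    show "H \<in> borel_measurable borel" unfolding H_def by measurable
    show "H z \<le> 2 powr b * B" for z
      using w[of z] B by (auto simp: H_def F_def indicator_def intro!: mult_mono)
  qed (auto simp: H_def F_def B)
  have "ennreal (1/256) * ennreal (energy 0 v v) = ennreal (1/256) * nn_energy 0 (\<lambda>x. ennreal (F (3/4 + x/4)))"
    using nn_energy_eq[OF order_refl v] by (simp add: Fv)
  also have "\<dots> \<le> nn_energy 0 (\<lambda>z. ennreal (F z) * indicator ?S z)"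
    by (rule nn_energy_subdisc) measurable
  also have "\<dots> = nn_energy 0 (\<lambda>z. ennreal (norm z powr b) * ennreal (H z))"
  proof (rule nn_energy_cong)
    fix z :: complex
    show "ennreal (F z) * indicator ?S z = ennreal (norm z powr b) * ennreal (H z)"
    proof (cases "z \<in> ?S")
      case True
      then have "z \<noteq> 0" using S(1) by fastforce
      then have "norm z powr b * H z = F z" using True by (simp add: H_def powr_minus_divide)
      then show ?thesis using True by (simp add: ennreal_mult[symmetric] H_def F_def B)
    qed (simp add: H_def)
  qed
  also have "\<dots> = nn_energy b (\<lambda>z. ennreal (H z))" by (rule nn_energy_weight[symmetric]) (use H in measurable)
  also have "\<dots> = ennreal (energy b H H)" by (rule nn_energy_eq[OF b H])
  finally have e: "energy 0 v v \<le> 256 * energy b H H"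
    using energy_nonneg[OF b admissible_bdd[OF H]] energy_nonneg[OF order_refl admissible_bdd[OF v]]
    by (simp add: ennreal_mult[symmetric] ennreal_le_iff)
  define K where "K = 2 powr (b/p) / 16"
  have K: "0 < K" by (simp add: K_def)
  have "ennreal (mass b p H) = (\<integral>\<^sup>+z. ennreal (H z powr (1+1/p)) \<partial>disc_measure b)"
    by (rule nn_mass_eq[symmetric, OF b p H])
  also have "\<dots> = (\<integral>\<^sup>+z. ennreal (norm z powr b) * ennreal (H z powr (1+1/p)) \<partial>disc_measure 0)"
    by (rule nn_integral_disc_weight) (use H in measurable)
  also have "\<dots> \<le> (\<integral>\<^sup>+z. (ennreal (2 powr (b/p)) * ennreal (F z powr (1+1/p))) * indicator ?S z \<partial>disc_measure 0)"
  proof (rule nn_integral_mono)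
    fix z
    show "ennreal (norm z powr b) * ennreal (H z powr (1+1/p)) \<le> (ennreal (2 powr (b/p)) * ennreal (F z powr (1+1/p))) * indicator ?S z"
    proof (cases "z \<in> ?S")
      case True
      have "norm z powr b * H z powr (1+1/p) = norm z powr b * norm z powr (-b * (1+1/p)) * F z powr (1+1/p)"
        using True by (simp add: H_def powr_mult F_def B powr_powr)
      also have "norm z powr b * norm z powr (-b * (1+1/p)) = norm z powr (-(b/p))"
        by (simp add: powr_add[symmetric] algebra_simps)
      also have "norm z powr (-(b/p)) \<le> 2 powr (b/p)"
      proof -
        have "norm z powr (-(b/p)) \<le> (1/2) powr (-(b/p))" using S[OF True] b p by (intro powr_mono2') auto
        then show ?thesis by (simp add: powr_divide powr_minus_divide)
      qed
      finally have "norm z powr b * H z powr (1+1/p) \<le> 2 powr (b/p) * F z powr (1+1/p)" by (simp add: mult_right_mono)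
      then show ?thesis using True by (simp add: ennreal_mult[symmetric] ennreal_leI)
    qed (simp add: H_def)
  qed
  also have "\<dots> = ennreal (1/16) * (\<integral>\<^sup>+x. ennreal (2 powr (b/p)) * ennreal (v x powr (1+1/p)) \<partial>disc_measure 0)"
    by (subst nn_integral_subdisc) (simp_all add: Fv)
  also have "\<dots> = ennreal (1/16) * (ennreal (2 powr (b/p)) * (\<integral>\<^sup>+x. ennreal (v x powr (1+1/p)) \<partial>disc_measure 0))"
    by (subst nn_integral_cmult) simp_all
  also have "\<dots> = ennreal (1/16) * (ennreal (2 powr (b/p)) * ennreal (mass 0 p v))"
    by (simp only: nn_mass_eq[OF order_refl p v])
  also have "\<dots> = ennreal (K * mass 0 p v)"
    using mass_nonneg[OF order_refl p, of v] by (simp add: K_def ennreal_mult[symmetric] mult_ac)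
  finally have "mass b p H \<le> K * mass 0 p v" using K mass_nonneg[OF order_refl p, of v] by (simp add: ennreal_le_iff)
  also have "\<dots> \<le> K" using K mv by (simp add: mult_left_le)
  finally have "energy b H H \<le> K powr (2 / (1 + 1/p)) * max_energy b p"
    by (intro energy_le_max_scaled[OF b p H] K)
  with e have "energy 0 v v \<le> 256 * K powr (2 / (1 + 1/p)) * max_energy b p" by simp
  also have "256 * K powr (2 / (1 + 1/p)) = (256 * 2 powr (2 * b)) powr (1 / (p + 1))"
  proof -
    have ex: "2 / (1 + 1/p) = 2 - 2 / (p+1)" "b / p * (2 / (1 + 1/p)) = 2 * b * (1 / (p+1))"
      using p by (auto simp: field_simps)
    have 16: "(16::real) powr 2 = 256" by simp
    have "K powr (2 / (1 + 1/p)) = 2 powr (2 * b * (1 / (p+1))) / 16 powr (2 - 2 / (p+1))"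
      unfolding K_def powr_divide powr_powr ex(2) by (simp only: ex(1))
    also have "(16::real) powr (2 - 2 / (p+1)) = 256 / 16 powr (2 * (1 / (p+1)))"
      by (simp add: powr_diff)
    also have "(16::real) powr (2 * (1 / (p+1))) = 256 powr (1 / (p+1))"
      by (simp only: powr_powr[symmetric] 16)
    finally show ?thesis by (simp add: powr_mult powr_powr) (simp add: mult.commute)
  qed
  finally show "energy 0 v v \<le> (256 * 2 powr (2 * b)) powr (1 / (p + 1)) * max_energy b p" .
qed

text \<open>A radial h factors through z^m for every m; with m = k + 1 it is compared with the
  pullback under z^k. The energy changes by (k/m)^3 and the mass by m/k. After normalization this is
  (k/m)^(3 - 2/(1 + 1/p)), whose exponent equals 1 + 2/(p+1).\<close>

lemma radial_energy_le:
  assumes b: "0 < b" and p: "1 < p" and k: "0 < (k::nat)" "2 / b \<le> real k"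
    and h: "admissible h" "mass b p h \<le> 1" and rad: "\<And>x. x \<in> ball 0 1 \<Longrightarrow> h x = g (cmod x)"
  shows "energy b h h \<le> (real k / real (k + 1)) powr (1 + 2 / (p + 1)) * max_energy 0 p"
proof -
  define m where "m = k + 1"
  have m: "0 < m" by (simp add: m_def)
  define c where "c = (b + 2) / real m - 2"
  \<comment> \<open>Chosen so that degree m from weight b and degree k from weight b' lead to the
    same weight c. The assumption \<open>2 / b \<le> real k\<close> says exactly that b' >= 0, as
    the comparison with weight 0 requires; c itself may be negative.\<close>
  define b' where "b' = (b + 2) * real k / real m - 2"
  have b': "0 \<le> b'"
  proof -
    have "2 \<le> real k * b" using k b by (simp add: field_simps)
    then show ?thesis by (simp add: b'_def m_def field_simps)
  qed
  have c': "(b' + 2) / real k - 2 = c" using k by (simp add: b'_def c_def)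
  have [measurable]: "h \<in> borel_measurable borel" using h by measurable
  obtain B where B: "B \<ge> 0" "\<And>x. 0 \<le> h x" "\<And>x. h x \<le> B" using admissibleE[OF h(1)] by blast
  \<comment> \<open>There is no global m-th root on the disc, but for radial h it is enough to
    evaluate at the real m-th root of the modulus.\<close>
  define F where "F = (\<lambda>z. h (complex_of_real (cmod z powr (1 / real m))))"
  have [measurable]: "F \<in> borel_measurable borel" unfolding F_def by measurable
  have Fm: "F (x ^ m) = h x" if "x \<in> ball 0 1" for x
  proof -
    have "cmod (x ^ m) powr (1 / real m) = cmod x"
      using m by (cases "x = 0") (auto simp: norm_power powr_realpow[symmetric] powr_powr)
    then show ?thesis using that rad by (simp add: F_def)
  qed
  define H where "H = (\<lambda>x. F (x ^ k))"
  have H: "admissible H"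
    unfolding H_def by (rule admissibleI[where B=B]) (auto simp: F_def B)
  note qb = exponent_pos[OF less_imp_le[OF b] p]
  have "ennreal (energy b h h) = nn_energy b (\<lambda>x. ennreal (h x))" using b by (simp add: nn_energy_eq h)
  also have "\<dots> = nn_energy b (\<lambda>x. ennreal (F (x ^ m)))" by (rule nn_energy_cong) (simp add: Fm)
  also have "\<dots> = ennreal (1 / real m ^ 3) * nn_energy c (\<lambda>z. ennreal (F z))"
    unfolding c_def by (rule nn_energy_power[OF _ m]) measurable
  finally have E1: "ennreal (energy b h h) = ennreal (1 / real m ^ 3) * nn_energy c (\<lambda>z. ennreal (F z))" .
  have "ennreal (energy b' H H) = nn_energy b' (\<lambda>x. ennreal (F (x ^ k)))" using nn_energy_eq[OF b' H] by (simp add: H_def)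
  also have "\<dots> = ennreal (1 / real k ^ 3) * nn_energy c (\<lambda>z. ennreal (F z))"
    unfolding c'[symmetric] by (rule nn_energy_power[OF _ k(1)]) measurable
  finally have E2: "ennreal (energy b' H H) = ennreal (1 / real k ^ 3) * nn_energy c (\<lambda>z. ennreal (F z))" .
  have "ennreal ((real k / real m) ^ 3 * energy b' H H) = ennreal ((real k / real m) ^ 3) * (ennreal (1 / real k ^ 3) * nn_energy c (\<lambda>z. ennreal (F z)))"
    using energy_nonneg[OF b' admissible_bdd[OF H]] by (simp add: ennreal_mult E2[symmetric])
  also have "\<dots> = ennreal (energy b h h)"
    unfolding E1 using k m by (simp add: mult.assoc[symmetric] ennreal_mult[symmetric] power_divide)
  finally have "ennreal ((real k / real m) ^ 3 * energy b' H H) = ennreal (energy b h h)" .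
  then have E: "energy b h h = (real k / real m) ^ 3 * energy b' H H"
    using energy_nonneg[OF b' admissible_bdd[OF H]] energy_nonneg[OF less_imp_le[OF b] admissible_bdd[OF h(1)]]
    by (subst (asm) ennreal_inj) auto
  have "ennreal (mass b p h) = (\<integral>\<^sup>+x. ennreal (F (x ^ m) powr (1+1/p)) \<partial>disc_measure b)"
    unfolding nn_mass_eq[OF less_imp_le[OF b] p h(1), symmetric]
    by (intro nn_integral_cong_AE eventually_mono[OF AE_disc_measure]) (simp add: Fm)
  also have "\<dots> = ennreal (1 / real m) * (\<integral>\<^sup>+z. ennreal (F z powr (1+1/p)) \<partial>disc_measure c)"
    unfolding c_def using m by (intro nn_integral_disc_power[of "\<lambda>z. ennreal (F z powr (1+1/p))"]) measurable
  finally have M1: "ennreal (mass b p h) = \<dots>" .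
  have "ennreal (mass b' p H) = (\<integral>\<^sup>+x. ennreal (F (x ^ k) powr (1+1/p)) \<partial>disc_measure b')"
    unfolding nn_mass_eq[OF b' p H, symmetric] by (simp add: H_def)
  also have "\<dots> = ennreal (1 / real k) * (\<integral>\<^sup>+z. ennreal (F z powr (1+1/p)) \<partial>disc_measure c)"
    unfolding c'[symmetric] using k by (intro nn_integral_disc_power[of "\<lambda>z. ennreal (F z powr (1+1/p))"]) measurable
  finally have M2: "ennreal (mass b' p H) = \<dots>" .
  have "ennreal (real m / real k * mass b p h) = ennreal (real m / real k) * (ennreal (1 / real m) * (\<integral>\<^sup>+z. ennreal (F z powr (1+1/p)) \<partial>disc_measure c))"
    using mass_nonneg[OF less_imp_le[OF b] p, of h] by (subst ennreal_mult) (auto simp: M1)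
  also have "\<dots> = ennreal (mass b' p H)"
    unfolding M2 using k m by (simp add: mult.assoc[symmetric] ennreal_mult[symmetric])
  finally have "ennreal (real m / real k * mass b p h) = ennreal (mass b' p H)" .
  then have "mass b' p H = real m / real k * mass b p h"
    using mass_nonneg[OF less_imp_le[OF b] p, of h] mass_nonneg[OF b' p, of H] by (subst (asm) ennreal_inj) auto
  also have "\<dots> \<le> real m / real k" using h(2) by (rule mult_left_le) simp
  finally have "energy b' H H \<le> (real m / real k) powr (2 / (1 + 1/p)) * max_energy b' p"
    using k m by (intro energy_le_max_scaled[OF b' p H]) auto
  also have "\<dots> \<le> (real m / real k) powr (2 / (1 + 1/p)) * max_energy 0 p"
    by (intro mult_left_mono max_energy_le_zero_weight b' p) auto
  finally have "energy b h h \<le> (real k / real m) ^ 3 * ((real m / real k) powr (2 / (1 + 1/p)) * max_energy 0 p)"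
    unfolding E by (intro mult_left_mono) auto
  also have "\<dots> = (real k / real m) powr (1 + 2 / (p + 1)) * max_energy 0 p"
  proof -
    define t where "t = real k / real m"
    have t: "0 < t" using k m by (simp add: t_def)
    have mt: "real m / real k = 1 / t" by (simp add: t_def)
    have "t ^ 3 * (1 / t) powr (2 / (1 + 1/p)) = t powr 3 * t powr (- (2 / (1 + 1/p)))"
      using t by (simp add: powr_divide powr_minus_divide)
    also have "\<dots> = t powr (3 - 2 / (1 + 1/p))" by (simp add: powr_add[symmetric])
    also have "3 - 2 / (1 + 1/p) = 1 + 2 / (p + 1)" using p by (simp add: field_simps)
    finally show ?thesis unfolding mt t_def[symmetric] by simp
  qed
  finally show ?thesis by (simp add: m_def)
qed

section \<open>Regularity of potentials\<close>

text \<open>Kernel increments are singular at two points at once. Bounding the product of the two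
  singularities by a sum lets the one-point Riesz estimates suffice.\<close>

lemma powr_mult_le_add:
  fixes s t :: real
  assumes "0 < s" "0 < t" "0 \<le> \<sigma>" "0 \<le> \<tau>"
  shows "s powr (-\<sigma>) * t powr (-\<tau>) \<le> s powr (-(\<sigma> + \<tau>)) + t powr (-(\<sigma> + \<tau>))"
proof (cases "s \<le> t")
  case True
  then have "s powr (-\<sigma>) * t powr (-\<tau>) \<le> s powr (-\<sigma>) * s powr (-\<tau>)"
    using assms by (intro mult_left_mono powr_mono2') auto
  also have "\<dots> = s powr (-(\<sigma> + \<tau>))" by (simp add: powr_add[symmetric])
  finally show ?thesis by (simp add: add_increasing2)
next
  case False
  then have "s powr (-\<sigma>) * t powr (-\<tau>) \<le> t powr (-\<sigma>) * t powr (-\<tau>)"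
    using assms by (intro mult_right_mono powr_mono2') auto
  also have "\<dots> = t powr (-(\<sigma> + \<tau>))" by (simp add: powr_add[symmetric])
  finally show ?thesis by (simp add: add_increasing)
qed

text \<open>The exponent 3/2 lies above 1, as differentiability demands, and below 2, as
  integrability of the resulting kernel demands. The factor with |1 + z| absorbs the logarithmic
  singularity at z = -1.\<close>

lemma ln_cmod_one_plus_remainder:
  fixes z :: complex
  assumes "z \<noteq> -1"
  shows "\<bar>ln (cmod (1 + z)) - Re z\<bar> \<le> 6 * cmod z powr (3/2) * (1 + cmod (1 + z) powr (-1/2))"
proof (cases "cmod z \<le> 1/2")
  case True
  have nz: "1 + z \<noteq> 0" using assms by (metis add_eq_0_iff)
  have "\<bar>ln (cmod (1 + z)) - Re z\<bar> = \<bar>Re (ln (1 + z) - z)\<bar>" using nz by simp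
  also have "\<dots> \<le> cmod (ln (1 + z) - z)" by (rule abs_Re_le_cmod)
  also have "\<dots> \<le> cmod z ^ 2 / (1 - cmod z)" using True by (intro Ln_approx_linear) auto
  also have "\<dots> \<le> cmod z ^ 2 / (1/2)" using True by (intro divide_left_mono) auto
  also have "cmod z ^ 2 \<le> cmod z powr (3/2)"
  proof (cases "z = 0")
    case False
    then have "cmod z ^ 2 = cmod z powr 2" by simp
    also have "\<dots> \<le> cmod z powr (3/2)" using True False by (intro powr_mono') auto
    finally show ?thesis .
  qed simp
  finally have "\<bar>ln (cmod (1 + z)) - Re z\<bar> \<le> 2 * cmod z powr (3/2)" by simp
  also have "\<dots> \<le> 6 * cmod z powr (3/2) * (1 + cmod (1 + z) powr (-1/2))"
    by (simp add: distrib_left add_increasing2)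
  finally show ?thesis .
next
  case False
  let ?a = "cmod z" and ?t = "cmod (1 + z)"
  have t: "0 < ?t" using assms by (metis add_eq_0_iff zero_less_norm_iff)
  have r: "\<bar>ln ?t - ln 1\<bar> \<le> ?a powr (1/2) / (1/2) * (?t powr (-(1/2)) + 1 powr (-(1/2)))"
    using t norm_triangle_ineq3[of "1 + z" 1] by (intro ln_diff_le_powr) auto
  have "?a powr (1/2) * 1 \<le> ?a powr (1/2) * (2 * ?a)" using False by (intro mult_left_mono) auto
  also have "?a powr (1/2) * (2 * ?a) = 2 * ?a powr (3/2)"
    using False powr_add[of ?a "1/2" 1] by simp
  finally have h1: "?a powr (1/2) \<le> 2 * ?a powr (3/2)" by simp
  have "1 \<le> (2 * ?a) powr (1/2)" using False by (intro ge_one_powr_ge_zero) auto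
  then have "?a * 1 \<le> ?a * (2 * ?a) powr (1/2)" by (intro mult_left_mono) auto
  also have "\<dots> = 2 powr (1/2) * ?a powr (3/2)" using False powr_add[of ?a "1/2" 1] by (simp add: powr_mult)
  also have "\<dots> \<le> 2 * ?a powr (3/2)" using powr_mono[of "1/2" 1 "2::real"] by (intro mult_right_mono) auto
  finally have h2: "?a \<le> 2 * ?a powr (3/2)" by simp
  have "\<bar>ln ?t - Re z\<bar> \<le> \<bar>ln ?t\<bar> + \<bar>Re z\<bar>" by simp
  also have "\<dots> \<le> 2 * ?a powr (1/2) * (?t powr (-1/2) + 1) + ?a" using r abs_Re_le_cmod[of z] by simp
  also have "\<dots> \<le> 2 * (2 * ?a powr (3/2)) * (?t powr (-1/2) + 1) + 2 * ?a powr (3/2)"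
    using h1 h2 by (intro add_mono mult_right_mono mult_left_mono) auto
  also have "\<dots> \<le> 6 * ?a powr (3/2) * (1 + ?t powr (-1/2))"
    by (simp add: algebra_simps)
  finally show ?thesis .
qed

lemma has_derivative_of_powr_remainder:
  fixes f :: "complex \<Rightarrow> 'a::real_normed_vector"
  assumes L: "bounded_linear L" and x0: "x0 \<in> ball 0 1" and s: "0 < s"
    and bd: "\<And>x. x \<in> ball 0 1 \<Longrightarrow> x \<noteq> x0 \<Longrightarrow> norm (f x - f x0 - L (x - x0)) \<le> K * cmod (x - x0) powr (1 + s)"
  shows "(f has_derivative L) (at x0)"
proof -
  obtain e where e: "0 < e" "ball x0 e \<subseteq> ball 0 1" using x0 openE[OF open_ball] by blast
  show ?thesis
  proof (rule has_derivativeI_sandwich[OF e(1) L, where H="\<lambda>x. K * cmod (x - x0) powr s"])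
    fix x assume x: "x \<noteq> x0" "dist x x0 < e"
    then have xb: "x \<in> ball 0 1" using e by (auto simp: dist_commute)
    have "norm (f x - f x0 - L (x - x0)) / norm (x - x0) \<le> (K * cmod (x - x0) powr (1 + s)) / norm (x - x0)"
      using bd[OF xb x(1)] by (rule divide_right_mono) simp
    also have "\<dots> = K * cmod (x - x0) powr s" using x by (simp add: powr_add)
    finally show "norm (f x - f x0 - L (x - x0)) / norm (x - x0) \<le> K * cmod (x - x0) powr s" .
  next
    have "((\<lambda>x. K * cmod (x - x0) powr s) \<longlongrightarrow> K * cmod (x0 - x0) powr s) (at x0)"
      using s by (intro tendsto_intros) auto
    then show "((\<lambda>x. K * cmod (x - x0) powr s) \<longlongrightarrow> 0) (at x0)" by simp
  qed
qed

text \<open>The choice operator turns an existing bound into a function of the exponent that can be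
  named in remainder estimates valid for all points.\<close>

definition riesz_const :: "real \<Rightarrow> real" where
  "riesz_const s = (SOME C. 0 < C \<and> (\<forall>x. cmod x \<le> 1 \<longrightarrow> integrable (disc_measure 0) (\<lambda>y. cmod (x - y) powr (-s)) \<and>
     (\<integral>y. cmod (x - y) powr (-s) \<partial>disc_measure 0) \<le> C))"

lemma riesz_const:
  assumes "s < 2"
  shows "0 < riesz_const s" "cmod x \<le> 1 \<Longrightarrow> integrable (disc_measure 0) (\<lambda>y. cmod (x - y) powr (-s))"
    "cmod x \<le> 1 \<Longrightarrow> (\<integral>y. cmod (x - y) powr (-s) \<partial>disc_measure 0) \<le> riesz_const s"
proof -
  let ?P = "\<lambda>C. 0 < C \<and> (\<forall>x. cmod x \<le> 1 \<longrightarrow> integrable (disc_measure 0) (\<lambda>y. cmod (x - y) powr (-s)) \<and>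
     (\<integral>y. cmod (x - y) powr (-s) \<partial>disc_measure 0) \<le> C)"
  have "\<exists>C. ?P C" using disc_kernel_integrable[OF assms] by (metis order_refl)
  then have "?P (riesz_const s)" unfolding riesz_const_def by (rule someI_ex)
  then show "0 < riesz_const s" "cmod x \<le> 1 \<Longrightarrow> integrable (disc_measure 0) (\<lambda>y. cmod (x - y) powr (-s))"
    "cmod x \<le> 1 \<Longrightarrow> (\<integral>y. cmod (x - y) powr (-s) \<partial>disc_measure 0) \<le> riesz_const s" by auto
qed

text \<open>Two centres are allowed because the kernels of difference quotients are singular at the
  base point and at the displaced point.\<close>

lemma riesz_kernel_bound:
  fixes k :: "complex \<Rightarrow> 'a::{banach,second_countable_topology}"
  assumes s: "s < 2" and x: "cmod x \<le> 1" "cmod x' \<le> 1" and A: "0 \<le> A" "0 \<le> A'" and k: "k \<in> borel_measurable borel"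
    and bd: "AE y in disc_measure 0. norm (k y) \<le> A * cmod (x - y) powr (-s) + A' * cmod (x' - y) powr (-s)"
  shows "integrable (disc_measure 0) k" "norm (\<integral>y. k y \<partial>disc_measure 0) \<le> (A + A') * riesz_const s"
proof -
  have i: "integrable (disc_measure 0) (\<lambda>y. A * cmod (x - y) powr (-s) + A' * cmod (x' - y) powr (-s))"
    by (intro Bochner_Integration.integrable_add integrable_mult_right riesz_const s x)
  show "integrable (disc_measure 0) k"
    by (rule Bochner_Integration.integrable_bound[OF i]) (use k bd in \<open>auto elim!: eventually_mono\<close>)
  then have ik: "integrable (disc_measure 0) (\<lambda>y. norm (k y))" by simp
  have "norm (\<integral>y. k y \<partial>disc_measure 0) \<le> (\<integral>y. norm (k y) \<partial>disc_measure 0)" by (rule integral_norm_bound)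
  also have "\<dots> \<le> (\<integral>y. A * cmod (x - y) powr (-s) + A' * cmod (x' - y) powr (-s) \<partial>disc_measure 0)"
    by (rule integral_mono_AE[OF ik i bd])
  also have "\<dots> = A * (\<integral>y. cmod (x - y) powr (-s) \<partial>disc_measure 0) + A' * (\<integral>y. cmod (x' - y) powr (-s) \<partial>disc_measure 0)"
    by (subst Bochner_Integration.integral_add) (auto intro!: integrable_mult_right riesz_const s x simp del: integrable_mult_right_iff)
  also have "\<dots> \<le> A * riesz_const s + A' * riesz_const s"
    by (intro add_mono mult_left_mono riesz_const s x A)
  finally show "norm (\<integral>y. k y \<partial>disc_measure 0) \<le> (A + A') * riesz_const s" by (simp add: algebra_simps)
qed

lemma AE_disc0: "AE y in disc_measure 0. cmod y < 1 \<and> y \<noteq> x \<and> y \<noteq> x'"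
  using AE_disc_measure[of 0] AE_disc_measure_neq[of x 0] AE_disc_measure_neq[of x' 0] by eventually_elim auto

section \<open>Differentiating the logarithmic and the Cauchy potential\<close>

definition log_pot :: "(complex \<Rightarrow> real) \<Rightarrow> complex \<Rightarrow> real" where
  "log_pot f x = (\<integral>y. ln (cmod (x - y)) * f y \<partial>disc_measure 0)"

definition cauchy_pot :: "(complex \<Rightarrow> real) \<Rightarrow> complex \<Rightarrow> complex" where
  "cauchy_pot f x = (\<integral>y. of_real (f y) / (x - y) \<partial>disc_measure 0)"

text \<open>A Beurling transform. The kernel 1 / (x - y)^2 is not integrable; subtracting f x
  replaces the principal value by an integral that converges absolutely for Hoelder continuous
  f.\<close>

definition beurling_pot :: "(complex \<Rightarrow> real) \<Rightarrow> complex \<Rightarrow> complex" where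
  "beurling_pot f x = (\<integral>y. of_real (f y - f x) / (x - y)\<^sup>2 \<partial>disc_measure 0)"

context
  fixes f :: "complex \<Rightarrow> real" and F H \<gamma> :: real
  assumes fm [measurable]: "f \<in> borel_measurable borel" and fF: "\<And>y. \<bar>f y\<bar> \<le> F"
    and \<gamma>: "0 < \<gamma>" "\<gamma> \<le> 1"
    and hoelder: "\<And>x y. x \<in> ball 0 1 \<Longrightarrow> y \<in> ball 0 1 \<Longrightarrow> \<bar>f x - f y\<bar> \<le> H * cmod (x - y) powr \<gamma>"
begin

interpretation finite_measure "disc_measure 0" by (rule finite_measure_disc_measure) simp

lemma F0: "0 \<le> F" using fF[of 0] by linarith

lemma H0: "0 \<le> H"
proof -
  have "0 \<le> H * cmod (0 - 1/2) powr \<gamma>" using hoelder[of 0 "1/2"] by (intro order_trans[OF abs_ge_zero]) auto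
  then show ?thesis by (simp add: zero_le_mult_iff)
qed

lemma integrable_log_pot: "cmod x \<le> 1 \<Longrightarrow> integrable (disc_measure 0) (\<lambda>y. ln (cmod (x - y)) * f y)"
proof (rule riesz_kernel_bound(1)[of "1" x x "4*F" 0])
  assume x: "cmod x \<le> 1"
  show "AE y in disc_measure 0. norm (ln (cmod (x - y)) * f y) \<le> 4 * F * cmod (x - y) powr (-1) + 0 * cmod (x - y) powr (-1)"
    using AE_disc0[of x x]
  proof eventually_elim
    case (elim y)
    then have pos: "0 < cmod (x - y)" by auto
    have le: "cmod (x - y) \<le> 2" using norm_triangle_ineq4[of x y] elim x by simp
    have "\<bar>ln (cmod (x - y))\<bar> \<le> 4 * cmod (x - y) powr (-1)"
    proof (cases "cmod (x - y) \<le> 1")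
      case True
      have "- ln (cmod (x - y)) = ln (1 / cmod (x - y))" using pos by (simp add: ln_div)
      also have "\<dots> \<le> 1 / cmod (x - y)" using pos ln_le_minus_one[of "1 / cmod (x - y)"] by simp
      also have "\<dots> \<le> 4 / cmod (x - y)" using pos by (intro divide_right_mono) auto
      finally show ?thesis using True pos by (simp add: powr_minus_divide)
    next
      case False
      have "ln (cmod (x - y)) \<le> cmod (x - y) - 1" using pos by (rule ln_le_minus_one)
      also have "\<dots> \<le> 1" using le by simp
      also have "1 \<le> 4 / cmod (x - y)" using le pos by (simp add: field_simps)
      finally show ?thesis using False by (simp add: powr_minus_divide)
    qed
    then have "\<bar>ln (cmod (x - y))\<bar> * \<bar>f y\<bar> \<le> 4 * cmod (x - y) powr (-1) * F"
      using fF F0 by (intro mult_mono) auto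
    then show ?case by (simp add: abs_mult mult_ac)
  qed
qed (use F0 in \<open>auto\<close>)

lemma integrable_cauchy_pot: "cmod x \<le> 1 \<Longrightarrow> integrable (disc_measure 0) (\<lambda>y. complex_of_real (f y) / (x - y))"
proof (rule riesz_kernel_bound(1)[of "1" x x "F" 0])
  show "AE y in disc_measure 0. norm (complex_of_real (f y) / (x - y)) \<le> F * cmod (x - y) powr (-1) + 0 * cmod (x - y) powr (-1)"
    using AE_disc0[of x x]
  proof eventually_elim
    case (elim y)
    then show ?case using fF[of y] by (simp add: norm_divide powr_minus_divide divide_right_mono)
  qed
qed (use F0 in \<open>auto\<close>)

lemma log_pot_has_derivative:
  assumes x0: "x0 \<in> ball 0 1"
  shows "(log_pot f has_derivative (\<lambda>h. Re (cauchy_pot f x0 * h))) (at x0)"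
proof (rule has_derivative_of_powr_remainder[OF _ x0, where s="1/2" and K="18 * F * riesz_const (3/2)"])
  show "bounded_linear (\<lambda>h. Re (cauchy_pot f x0 * h))"
    by (intro bounded_linear_compose[OF bounded_linear_Re] bounded_linear_mult_right)
  fix x assume x: "x \<in> ball 0 1" "x \<noteq> x0"
  define h where "h = x - x0"
  let ?k = "\<lambda>y. ln (cmod (x - y)) * f y - ln (cmod (x0 - y)) * f y - Re (complex_of_real (f y) / (x0 - y) * h)"
  have i1: "integrable (disc_measure 0) (\<lambda>y. Re (complex_of_real (f y) / (x0 - y) * h))"
    using x0 by (intro integrable_Re integrable_mult_left integrable_cauchy_pot) auto
  have "log_pot f x - log_pot f x0 - Re (cauchy_pot f x0 * h) = (\<integral>y. ?k y \<partial>disc_measure 0)"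
  proof -
    have "Re (cauchy_pot f x0 * h) = (\<integral>y. Re (complex_of_real (f y) / (x0 - y) * h) \<partial>disc_measure 0)"
    proof -
      have i: "integrable (disc_measure 0) (\<lambda>y. complex_of_real (f y) / (x0 - y) * h)"
        using x0 by (intro integrable_mult_left integrable_cauchy_pot) auto
      have "cauchy_pot f x0 * h = (\<integral>y. complex_of_real (f y) / (x0 - y) * h \<partial>disc_measure 0)"
        unfolding cauchy_pot_def by (rule integral_mult_left_zero[symmetric])
      then show ?thesis by (simp only: integral_Re[OF i])
    qed
    then show ?thesis unfolding log_pot_def using i1 integrable_log_pot x x0
      by (simp add: Bochner_Integration.integral_diff)
  qed
  also have "norm (\<integral>y. ?k y \<partial>disc_measure 0) \<le> (12 * F * cmod h powr (3/2) + 6 * F * cmod h powr (3/2)) * riesz_const (3/2)"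
  proof (rule riesz_kernel_bound(2)[of "3/2" x0 x])
    show "AE y in disc_measure 0. norm (?k y) \<le> 12 * F * cmod h powr (3/2) * cmod (x0 - y) powr (-(3/2)) + 6 * F * cmod h powr (3/2) * cmod (x - y) powr (-(3/2))"
      using AE_disc0[of x x0]
    proof eventually_elim
      case (elim y)
      define a where "a = cmod (x0 - y)"
      define b where "b = cmod (x - y)"
      have ab: "0 < a" "0 < b" using elim by (auto simp: a_def b_def)
      \<comment> \<open>With this z, x - y = (x0 - y) (1 + z), so the kernel increment minus its
        linear part is f y (ln |1 + z| - Re z). The excluded value z = -1 means y = x.\<close>
      define z where "z = h / (x0 - y)"
      have "x0 \<noteq> y" using elim by auto
      then have "(x0 - y) * (1 + z) = (x0 - y) + h" by (simp add: z_def distrib_left)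
      also have "\<dots> = x - y" by (simp add: h_def)
      finally have xy: "x - y = (x0 - y) * (1 + z)" ..
      have bz: "b = a * cmod (1 + z)" by (simp add: a_def b_def xy norm_mult)
      then have z1: "0 < cmod (1 + z)" using ab by (simp add: zero_less_mult_iff)
      then have zn: "z \<noteq> -1" by auto
      have "?k y = f y * (ln (cmod (1 + z)) - Re z)"
      proof -
        have "ln b = ln a + ln (cmod (1 + z))" unfolding bz using ab z1 by (simp add: ln_mult)
        moreover have "Re (complex_of_real (f y) / (x0 - y) * h) = f y * Re z"
        proof -
          have "complex_of_real (f y) / (x0 - y) * h = complex_of_real (f y) * z" by (simp add: z_def)
          then show ?thesis by simp
        qed
        ultimately show ?thesis unfolding a_def[symmetric] b_def[symmetric] by (simp add: algebra_simps)
      qed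
      then have "norm (?k y) = \<bar>f y\<bar> * \<bar>ln (cmod (1 + z)) - Re z\<bar>" by (simp add: abs_mult)
      also have "\<dots> \<le> F * (6 * cmod z powr (3/2) * (1 + cmod (1 + z) powr (-1/2)))"
        using fF F0 ln_cmod_one_plus_remainder[OF zn] by (intro mult_mono) auto
      also have "cmod z powr (3/2) = cmod h powr (3/2) * a powr (-(3/2))"
        by (simp add: z_def norm_divide powr_divide powr_minus_divide a_def)
      also have "cmod (1 + z) = b / a" using bz ab by simp
      also have "(b / a) powr (-1/2) = a powr (1/2) * b powr (-(1/2))"
        using ab by (simp add: powr_divide powr_minus_divide)
      also have "F * (6 * (cmod h powr (3/2) * a powr (-(3/2))) * (1 + a powr (1/2) * b powr (-(1/2))))
        = 6 * F * cmod h powr (3/2) * (a powr (-(3/2)) + (a powr (-(3/2)) * a powr (1/2)) * b powr (-(1/2)))"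
        by (simp add: algebra_simps)
      also have "a powr (-(3/2)) * a powr (1/2) = a powr (-1)" by (simp add: powr_add[symmetric])
      also have "6 * F * cmod h powr (3/2) * (a powr (-(3/2)) + a powr (-1) * b powr (-(1/2)))
        \<le> 6 * F * cmod h powr (3/2) * (a powr (-(3/2)) + (a powr (-(1 + 1/2)) + b powr (-(1 + 1/2))))"
        using F0 ab by (intro mult_left_mono add_left_mono powr_mult_le_add) auto
      also have "\<dots> = 12 * F * cmod h powr (3/2) * a powr (-(3/2)) + 6 * F * cmod h powr (3/2) * b powr (-(3/2))"
        by (simp add: algebra_simps)
      finally show ?case by (simp add: a_def b_def)
    qed
  qed (use x x0 F0 in auto)
  finally show "norm (log_pot f x - log_pot f x0 - Re (cauchy_pot f x0 * (x - x0))) \<le> 18 * F * riesz_const (3/2) * cmod (x - x0) powr (1 + 1/2)"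
    by (simp add: h_def algebra_simps)
qed simp

lemma beurling_kernel_bound:
  assumes x: "x \<in> ball 0 1"
  shows "AE y in disc_measure 0. norm (complex_of_real (f y - f x) / (x - y)\<^sup>2) \<le> H * cmod (x - y) powr (-(2 - \<gamma>))"
  using AE_disc0[of x x]
proof eventually_elim
  case (elim y)
  then have pos: "0 < cmod (x - y)" by auto
  have "norm (complex_of_real (f y - f x) / (x - y)\<^sup>2) = \<bar>f y - f x\<bar> / cmod (x - y) powr 2"
    using pos by (simp add: norm_divide norm_power flip: of_real_diff)
  also have "\<dots> \<le> (H * cmod (y - x) powr \<gamma>) / cmod (x - y) powr 2"
    using elim x by (intro divide_right_mono hoelder) auto
  also have "\<dots> = H * cmod (x - y) powr (-(2 - \<gamma>))"
    by (simp add: norm_minus_commute powr_diff)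
  finally show ?case .
qed

lemma integrable_beurling: "x \<in> ball 0 1 \<Longrightarrow> integrable (disc_measure 0) (\<lambda>y. complex_of_real (f y - f x) / (x - y)\<^sup>2)"
  using beurling_kernel_bound[of x] \<gamma> H0 by (intro riesz_kernel_bound(1)[of "2 - \<gamma>" x x H 0]) auto

text \<open>f is split into f - f x0, whose vanishing at x0 tames the differentiated kernel, and the
  constant f x0. The constant is handled by \<open>one\<close>, the Cauchy transform of the disc,
  and contributes the conjugate-linear term that eventually becomes the right-hand side of the
  equation.\<close>

lemma cauchy_pot_has_derivative:
  assumes x0: "x0 \<in> ball 0 1" and one: "\<And>x. x \<in> ball 0 1 \<Longrightarrow> (\<integral>y. 1 / (x - y) \<partial>disc_measure 0) = of_real pi * cnj x"
  shows "(cauchy_pot f has_derivative (\<lambda>h. of_real (pi * f x0) * cnj h - beurling_pot f x0 * h)) (at x0)"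
proof (rule has_derivative_of_powr_remainder[OF _ x0, where s="\<gamma>/2" and K="8 * H * riesz_const (2 - \<gamma>/2)"])
  show "bounded_linear (\<lambda>h. of_real (pi * f x0) * cnj h - beurling_pot f x0 * h)"
    by (intro bounded_linear_sub bounded_linear_const_mult bounded_linear_cnj bounded_linear_ident)
  show "0 < \<gamma>/2" using \<gamma> by simp
  fix x assume x: "x \<in> ball 0 1" "x \<noteq> x0"
  define h where "h = x - x0"
  let ?k = "\<lambda>y. complex_of_real (f y - f x0) / (x - y) - complex_of_real (f y - f x0) / (x0 - y) + complex_of_real (f y - f x0) / (x0 - y)\<^sup>2 * h"
  have io: "integrable (disc_measure 0) (\<lambda>y. 1 / (x - y))" if "cmod x \<le> 1" for x
    by (rule riesz_kernel_bound(1)[of 1 x x 1 0])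
      (use that AE_disc0[of x x] in \<open>auto elim!: eventually_mono simp: norm_divide powr_minus_divide\<close>)
  have ig: "integrable (disc_measure 0) (\<lambda>y. complex_of_real (f y - f x0) / (x - y))"
    and cp: "cauchy_pot f x = (\<integral>y. complex_of_real (f y - f x0) / (x - y) \<partial>disc_measure 0) + of_real (f x0) * (of_real pi * cnj x)"
    if "x \<in> ball 0 1" for x
  proof -
    have e: "complex_of_real (f y - f x0) / (x - y) = complex_of_real (f y) / (x - y) - of_real (f x0) * (1 / (x - y))" for y
      by (simp add: diff_divide_distrib)
    show i: "integrable (disc_measure 0) (\<lambda>y. complex_of_real (f y - f x0) / (x - y))"
      unfolding e using that by (intro Bochner_Integration.integrable_diff integrable_cauchy_pot integrable_mult_right io) auto
    have "(\<integral>y. complex_of_real (f y - f x0) / (x - y) \<partial>disc_measure 0) = cauchy_pot f x - of_real (f x0) * (of_real pi * cnj x)"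
    proof -
      have i1: "integrable (disc_measure 0) (\<lambda>y. complex_of_real (f y) / (x - y))"
        and i2: "integrable (disc_measure 0) (\<lambda>y. of_real (f x0) * (1 / (x - y)))"
        using that by (auto intro!: integrable_cauchy_pot integrable_mult_right io simp del: integrable_mult_right_iff times_divide_eq_right)
      show ?thesis
        unfolding e cauchy_pot_def one[OF that, symmetric]
        by (simp only: Bochner_Integration.integral_diff[OF i1 i2] integral_mult_right_zero)
    qed
    then show "cauchy_pot f x = (\<integral>y. complex_of_real (f y - f x0) / (x - y) \<partial>disc_measure 0) + of_real (f x0) * (of_real pi * cnj x)" by simp
  qed
  have ib: "integrable (disc_measure 0) (\<lambda>y. complex_of_real (f y - f x0) / (x0 - y)\<^sup>2 * h)"
    by (intro integrable_mult_left integrable_beurling x0)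
  have bh: "beurling_pot f x0 * h = (\<integral>y. complex_of_real (f y - f x0) / (x0 - y)\<^sup>2 * h \<partial>disc_measure 0)"
    unfolding beurling_pot_def by (rule integral_mult_left_zero[symmetric])
  have "cauchy_pot f x - cauchy_pot f x0 - (of_real (pi * f x0) * cnj h - beurling_pot f x0 * h)
    = (\<integral>y. complex_of_real (f y - f x0) / (x - y) \<partial>disc_measure 0) - (\<integral>y. complex_of_real (f y - f x0) / (x0 - y) \<partial>disc_measure 0) + beurling_pot f x0 * h"
    unfolding cp[OF x(1)] cp[OF x0] by (simp add: h_def algebra_simps)
  also have "\<dots> = (\<integral>y. ?k y \<partial>disc_measure 0)"
    unfolding bh by (simp only: Bochner_Integration.integral_add[OF Bochner_Integration.integrable_diff[OF ig[OF x(1)] ig[OF x0]] ib]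
      Bochner_Integration.integral_diff[OF ig[OF x(1)] ig[OF x0]])
  also have "norm \<dots> \<le> (4 * H * cmod h powr (1 + \<gamma>/2) + 4 * H * cmod h powr (1 + \<gamma>/2)) * riesz_const (2 - \<gamma>/2)"
  proof (rule riesz_kernel_bound(2)[of "2 - \<gamma>/2" x0 x])
    show "AE y in disc_measure 0. norm (?k y) \<le> 4 * H * cmod h powr (1 + \<gamma>/2) * cmod (x0 - y) powr (-(2 - \<gamma>/2)) + 4 * H * cmod h powr (1 + \<gamma>/2) * cmod (x - y) powr (-(2 - \<gamma>/2))"
      using AE_disc0[of x x0]
    proof eventually_elim
      case (elim y)
      define a where "a = cmod (x0 - y)"
      define b where "b = cmod (x - y)"
      have ab: "0 < a" "0 < b" using elim by (auto simp: a_def b_def)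
      have h0: "0 < cmod h" using x by (simp add: h_def)
      \<comment> \<open>The Hoelder gain is halved: one half lifts the remainder exponent to 1 + s >
        1, the other keeps the kernel exponent at 2 - s < 2.\<close>
      define s where "s = \<gamma>/2"
      have s: "0 < s" "s \<le> 1/2" "\<gamma> = 2 * s" using \<gamma> by (auto simp: s_def)
      have nz: "x - y \<noteq> 0" "x0 - y \<noteq> 0" using elim by auto
      have "g / (x - y) - g / (x0 - y) + g / (x0 - y)\<^sup>2 * h = g * (1 / (x - y) - 1 / (x0 - y) + h / (x0 - y)\<^sup>2)" for g :: complex
        by (simp add: algebra_simps)
      then have "?k y = complex_of_real (f y - f x0) * (1 / (x - y) - 1 / (x0 - y) + h / (x0 - y)\<^sup>2)" .
      also have "1 / (x - y) - 1 / (x0 - y) + h / (x0 - y)\<^sup>2 = h\<^sup>2 / ((x - y) * (x0 - y)\<^sup>2)"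
      proof -
        have *: "1 / B - 1 / A + (B - A) / A\<^sup>2 = (B - A)\<^sup>2 / (B * A\<^sup>2)" if "A \<noteq> 0" "B \<noteq> 0" for A B :: complex
          using that by (simp add: field_simps power2_eq_square)
        have "(x - y) - (x0 - y) = h" by (simp add: h_def)
        then show ?thesis using *[OF nz(2,1)] by simp
      qed
      finally have "norm (?k y) = \<bar>f y - f x0\<bar> * ((cmod h)\<^sup>2 / (b * a\<^sup>2))"
        by (simp only: norm_mult norm_divide norm_power norm_of_real a_def b_def)
      also have "\<dots> \<le> (H * cmod (y - x0) powr \<gamma>) * ((cmod h)\<^sup>2 / (b * a\<^sup>2))"
        using elim x0 ab by (intro mult_right_mono hoelder) auto
      also have "cmod (y - x0) = a" by (simp add: a_def norm_minus_commute)
      \<comment> \<open>Only |h|^(1+s) is kept as smallness; |h|^(1-s) is spent against the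
        singularities through |h| <= |x0 - y| + |x - y|.\<close>
      also have "(cmod h)\<^sup>2 = cmod h powr (1 + s) * cmod h powr (1 - s)"
        using h0 by (simp add: powr_add[symmetric])
      also have "(H * a powr \<gamma>) * (cmod h powr (1 + s) * cmod h powr (1 - s) / (b * a\<^sup>2)) = H * cmod h powr (1 + s) * (cmod h powr (1 - s) * (a powr (\<gamma> - 2) * b powr (-1)))"
        using ab by (simp add: powr_diff powr_minus_divide field_simps)
      also have "\<dots> \<le> H * cmod h powr (1 + s) * ((2 * (a powr (1 - s) + b powr (1 - s))) * (a powr (\<gamma> - 2) * b powr (-1)))"
      proof (intro mult_left_mono mult_right_mono)
        have "cmod h \<le> a + b" using norm_triangle_ineq4[of "x - y" "x0 - y"] by (simp add: h_def a_def b_def)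
        also have "\<dots> \<le> 2 * max a b" by simp
        finally have "cmod h powr (1 - s) \<le> (2 * max a b) powr (1 - s)" using s by (intro powr_mono2) auto
        also have "\<dots> = 2 powr (1 - s) * max a b powr (1 - s)" using ab by (simp add: powr_mult)
        also have "\<dots> \<le> 2 * (a powr (1 - s) + b powr (1 - s))"
          using s powr_mono[of "1 - s" 1 "2::real"] by (intro mult_mono) (auto simp: max_def)
        finally show "cmod h powr (1 - s) \<le> 2 * (a powr (1 - s) + b powr (1 - s))" .
      qed (use H0 in auto)
      also have "\<dots> = 2 * H * cmod h powr (1 + s) * (a powr (-(1 - s)) * b powr (-1) + a powr (-(2 - 2 * s)) * b powr (-s))"
      proof -
        have e: "a powr (1 - s) * a powr (\<gamma> - 2) = a powr (-(1 - s))" "b powr (1 - s) * b powr (-1) = b powr (-s)"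
          "a powr (\<gamma> - 2) = a powr (-(2 - 2 * s))"
          by (subst powr_add[symmetric], simp add: s(3))+ (simp add: s(3))
        have *: "t * u * ((2 * (A + B)) * (C * D)) = 2 * t * u * ((A * C) * D + C * (B * D))" for t u A B C D :: real
          by (simp add: algebra_simps)
        show ?thesis unfolding e[symmetric] by (rule *)
      qed
      also have "\<dots> \<le> 2 * H * cmod h powr (1 + s) * ((a powr (-((1 - s) + 1)) + b powr (-((1 - s) + 1))) + (a powr (-((2 - 2 * s) + s)) + b powr (-((2 - 2 * s) + s))))"
        using H0 ab s by (intro mult_left_mono add_mono powr_mult_le_add) auto
      also have "\<dots> = 4 * H * cmod h powr (1 + s) * a powr (-(2 - s)) + 4 * H * cmod h powr (1 + s) * b powr (-(2 - s))"
        by (simp add: algebra_simps)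
      finally show ?case by (simp add: a_def b_def s_def)
    qed
  qed (use x x0 H0 \<gamma> in auto)
  also have "\<dots> = 8 * H * riesz_const (2 - \<gamma>/2) * cmod h powr (1 + \<gamma>/2)" by (simp add: algebra_simps)
  finally show "norm (cauchy_pot f x - cauchy_pot f x0 - (of_real (pi * f x0) * cnj (x - x0) - beurling_pot f x0 * (x - x0))) \<le> 8 * H * riesz_const (2 - \<gamma>/2) * cmod (x - x0) powr (1 + \<gamma>/2)"
    unfolding h_def .
qed

text \<open>The kernel is multiplied by a factor \<eta> that vanishes quadratically on the diagonal.
  The truncated integral is continuous by dominated convergence, and the truncation error is small
  uniformly in x.\<close>

lemma continuous_on_beurling_pot: "continuous_on (ball 0 1) (beurling_pot f)"
  unfolding continuous_on_sequentially
proof (intro allI ballI impI, elim conjE)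
  fix X :: "nat \<Rightarrow> complex" and x0 :: complex
  assume x0: "x0 \<in> ball 0 1" and X: "\<forall>n. X n \<in> ball 0 1" and lim: "X \<longlonglongrightarrow> x0"
  let ?k = "\<lambda>x y. complex_of_real (f y - f x) / (x - y)\<^sup>2"
  show "(beurling_pot f \<circ> X) \<longlonglongrightarrow> beurling_pot f x0"
  proof (rule LIMSEQ_I)
    fix r :: real assume r: "0 < r"
    define C where "C = riesz_const (2 - \<gamma>/2)"
    have C: "0 < C" using \<gamma> by (simp add: C_def riesz_const)
    \<comment> \<open>Solves (H + 1) C e^(\<gamma>/2) = r/4, the bound on the truncation error. H +
      1 replaces H, which may be zero.\<close>
    define e where "e = (r / (4 * (H + 1) * C)) powr (2 / \<gamma>)"
    have e: "0 < e" using r C H0 by (simp add: e_def)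
    have eg: "e powr (\<gamma>/2) = r / (4 * (H + 1) * C)" using \<gamma> r C H0 by (simp add: e_def powr_powr)
    \<comment> \<open>The square cancels |x - y|^(-2) exactly and leaves the constant bound 2 F /
      e^2 for the truncated kernel.\<close>
    define \<eta> where "\<eta> = (\<lambda>x y. (min 1 (cmod (x - y) / e))\<^sup>2)"
    have \<eta>: "0 \<le> \<eta> x y" "\<eta> x y \<le> 1" for x y
      using e by (auto simp: \<eta>_def intro!: power_le_one)
    have near: "norm (beurling_pot f x - (\<integral>y. ?k x y * of_real (\<eta> x y) \<partial>disc_measure 0)) \<le> r / 4"
      and ik: "integrable (disc_measure 0) (\<lambda>y. ?k x y * of_real (\<eta> x y))" if x: "x \<in> ball 0 1" for x
    proof -
      have [measurable]: "(\<lambda>y. \<eta> x y) \<in> borel_measurable borel" unfolding \<eta>_def by measurable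
      show ik: "integrable (disc_measure 0) (\<lambda>y. ?k x y * of_real (\<eta> x y))"
      proof (rule Bochner_Integration.integrable_bound[OF integrable_beurling[OF x]])
        show "AE y in disc_measure 0. norm (?k x y * of_real (\<eta> x y)) \<le> norm (?k x y)"
        proof (rule AE_I2)
          fix y
          have "norm (?k x y * of_real (\<eta> x y)) = norm (?k x y) * \<eta> x y"
            using \<eta>[of x y] by (simp only: norm_mult norm_of_real abs_of_nonneg)
          also have "\<dots> \<le> norm (?k x y)" using \<eta>[of x y] by (intro mult_left_le) auto
          finally show "norm (?k x y * of_real (\<eta> x y)) \<le> norm (?k x y)" .
        qed
      qed measurable
      have "beurling_pot f x - (\<integral>y. ?k x y * of_real (\<eta> x y) \<partial>disc_measure 0) = (\<integral>y. ?k x y * of_real (1 - \<eta> x y) \<partial>disc_measure 0)"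
      proof -
        have e': "?k x y * of_real (1 - \<eta> x y) = ?k x y - ?k x y * of_real (\<eta> x y)" for y
          by (simp only: of_real_diff of_real_1 right_diff_distrib mult_1_right)
        show ?thesis unfolding e' beurling_pot_def by (rule Bochner_Integration.integral_diff[symmetric, OF integrable_beurling[OF x] ik])
      qed
      also have "norm \<dots> \<le> (H * e powr (\<gamma>/2) + 0) * riesz_const (2 - \<gamma>/2)"
      proof (rule riesz_kernel_bound(2)[of "2 - \<gamma>/2" x x])
        show "AE y in disc_measure 0. norm (?k x y * of_real (1 - \<eta> x y)) \<le> H * e powr (\<gamma>/2) * cmod (x - y) powr (-(2 - \<gamma>/2)) + 0 * cmod (x - y) powr (-(2 - \<gamma>/2))"
          using beurling_kernel_bound[OF x] AE_disc0[of x x]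
        proof eventually_elim
          case (elim y)
          have n1: "norm (?k x y * of_real (1 - \<eta> x y)) = norm (?k x y) * (1 - \<eta> x y)"
            using \<eta>[of x y] by (simp only: norm_mult norm_of_real abs_of_nonneg diff_ge_0_iff_ge)
          show ?case
          proof (cases "cmod (x - y) < e")
            case True
            have "norm (?k x y) * (1 - \<eta> x y) \<le> norm (?k x y) * 1" using \<eta>[of x y] by (intro mult_left_mono) auto
            also have "\<dots> \<le> H * cmod (x - y) powr (-(2 - \<gamma>))" using elim(1) by simp
            also have "cmod (x - y) powr (-(2 - \<gamma>)) = cmod (x - y) powr (\<gamma>/2) * cmod (x - y) powr (-(2 - \<gamma>/2))"
              by (simp add: powr_add[symmetric])
            also have "H * (cmod (x - y) powr (\<gamma>/2) * cmod (x - y) powr (-(2 - \<gamma>/2))) \<le> H * (e powr (\<gamma>/2) * cmod (x - y) powr (-(2 - \<gamma>/2)))"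
              using True \<gamma> H0 by (intro mult_left_mono mult_right_mono powr_mono2) auto
            finally show ?thesis unfolding n1 by (simp add: mult.assoc)
          next
            case False
            then have "\<eta> x y = 1" using e by (simp add: \<eta>_def min_def)
            then show ?thesis unfolding n1 using H0 by simp
          qed
        qed
        show "(\<lambda>y. ?k x y * of_real (1 - \<eta> x y)) \<in> borel_measurable borel" by measurable
      qed (use x \<gamma> H0 in auto)
      also have "\<dots> = H * (r / (4 * (H + 1) * C)) * C" by (simp add: eg C_def)
      also have "\<dots> = (H / (H + 1)) * (r / 4)" using C by simp
      also have "\<dots> \<le> 1 * (r / 4)" using H0 r by (intro mult_right_mono) auto
      finally show "norm (beurling_pot f x - (\<integral>y. ?k x y * of_real (\<eta> x y) \<partial>disc_measure 0)) \<le> r / 4" by simp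
    qed
    have "(\<lambda>n. \<integral>y. ?k (X n) y * of_real (\<eta> (X n) y) \<partial>disc_measure 0) \<longlonglongrightarrow> (\<integral>y. ?k x0 y * of_real (\<eta> x0 y) \<partial>disc_measure 0)"
    proof (rule integral_dominated_convergence[where w="\<lambda>_. 2 * F / e\<^sup>2"])
      have [measurable]: "(\<lambda>y. \<eta> x y) \<in> borel_measurable borel" for x unfolding \<eta>_def by measurable
      show "(\<lambda>y. ?k x0 y * of_real (\<eta> x0 y)) \<in> borel_measurable (disc_measure 0)"
        "(\<lambda>y. ?k (X n) y * of_real (\<eta> (X n) y)) \<in> borel_measurable (disc_measure 0)" for n by measurable
      show "AE y in disc_measure 0. (\<lambda>n. ?k (X n) y * of_real (\<eta> (X n) y)) \<longlonglongrightarrow> ?k x0 y * of_real (\<eta> x0 y)"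
        using AE_disc0[of x0 x0]
      proof eventually_elim
        case (elim y)
        have fl: "(\<lambda>n. f (X n)) \<longlonglongrightarrow> f x0"
        proof (rule LIM_zero_cancel, rule tendsto_rabs_zero_cancel, rule tendsto_sandwich[OF _ _ tendsto_const])
          show "\<forall>\<^sub>F n in sequentially. 0 \<le> \<bar>f (X n) - f x0\<bar>" by simp
          show "\<forall>\<^sub>F n in sequentially. \<bar>f (X n) - f x0\<bar> \<le> H * cmod (X n - x0) powr \<gamma>"
            using X x0 by (intro always_eventually allI hoelder) auto
          have "(\<lambda>n. H * cmod (X n - x0) powr \<gamma>) \<longlonglongrightarrow> H * cmod (x0 - x0) powr \<gamma>"
            using \<gamma> by (intro tendsto_intros lim) auto
          then show "(\<lambda>n. H * cmod (X n - x0) powr \<gamma>) \<longlonglongrightarrow> 0" by simp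
        qed
        show ?case unfolding \<eta>_def
          by (intro tendsto_intros lim fl) (use elim e in auto)
      qed
      show "AE y in disc_measure 0. norm (?k (X n) y * of_real (\<eta> (X n) y)) \<le> 2 * F / e\<^sup>2" for n
        using AE_disc0[of "X n" x0]
      proof eventually_elim
        case (elim y)
        then have pos: "0 < cmod (X n - y)" by auto
        have "\<eta> (X n) y \<le> (cmod (X n - y) / e)\<^sup>2" unfolding \<eta>_def using e by (intro power_mono) auto
        then have 1: "\<eta> (X n) y / (cmod (X n - y))\<^sup>2 \<le> 1 / e\<^sup>2" using pos e by (simp add: power_divide field_simps)
        have "\<bar>f y - f (X n)\<bar> \<le> 2 * F" using fF[of y] fF[of "X n"] by linarith
        then have "\<bar>f y - f (X n)\<bar> * (\<eta> (X n) y / (cmod (X n - y))\<^sup>2) \<le> 2 * F * (1 / e\<^sup>2)"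
          using 1 \<eta>[of "X n" y] F0 by (intro mult_mono) auto
        moreover have "norm (?k (X n) y * of_real (\<eta> (X n) y)) = \<bar>f y - f (X n)\<bar> * (\<eta> (X n) y / (cmod (X n - y))\<^sup>2)"
          using \<eta>[of "X n" y] by (simp only: norm_mult norm_divide norm_power norm_of_real) simp
        ultimately show ?case by simp
      qed
    qed simp
    from LIMSEQ_D[OF this, of "r/4"] r obtain N where N: "\<And>n. n \<ge> N \<Longrightarrow>
      norm ((\<integral>y. ?k (X n) y * of_real (\<eta> (X n) y) \<partial>disc_measure 0) - (\<integral>y. ?k x0 y * of_real (\<eta> x0 y) \<partial>disc_measure 0)) < r / 4" by auto
    have "norm ((beurling_pot f \<circ> X) n - beurling_pot f x0) < r" if "n \<ge> N" for n
    proof -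
      have "X n \<in> ball 0 1" using X by simp
      from near[OF this] near[OF x0] N[OF that] show ?thesis
        by (simp add: o_def) (smt (verit) norm_triangle_ineq norm_triangle_ineq4 norm_minus_commute diff_add_cancel add_diff_eq)
    qed
    then show "\<exists>N. \<forall>n\<ge>N. norm ((beurling_pot f \<circ> X) n - beurling_pot f x0) < r" by blast
  qed
qed

end

section \<open>The Cauchy transform of the disc\<close>

lemma distr_disc_rotate:
  assumes "cmod c = 1"
  shows "distr (disc_measure a) borel ((*) c) = disc_measure a"
proof (rule measure_eqI)
  fix A assume "A \<in> sets (distr (disc_measure a) borel ((*) c))"
  then have A [measurable]: "A \<in> sets borel" by simp
  have "emeasure (distr (disc_measure a) borel ((*) c)) A = (\<integral>\<^sup>+z. indicator A z \<partial>distr (disc_measure a) borel ((*) c))" by simp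
  also have "\<dots> = (\<integral>\<^sup>+z. indicator A (c * z) \<partial>disc_measure a)" by (subst nn_integral_distr) simp_all
  also have "\<dots> = emeasure (disc_measure a) A" by (subst nn_integral_disc_rotate[OF _ assms]) simp_all
  finally show "emeasure (distr (disc_measure a) borel ((*) c)) A = emeasure (disc_measure a) A" .
qed simp

lemma integral_disc_rotate:
  fixes F :: "complex \<Rightarrow> 'a::{banach,second_countable_topology}"
  assumes [measurable]: "F \<in> borel_measurable borel" and c: "cmod c = 1"
  shows "(\<integral>z. F (c * z) \<partial>disc_measure a) = (\<integral>z. F z \<partial>disc_measure a)"
proof -
  have "(\<integral>z. F z \<partial>disc_measure a) = (\<integral>z. F z \<partial>distr (disc_measure a) borel ((*) c))"
    unfolding distr_disc_rotate[OF c] ..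
  also have "\<dots> = (\<integral>z. F (c * z) \<partial>disc_measure a)" by (rule integral_distr) simp_all
  finally show ?thesis ..
qed

text \<open>Rotation by pi / n preserves the measure and multiplies g by -1, so the integral equals
  its own negative.\<close>

lemma integral_disc_homogeneous_eq_0:
  fixes g :: "complex \<Rightarrow> complex"
  assumes [measurable]: "g \<in> borel_measurable borel" and n: "n \<noteq> 0" and g: "\<And>c y. cmod c = 1 \<Longrightarrow> g (c * y) = c powi n * g y"
  shows "(\<integral>y. g y \<partial>disc_measure a) = 0"
proof -
  define c where "c = cis (pi / real_of_int n)"
  have c: "cmod c = 1" "c powi n = -1" using n by (simp_all add: c_def cis_power_int)
  have "(\<integral>y. g y \<partial>disc_measure a) = (\<integral>y. g (c * y) \<partial>disc_measure a)"
    by (rule integral_disc_rotate[symmetric]) (simp_all add: c)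
  also have "\<dots> = - (\<integral>y. g y \<partial>disc_measure a)" by (simp add: g c)
  finally show ?thesis by simp
qed

lemma measure_disc0_ball:
  assumes "0 \<le> r" "r \<le> 1"
  shows "measure (disc_measure 0) (ball 0 r) = pi * r\<^sup>2"
proof -
  have "emeasure (disc_measure 0) (ball 0 r) = (\<integral>\<^sup>+z. indicator (ball 0 r) z \<partial>disc_measure 0)" by (rule nn_integral_indicator[symmetric]) simp
  also have "\<dots> = (\<integral>\<^sup>+z. ennreal (norm (z::complex) powr 0) * indicator (ball 0 r) z * indicator (ball 0 1) z \<partial>lborel)"
    by (rule nn_integral_disc_measure) simp
  also have "\<dots> = (\<integral>\<^sup>+z. indicator (ball 0 r) (z::complex) \<partial>lborel)"
    using assms by (intro nn_integral_cong_AE eventually_mono[OF AE_lborel_singleton[of 0]]) (auto simp: indicator_def)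
  also have "\<dots> = ennreal (pi * r\<^sup>2)" using assms by (simp add: emeasure_ball unit_ball_vol_2)
  finally show ?thesis by (simp add: measure_def)
qed

text \<open>Expand 1 / (x - y) in powers of y / x. By rotation only the zeroth power has a nonzero
  integral, and it yields the area of the small disc divided by x.\<close>

lemma cauchy_kernel_inner:
  assumes x: "0 < \<rho>" "\<rho> < cmod x" "cmod x \<le> 1"
  shows "(\<integral>y. indicator (ball 0 \<rho>) y / (x - y) \<partial>disc_measure 0) = of_real (pi * \<rho>\<^sup>2) / x"
proof -
  interpret finite_measure "disc_measure 0" by (rule finite_measure_disc_measure) simp
  have x0: "x \<noteq> 0" using x by auto
  define t where "t = (\<lambda>k y. indicator (ball 0 \<rho>) y * (y ^ k / x ^ Suc k))"
  have tm [measurable]: "t k \<in> borel_measurable borel" for k unfolding t_def by measurable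
  define q where "q = \<rho> / cmod x"
  have q: "0 < q" "q < 1" using x x0 by (auto simp: q_def)
  have tb: "cmod (t k y) \<le> (1 / cmod x) * q ^ k" for k y
  proof (cases "y \<in> ball 0 \<rho>")
    case True
    have "cmod y ^ k / cmod x ^ Suc k \<le> \<rho> ^ k / cmod x ^ Suc k"
      using True by (intro divide_right_mono power_mono) auto
    then show ?thesis using True by (simp add: t_def norm_mult norm_divide norm_power q_def power_divide field_simps)
  qed (use q in \<open>simp add: t_def\<close>)
  have sm: "summable (\<lambda>k. (1 / cmod x) * q ^ k)" using q by (intro summable_mult summable_geometric) auto
  have ti: "integrable (disc_measure 0) (t k)" for k
    by (rule integrable_const_bound[where B="(1 / cmod x) * q ^ k"]) (use tb in auto)
  have s: "(\<lambda>k. \<integral>y. t k y \<partial>disc_measure 0) sums (\<integral>y. (\<Sum>k. t k y) \<partial>disc_measure 0)"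
  proof (rule sums_integral[OF ti])
    show "AE y in disc_measure 0. summable (\<lambda>k. norm (t k y))"
      by (intro AE_I2 summable_comparison_test'[OF sm]) (use tb in auto)
    show "summable (\<lambda>k. \<integral>y. norm (t k y) \<partial>disc_measure 0)"
    proof (rule summable_comparison_test'[OF summable_mult[OF sm, of "measure (disc_measure 0) UNIV"]])
      fix k
      have "(\<integral>y. norm (t k y) \<partial>disc_measure 0) \<le> (\<integral>y. (1 / cmod x) * q ^ k \<partial>disc_measure 0)"
        by (intro integral_mono integrable_norm ti) (use tb in auto)
      then show "norm (\<integral>y. norm (t k y) \<partial>disc_measure 0) \<le> measure (disc_measure 0) UNIV * ((1 / cmod x) * q ^ k)"
        by simp
    qed
  qed
  have sum_t: "(\<Sum>k. t k y) = indicator (ball 0 \<rho>) y / (x - y)" for y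
  proof (cases "y \<in> ball 0 \<rho>")
    case True
    then have "cmod (y / x) < 1" using x x0 by (simp add: norm_divide)
    from sums_mult[OF geometric_sums[OF this], of "1 / x"]
    have "(\<lambda>k. y ^ k / x ^ Suc k) sums (1 / x * (1 / (1 - y / x)))" by (simp add: power_divide)
    also have "1 / x * (1 / (1 - y / x)) = 1 / (x - y)" using x0 by (simp add: field_simps)
    finally show ?thesis using True by (simp add: t_def sums_iff)
  qed (simp add: t_def)
  have t0: "(\<integral>y. t k y \<partial>disc_measure 0) = (if k = 0 then of_real (pi * \<rho>\<^sup>2) / x else 0)" for k
  proof (cases "k = 0")
    case True
    have "(\<integral>y. t 0 y \<partial>disc_measure 0) = (\<integral>y. complex_of_real (indicator (ball 0 \<rho>) y) * (1 / x) \<partial>disc_measure 0)"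
      by (intro Bochner_Integration.integral_cong) (auto simp: t_def indicator_def)
    also have "\<dots> = complex_of_real (\<integral>y. indicator (ball 0 \<rho>) y \<partial>disc_measure 0) * (1 / x)"
      by (simp only: integral_mult_left_zero integral_complex_of_real)
    also have "(\<integral>y. indicat_real (ball 0 \<rho>) y \<partial>disc_measure 0) = pi * \<rho>\<^sup>2"
      using measure_disc0_ball[of \<rho>] x by simp
    finally show ?thesis using True by simp
  next
    case False
    have "(\<integral>y. t k y \<partial>disc_measure 0) = 0"
      using False by (intro integral_disc_homogeneous_eq_0[where n="int k"]) (auto simp: t_def norm_mult indicator_def power_mult_distrib)
    then show ?thesis using False by simp
  qed
  have "(\<lambda>k. if k = 0 then of_real (pi * \<rho>\<^sup>2) / x else 0) sums (of_real (pi * \<rho>\<^sup>2) / x)" by (rule sums_single)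
  then show ?thesis using s sums_unique2 unfolding t0 sum_t by blast
qed

text \<open>Here the expansion in x / y contains only strictly negative powers of y, and rotation
  makes each of them integrate to 0.\<close>

lemma cauchy_kernel_outer:
  assumes x: "cmod x < \<rho>"
  shows "(\<integral>y. indicator {y. \<rho> < cmod y} y / (x - y) \<partial>disc_measure 0) = 0"
proof -
  interpret finite_measure "disc_measure 0" by (rule finite_measure_disc_measure) simp
  let ?A = "{y. \<rho> < cmod y}"
  have \<rho>: "0 < \<rho>" using x norm_ge_zero[of x] by linarith
  have A [measurable]: "?A \<in> sets borel" by measurable
  define t where "t = (\<lambda>k y. indicator ?A y * (- (x ^ k / y ^ Suc k)))"
  have tm [measurable]: "t k \<in> borel_measurable borel" for k unfolding t_def by measurable
  define q where "q = cmod x / \<rho>"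
  have q: "0 \<le> q" "q < 1" using x \<rho> by (auto simp: q_def)
  have tb: "cmod (t k y) \<le> (1 / \<rho>) * q ^ k" for k y
  proof (cases "y \<in> ?A")
    case True
    have "cmod x ^ k / cmod y ^ Suc k \<le> cmod x ^ k / \<rho> ^ Suc k"
      using True \<rho> by (intro divide_left_mono power_mono mult_pos_pos zero_less_power) auto
    then show ?thesis using True by (simp add: t_def norm_mult norm_divide norm_power q_def power_divide field_simps)
  qed (use q \<rho> in \<open>simp add: t_def\<close>)
  have sm: "summable (\<lambda>k. (1 / \<rho>) * q ^ k)" using q by (intro summable_mult summable_geometric) auto
  have ti: "integrable (disc_measure 0) (t k)" for k
    by (rule integrable_const_bound[where B="(1 / \<rho>) * q ^ k"]) (use tb in auto)
  have s: "(\<lambda>k. \<integral>y. t k y \<partial>disc_measure 0) sums (\<integral>y. (\<Sum>k. t k y) \<partial>disc_measure 0)"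
  proof (rule sums_integral[OF ti])
    show "AE y in disc_measure 0. summable (\<lambda>k. norm (t k y))"
      by (intro AE_I2 summable_comparison_test'[OF sm]) (use tb in auto)
    show "summable (\<lambda>k. \<integral>y. norm (t k y) \<partial>disc_measure 0)"
    proof (rule summable_comparison_test'[OF summable_mult[OF sm, of "measure (disc_measure 0) UNIV"]])
      fix k
      have "(\<integral>y. norm (t k y) \<partial>disc_measure 0) \<le> (\<integral>y. (1 / \<rho>) * q ^ k \<partial>disc_measure 0)"
        by (intro integral_mono integrable_norm ti) (use tb in auto)
      then show "norm (\<integral>y. norm (t k y) \<partial>disc_measure 0) \<le> measure (disc_measure 0) UNIV * ((1 / \<rho>) * q ^ k)"
        by simp
    qed
  qed
  have sum_t: "(\<Sum>k. t k y) = indicator ?A y / (x - y)" for y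
  proof (cases "y \<in> ?A")
    case True
    then have y0: "y \<noteq> 0" using \<rho> by auto
    have "cmod (x / y) < 1" using True x y0 by (simp add: norm_divide)
    from sums_mult[OF geometric_sums[OF this], of "- (1 / y)"]
    have "(\<lambda>k. - (x ^ k / y ^ Suc k)) sums (- (1 / y) * (1 / (1 - x / y)))" by (simp add: power_divide)
    also have "- (1 / y) * (1 / (1 - x / y)) = 1 / (x - y)"
    proof -
      have "x - y \<noteq> 0" using True x by auto
      moreover have "1 - x / y = (y - x) / y" using y0 by (simp add: field_simps)
      ultimately show ?thesis using y0 by (simp add: divide_simps)
    qed
    finally show ?thesis using True by (simp add: t_def sums_iff)
  qed (simp add: t_def)
  have t0: "(\<integral>y. t k y \<partial>disc_measure 0) = 0" for k
  proof (rule integral_disc_homogeneous_eq_0[where n="- int (Suc k)"])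
    fix c y :: complex assume c: "cmod c = 1"
    then have "c \<noteq> 0" by auto
    then show "t k (c * y) = c powi (- int (Suc k)) * t k y"
      using c by (auto simp: t_def norm_mult indicator_def power_int_minus power_mult_distrib field_simps simp del: power_Suc of_nat_Suc)
  qed auto
  have "(\<lambda>k. 0) sums (0::complex)" by simp
  then show ?thesis using s sums_unique2 unfolding t0 sum_t by blast
qed

lemma AE_disc_measure_sphere: "AE y in disc_measure a. cmod y \<noteq> r"
proof -
  have "sphere (0::complex) r \<in> null_sets lborel"
    using negligible_sphere[of "0::complex" r] by (auto simp: null_sets_completion_iff negligible_iff_null_sets)
  from AE_not_in[OF this] show ?thesis unfolding AE_disc_measure_iff by (auto elim: eventually_mono)
qed

lemma integral_cauchy_kernel:
  assumes x: "x \<in> ball 0 1"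
  shows "(\<integral>y. 1 / (x - y) \<partial>disc_measure 0) = of_real pi * cnj x"
proof -
  let ?r = "cmod x"
  have io: "integrable (disc_measure 0) (\<lambda>y. 1 / (x - y))"
    by (rule riesz_kernel_bound(1)[of 1 x x 1 0])
      (use x AE_disc0[of x x] in \<open>auto elim!: eventually_mono simp: norm_divide powr_minus_divide\<close>)
  \<comment> \<open>The two expansions converge uniformly only away from |y| = |x|, so a ring around
    that circle is cut out and then shrunk. The offset n + 2 keeps the inner radius positive already
    for n = 0 when x is nonzero.\<close>
  define Inn where "Inn = (\<lambda>n::nat. ball (0::complex) (?r * (1 - 1 / real (n+2))))"
  define Out where "Out = (\<lambda>n::nat. {y::complex. ?r + 1 / real (n+1) < cmod y})"
  have [measurable]: "Inn n \<in> sets borel" "Out n \<in> sets borel" for n unfolding Inn_def Out_def by measurable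
  have lim: "(\<lambda>n. \<integral>y. (indicator (Inn n) y + indicator (Out n) y) / (x - y) \<partial>disc_measure 0) \<longlonglongrightarrow> (\<integral>y. 1 / (x - y) \<partial>disc_measure 0)"
  proof (rule integral_dominated_convergence[where w="\<lambda>y. norm (1 / (x - y))"])
    show "integrable (disc_measure 0) (\<lambda>y. norm (1 / (x - y)))" using io by (rule integrable_norm)
    show "AE y in disc_measure 0. norm ((indicator (Inn n) y + indicator (Out n) y) / (x - y)) \<le> norm (1 / (x - y))" for n
    proof (rule AE_I2)
      fix y
      have "\<not> (y \<in> Inn n \<and> y \<in> Out n)"
      proof
        assume "y \<in> Inn n \<and> y \<in> Out n"
        then have "?r + 1 / real (n+1) < ?r * (1 - 1 / real (n+2))" by (auto simp: Inn_def Out_def)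
        also have "\<dots> \<le> ?r" by (simp add: mult_left_le)
        finally show False by (simp add: divide_simps split: if_splits)
      qed
      then have "norm (indicator (Inn n) y + indicator (Out n) y :: complex) \<le> 1" by (auto simp: indicator_def)
      then show "norm ((indicator (Inn n) y + indicator (Out n) y) / (x - y)) \<le> norm (1 / (x - y))"
        by (simp add: norm_divide divide_right_mono)
    qed
    show "AE y in disc_measure 0. (\<lambda>n. (indicator (Inn n) y + indicator (Out n) y) / (x - y)) \<longlonglongrightarrow> 1 / (x - y)"
      using AE_disc_measure_sphere[of ?r 0] AE_disc0[of x x]
    proof eventually_elim
      case (elim y)
      have l1: "(\<lambda>n. ?r * (1 - 1 / real (n+2))) \<longlonglongrightarrow> ?r" by real_asymp
      have l2: "(\<lambda>n. ?r + 1 / real (n+1)) \<longlonglongrightarrow> ?r" by real_asymp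
      have "\<forall>\<^sub>F n in sequentially. (indicator (Inn n) y + indicator (Out n) y :: complex) = 1"
      proof (cases "cmod y < ?r")
        case True
        show ?thesis using order_tendstoD(1)[OF l1 True]
        proof eventually_elim
          case (elim n)
          have "?r < ?r + 1 / real (n+1)" by simp
          then have "y \<notin> Out n" unfolding Out_def mem_Collect_eq not_less using True by linarith
          then show ?case using elim by (simp add: Inn_def)
        qed
      next
        case False
        then have "?r < cmod y" using elim by simp
        show ?thesis using order_tendstoD(2)[OF l2 \<open>?r < cmod y\<close>]
        proof eventually_elim
          case (elim n)
          have "?r * (1 - 1 / real (n+2)) \<le> ?r" by (simp add: mult_left_le)
          then have "y \<notin> Inn n" using False by (auto simp: Inn_def)
          then show ?case using elim by (simp add: Out_def)
        qed
      qed
      then show ?case by (intro tendsto_eventually) (auto elim: eventually_mono)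
    qed
  qed measurable
  have iI: "integrable (disc_measure 0) (\<lambda>y. indicator A y / (x - y))" if [measurable]: "A \<in> sets borel" for A
    by (rule Bochner_Integration.integrable_bound[OF io]) (auto simp: indicator_def)
  have val: "(\<integral>y. (indicator (Inn n) y + indicator (Out n) y) / (x - y) \<partial>disc_measure 0) = of_real (pi * (1 - 1 / real (n+2))\<^sup>2) * cnj x" for n
  proof -
    have "(\<integral>y. (indicator (Inn n) y + indicator (Out n) y) / (x - y) \<partial>disc_measure 0) = (\<integral>y. indicator (Inn n) y / (x - y) \<partial>disc_measure 0) + (\<integral>y. indicator (Out n) y / (x - y) \<partial>disc_measure 0)"
      unfolding add_divide_distrib by (intro Bochner_Integration.integral_add iI) auto
    also have "(\<integral>y. indicator (Out n) y / (x - y) \<partial>disc_measure 0) = 0"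
      unfolding Out_def by (rule cauchy_kernel_outer) simp
    also have "(\<integral>y. indicator (Inn n) y / (x - y) \<partial>disc_measure 0) = of_real (pi * (1 - 1 / real (n+2))\<^sup>2) * cnj x"
    proof (cases "x = 0")
      case True
      then show ?thesis by (simp add: Inn_def)
    next
      case False
      have "1 - 1 / real (n+2) < 1" "0 < 1 - 1 / real (n+2)" by auto
      then have "0 < ?r * (1 - 1 / real (n+2))" "?r * (1 - 1 / real (n+2)) < ?r" using False by (auto simp: mult_less_cancel_left2)
      then have "(\<integral>y. indicator (Inn n) y / (x - y) \<partial>disc_measure 0) = of_real (pi * (?r * (1 - 1 / real (n+2)))\<^sup>2) / x"
        unfolding Inn_def using x by (intro cauchy_kernel_inner) auto
      also have "\<dots> = of_real (pi * (1 - 1 / real (n+2))\<^sup>2) * (of_real (?r\<^sup>2) / x)"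
        by (simp add: power_mult_distrib)
      also have "of_real (?r\<^sup>2) / x = cnj x" unfolding complex_norm_square using False by simp
      finally show ?thesis .
    qed
    finally show ?thesis by simp
  qed
  have "(\<lambda>n. pi * (1 - 1 / real (n+2))\<^sup>2) \<longlonglongrightarrow> pi" by real_asymp
  then have "(\<lambda>n. of_real (pi * (1 - 1 / real (n+2))\<^sup>2) * cnj x) \<longlonglongrightarrow> of_real pi * cnj x"
    by (intro tendsto_intros)
  then show ?thesis using lim unfolding val by (metis LIMSEQ_unique)
qed

text \<open>On the disc Ln (1 - x * cnj y) is a power series in x with coefficients depending on y.
  Integrating term by term against f gives a power series in x again, so the regular part of the
  potential is the real part of a holomorphic function.\<close>

lemma regular_part_holomorphic:
  fixes f :: "complex \<Rightarrow> real"
  assumes [measurable]: "f \<in> borel_measurable borel" and fF: "\<And>y. \<bar>f y\<bar> \<le> F"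
  obtains \<Phi> where "\<Phi> holomorphic_on ball 0 1"
    "\<And>x. x \<in> ball 0 1 \<Longrightarrow> integrable (disc_measure 0) (\<lambda>y. ln (cmod (1 - x * cnj y)) * f y)"
    "\<And>x. x \<in> ball 0 1 \<Longrightarrow> (\<integral>y. ln (cmod (1 - x * cnj y)) * f y \<partial>disc_measure 0) = Re (\<Phi> x)"
proof -
  interpret finite_measure "disc_measure 0" by (rule finite_measure_disc_measure) simp
  have F0: "0 \<le> F" using fF[of 0] by linarith
  \<comment> \<open>The term k = 0 is zero because division by \<open>of_nat 0\<close> gives 0, as
    the logarithm series requires. The indicator makes the bound F |x|^k valid for every y.\<close>
  define t where "t = (\<lambda>x k y. indicator (ball 0 1) y * (- ((x * cnj y) ^ k) / of_nat k) * complex_of_real (f y))"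
  define c where "c = (\<lambda>k. \<integral>y. indicator (ball 0 1) y * (- (cnj y ^ k) / of_nat k) * complex_of_real (f y) \<partial>disc_measure 0)"
  define \<Phi> where "\<Phi> x = (\<integral>y. (\<Sum>k. t x k y) \<partial>disc_measure 0)" for x
  have tm [measurable]: "t x k \<in> borel_measurable borel" for x k unfolding t_def by measurable
  have tb: "norm (t x k y) \<le> F * cmod x ^ k" for x k y
  proof (cases "y \<in> ball 0 1")
    case True
    have "norm (t x k y) = (cmod x ^ k * cmod y ^ k / real k) * \<bar>f y\<bar>"
      using True by (simp add: t_def norm_mult norm_divide norm_power power_mult_distrib)
    also have "\<dots> \<le> (cmod x ^ k * 1) * F"
    proof (intro mult_mono fF)
      have "cmod x ^ k * cmod y ^ k / real k \<le> cmod x ^ k * cmod y ^ k"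
      proof (cases "k = 0")
        case False
        then show ?thesis using divide_left_mono[of 1 "real k" "cmod x ^ k * cmod y ^ k"] by simp
      qed simp
      also have "\<dots> \<le> cmod x ^ k * 1" using True by (intro mult_left_mono power_le_one) auto
      finally show "cmod x ^ k * cmod y ^ k / real k \<le> cmod x ^ k * 1" .
    qed auto
    finally show ?thesis by (simp add: mult.commute)
  qed (use F0 in \<open>simp add: t_def\<close>)
  have ti: "integrable (disc_measure 0) (t x k)" for x k
    by (rule integrable_const_bound[where B="F * cmod x ^ k"]) (use tb in auto)
  have sm: "summable (\<lambda>k. F * cmod x ^ k)" if "x \<in> ball 0 1" for x
    using that by (intro summable_mult summable_geometric) auto
  have A: "AE y in disc_measure 0. summable (\<lambda>k. norm (t x k y))" if "x \<in> ball 0 1" for x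
    by (intro AE_I2 summable_comparison_test'[OF sm[OF that]]) (use tb in auto)
  have B: "summable (\<lambda>k. \<integral>y. norm (t x k y) \<partial>disc_measure 0)" if "x \<in> ball 0 1" for x
  proof (rule summable_comparison_test'[OF summable_mult[OF sm[OF that], of "measure (disc_measure 0) UNIV"]])
    fix k
    have "(\<integral>y. norm (t x k y) \<partial>disc_measure 0) \<le> (\<integral>y. F * cmod x ^ k \<partial>disc_measure 0)"
      by (intro integral_mono integrable_norm ti) (use tb in auto)
    then show "norm (\<integral>y. norm (t x k y) \<partial>disc_measure 0) \<le> measure (disc_measure 0) UNIV * (F * cmod x ^ k)" by simp
  qed
  have cs: "(\<lambda>k. c k * (x - 0) ^ k) sums \<Phi> x" if "x \<in> ball 0 1" for x
  proof -
    have "(\<integral>y. t x k y \<partial>disc_measure 0) = c k * (x - 0) ^ k" for k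
    proof -
      have "t x k y = indicator (ball 0 1) y * (- (cnj y ^ k) / of_nat k) * complex_of_real (f y) * x ^ k" for y
        by (simp add: t_def power_mult_distrib mult_ac)
      then show ?thesis unfolding c_def by (simp only: integral_mult_left_zero diff_zero)
    qed
    then show ?thesis using sums_integral[OF ti A[OF that] B[OF that]] by (simp add: \<Phi>_def)
  qed
  have hol: "\<Phi> holomorphic_on ball 0 1" by (rule power_series_holomorphic[OF cs])
  have st: "(\<Sum>k. t x k y) = Ln (1 - x * cnj y) * complex_of_real (f y)" if "x \<in> ball 0 1" "y \<in> ball 0 1" for x y
  proof -
    have "cmod (- (x * cnj y)) < 1"
      using that mult_strict_mono[of "cmod x" 1 "cmod y" 1] by (simp add: norm_mult)
    from sums_mult2[OF Ln_series'[OF this], of "complex_of_real (f y)"]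
    show ?thesis using that by (simp add: t_def sums_iff)
  qed
  have re: "AE y in disc_measure 0. Re (\<Sum>k. t x k y) = ln (cmod (1 - x * cnj y)) * f y" if x: "x \<in> ball 0 1" for x
    using AE_disc_measure
  proof eventually_elim
    case (elim y)
    have "cmod (x * cnj y) < 1"
      using x elim mult_strict_mono[of "cmod x" 1 "cmod y" 1] by (simp add: norm_mult)
    then have "1 - x * cnj y \<noteq> 0" by auto
    then show ?case using st[OF x elim] by simp
  qed
  have si: "integrable (disc_measure 0) (\<lambda>y. \<Sum>k. t x k y)" if "x \<in> ball 0 1" for x
    by (rule integrable_suminf[OF ti A[OF that] B[OF that]])
  have m: "(\<lambda>y. ln (cmod (1 - x * cnj y)) * f y) \<in> borel_measurable borel" for x by measurable
  show ?thesis
  proof (rule that[OF hol])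
    fix x :: complex assume x: "x \<in> ball 0 1"
    show "integrable (disc_measure 0) (\<lambda>y. ln (cmod (1 - x * cnj y)) * f y)"
      by (rule integrable_cong_AE_imp[OF integrable_Re[OF si[OF x]] _ re[OF x]]) (simp add: m)
    have "(\<integral>y. ln (cmod (1 - x * cnj y)) * f y \<partial>disc_measure 0) = (\<integral>y. Re (\<Sum>k. t x k y) \<partial>disc_measure 0)"
      by (rule integral_cong_AE) (use re[OF x] m in \<open>auto elim: eventually_mono\<close>)
    also have "\<dots> = Re (\<Phi> x)" unfolding \<Phi>_def by (rule integral_Re[OF si[OF x]])
    finally show "(\<integral>y. ln (cmod (1 - x * cnj y)) * f y \<partial>disc_measure 0) = Re (\<Phi> x)" .
  qed
qed

text \<open>\<Psi> is u_x - i u_y for the potential u, that is, twice its Wirtinger derivative, and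
  its conjugate-linear part -f/2 encodes -Laplacian u = f. Logarithm and Cauchy potentials give the
  singular part, a holomorphic function the rest.\<close>

theorem potential_regularity:
  fixes f :: "complex \<Rightarrow> real"
  assumes f: "f \<in> borel_measurable borel" "\<And>y. \<bar>f y\<bar> \<le> F"
    and \<gamma>: "0 < \<gamma>" "\<gamma> \<le> 1"
    and hoelder: "\<And>x y. x \<in> ball 0 1 \<Longrightarrow> y \<in> ball 0 1 \<Longrightarrow> \<bar>f x - f y\<bar> \<le> H * cmod (x - y) powr \<gamma>"
  obtains \<Psi> E where "continuous_on (ball 0 1) E"
    "\<And>x. x \<in> ball 0 1 \<Longrightarrow> (potential 0 f has_derivative (\<lambda>h. Re (\<Psi> x * h))) (at x)"
    "\<And>x. x \<in> ball 0 1 \<Longrightarrow> (\<Psi> has_derivative (\<lambda>h. E x * h - of_real (f x / 2) * cnj h)) (at x)"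
proof -
  obtain \<Phi> where \<Phi>: "\<Phi> holomorphic_on ball 0 1"
    "\<And>x. x \<in> ball 0 1 \<Longrightarrow> integrable (disc_measure 0) (\<lambda>y. ln (cmod (1 - x * cnj y)) * f y)"
    "\<And>x. x \<in> ball 0 1 \<Longrightarrow> (\<integral>y. ln (cmod (1 - x * cnj y)) * f y \<partial>disc_measure 0) = Re (\<Phi> x)"
    using regular_part_holomorphic[OF f] by blast
  let ?c = "complex_of_real (1 / (2 * pi))"
  have pot: "potential 0 f x = (Re (\<Phi> x) - log_pot f x) / (2 * pi)" if x: "x \<in> ball 0 1" for x
  proof -
    have i: "integrable (disc_measure 0) (\<lambda>y. ln (cmod (x - y)) * f y)"
      using x by (intro integrable_log_pot[OF f \<gamma> hoelder]) auto
    have "potential 0 f x = (\<integral>y. (ln (cmod (1 - x * cnj y)) * f y - ln (cmod (x - y)) * f y) / (2 * pi) \<partial>disc_measure 0)"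
      unfolding potential_def
    proof (rule integral_cong_AE)
      show "AE y in disc_measure 0. green x y * f y = (ln (cmod (1 - x * cnj y)) * f y - ln (cmod (x - y)) * f y) / (2 * pi)"
        using AE_disc0[of x x] by eventually_elim (auto simp: green_def algebra_simps diff_divide_distrib)
    qed (use f(1) in measurable)
    then show ?thesis unfolding log_pot_def \<Phi>(3)[OF x, symmetric]
      using Bochner_Integration.integral_diff[OF \<Phi>(2)[OF x] i] by simp
  qed
  define \<Psi> where "\<Psi> = (\<lambda>x. ?c * (deriv \<Phi> x - cauchy_pot f x))"
  define E where "E = (\<lambda>x. ?c * (deriv (deriv \<Phi>) x + beurling_pot f x))"
  have d1: "deriv \<Phi> holomorphic_on ball 0 1" using \<Phi>(1) by (rule holomorphic_deriv) simp
  have d2: "deriv (deriv \<Phi>) holomorphic_on ball 0 1" using d1 by (rule holomorphic_deriv) simp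
  show ?thesis
  proof (rule that)
    show "continuous_on (ball 0 1) E" unfolding E_def
      by (intro continuous_intros holomorphic_on_imp_continuous_on d2 continuous_on_beurling_pot[OF f \<gamma> hoelder])
    fix x :: complex assume x: "x \<in> ball 0 1"
    have D1: "(\<Phi> has_derivative (\<lambda>h. deriv \<Phi> x * h)) (at x)"
      using holomorphic_derivI[OF \<Phi>(1) open_ball x] by (simp add: has_field_derivative_def)
    have D2: "(deriv \<Phi> has_derivative (\<lambda>h. deriv (deriv \<Phi>) x * h)) (at x)"
      using holomorphic_derivI[OF d1 open_ball x] by (simp add: has_field_derivative_def)
    have L: "(log_pot f has_derivative (\<lambda>h. Re (cauchy_pot f x * h))) (at x)"
      by (rule log_pot_has_derivative[OF f \<gamma> hoelder x])
    have C: "(cauchy_pot f has_derivative (\<lambda>h. of_real (pi * f x) * cnj h - beurling_pot f x * h)) (at x)"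
      by (rule cauchy_pot_has_derivative[OF f \<gamma> hoelder x integral_cauchy_kernel])
    have R: "((\<lambda>x. Re (\<Phi> x)) has_derivative (\<lambda>h. Re (deriv \<Phi> x * h))) (at x)"
      by (rule has_derivative_Re[OF D1])
    have "((\<lambda>x. 1 / (2 * pi) * (Re (\<Phi> x) - log_pot f x)) has_derivative (\<lambda>h. 1 / (2 * pi) * (Re (deriv \<Phi> x * h) - Re (cauchy_pot f x * h)))) (at x)"
      by (intro has_derivative_mult_right has_derivative_diff R L)
    also have "(\<lambda>h. 1 / (2 * pi) * (Re (deriv \<Phi> x * h) - Re (cauchy_pot f x * h))) = (\<lambda>h. Re (\<Psi> x * h))"
    proof (rule ext)
      have *: "r * (Re (A * h) - Re (B * h)) = Re (of_real r * (A - B) * h)" for r A B h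
        by (simp add: algebra_simps)
      show "1 / (2 * pi) * (Re (deriv \<Phi> x * h) - Re (cauchy_pot f x * h)) = Re (\<Psi> x * h)" for h
        unfolding \<Psi>_def by (rule *)
    qed
    finally show "(potential 0 f has_derivative (\<lambda>h. Re (\<Psi> x * h))) (at x)"
      by (rule has_derivative_transform_within_open[OF _ open_ball x]) (simp add: pot)
    have "(\<Psi> has_derivative (\<lambda>h. ?c * (deriv (deriv \<Phi>) x * h - (of_real (pi * f x) * cnj h - beurling_pot f x * h)))) (at x)"
      unfolding \<Psi>_def by (intro has_derivative_mult_right has_derivative_diff D2 C)
    also have "(\<lambda>h. ?c * (deriv (deriv \<Phi>) x * h - (of_real (pi * f x) * cnj h - beurling_pot f x * h))) = (\<lambda>h. E x * h - of_real (f x / 2) * cnj h)"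
    proof (rule ext)
      fix h
      have "1 / (2 * pi) * (pi * f x) = f x / 2" by simp
      then have "?c * of_real (pi * f x) = of_real (f x / 2)" by (metis of_real_mult)
      then show "?c * (deriv (deriv \<Phi>) x * h - (of_real (pi * f x) * cnj h - beurling_pot f x * h)) = E x * h - of_real (f x / 2) * cnj h"
        unfolding E_def by (simp only: algebra_simps)
    qed
    finally show "(\<Psi> has_derivative (\<lambda>h. E x * h - of_real (f x / 2) * cnj h)) (at x)" .
  qed
qed

section \<open>Transfer to the real plane\<close>

lemma powr_add_le_add:
  fixes s t :: real
  assumes "0 \<le> s" "0 \<le> t" and \<gamma>: "0 < \<gamma>" "\<gamma> \<le> 1"
  shows "(s + t) powr \<gamma> \<le> s powr \<gamma> + t powr \<gamma>"
proof (cases "s + t = 0")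
  case False
  then have st: "0 < s + t" using assms by simp
  have *: "r / (s + t) \<le> r powr \<gamma> / (s + t) powr \<gamma>" if "0 \<le> r" "r \<le> s + t" for r
  proof -
    have "r / (s + t) = (r / (s + t)) powr 1" using that st by simp
    also have "\<dots> \<le> (r / (s + t)) powr \<gamma>" using that st \<gamma> by (intro powr_mono') auto
    finally show ?thesis using that st by (simp add: powr_divide)
  qed
  have "1 = s / (s + t) + t / (s + t)" using st by (simp add: add_divide_distrib[symmetric])
  also have "\<dots> \<le> s powr \<gamma> / (s + t) powr \<gamma> + t powr \<gamma> / (s + t) powr \<gamma>"
    using assms by (intro add_mono *) auto
  finally show ?thesis using st by (simp add: add_divide_distrib[symmetric] le_divide_eq)
qed (use assms in auto)

lemma powr_diff_hoelder:
  fixes s t :: real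
  assumes "0 \<le> s" "0 \<le> t" and \<gamma>: "0 < \<gamma>" "\<gamma> \<le> 1"
  shows "\<bar>s powr \<gamma> - t powr \<gamma>\<bar> \<le> \<bar>s - t\<bar> powr \<gamma>"
proof -
  have *: "s powr \<gamma> - t powr \<gamma> \<le> \<bar>s - t\<bar> powr \<gamma>" if "0 \<le> t" "t \<le> s" for s t
    using powr_add_le_add[of "s - t" t \<gamma>] that \<gamma> by simp
  show ?thesis
    using *[of t s] *[of s t] assms powr_mono2[of \<gamma> t s] powr_mono2[of \<gamma> s t]
    by (cases "t \<le> s") (auto simp: abs_minus_commute)
qed

lemma powr_diff_lipschitz:
  fixes s t :: real
  assumes st: "0 \<le> s" "s \<le> B" "0 \<le> t" "t \<le> B" and p: "1 \<le> p"
  shows "\<bar>s powr p - t powr p\<bar> \<le> p * B powr (p - 1) * \<bar>s - t\<bar>"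
proof -
  have *: "t powr p - s powr p \<le> p * B powr (p - 1) * (t - s)" if "0 \<le> s" "s < t" "t \<le> B" for s t
  proof (cases "s = 0")
    case True
    have "t powr p = t powr (p - 1) * t" using that True by (simp add: powr_diff)
    also have "\<dots> \<le> B powr (p - 1) * t" using that p True by (intro mult_right_mono powr_mono2) auto
    also have "\<dots> \<le> p * (B powr (p - 1) * t)" using p that True mult_right_mono[of 1 p "B powr (p - 1) * t"] by simp
    finally show ?thesis using True p by (simp add: mult.assoc)
  next
    case False
    then have s0: "0 < s" using that by simp
    have "\<exists>z. s < z \<and> z < t \<and> t powr p - s powr p = (t - s) * (p * z powr (p - 1))"
      using that(2) s0 by (intro MVT2) (auto intro!: has_real_derivative_powr)
    then obtain z where z: "s < z" "z < t" "t powr p - s powr p = (t - s) * (p * z powr (p - 1))" by blast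
    have "z powr (p - 1) \<le> B powr (p - 1)" using z that p s0 by (intro powr_mono2) auto
    then have "(t - s) * (p * z powr (p - 1)) \<le> (t - s) * (p * B powr (p - 1))"
      using that p by (intro mult_left_mono) auto
    then show ?thesis using z by (simp add: mult_ac)
  qed
  show ?thesis
  proof (cases s t rule: linorder_cases)
    case less
    then show ?thesis using *[of s t] st p powr_mono2[of p s t] by simp
  next
    case greater
    then show ?thesis using *[of t s] st p powr_mono2[of p t s] by simp
  qed simp
qed

text \<open>For \<alpha> <= 1 the weight is Hoelder of order \<alpha> at the origin and no better,
  for \<alpha> > 1 it is Lipschitz; one statement covers both so that the regularity theorem applies
  to every \<alpha> > 0.\<close>

lemma norm_powr_hoelder:
  assumes \<alpha>: "0 < \<alpha>"
  obtains K \<gamma> where "0 < \<gamma>" "\<gamma> \<le> 1" "0 \<le> K"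
    "\<And>x y :: complex. norm x \<le> 1 \<Longrightarrow> norm y \<le> 1 \<Longrightarrow> \<bar>norm x powr \<alpha> - norm y powr \<alpha>\<bar> \<le> K * norm (x - y) powr \<gamma>"
proof (cases "\<alpha> \<le> 1")
  case True
  show ?thesis
  proof (rule that[of \<alpha> 1])
    fix x y :: complex
    have "\<bar>norm x powr \<alpha> - norm y powr \<alpha>\<bar> \<le> \<bar>norm x - norm y\<bar> powr \<alpha>" using \<alpha> True by (intro powr_diff_hoelder) auto
    also have "\<dots> \<le> norm (x - y) powr \<alpha>" using \<alpha> norm_triangle_ineq3[of x y] by (intro powr_mono2) auto
    finally show "\<bar>norm x powr \<alpha> - norm y powr \<alpha>\<bar> \<le> 1 * norm (x - y) powr \<alpha>" by simp
  qed (use \<alpha> True in auto)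
next
  case False
  show ?thesis
  proof (rule that[of 1 \<alpha>])
    fix x y :: complex assume xy: "norm x \<le> 1" "norm y \<le> 1"
    have "\<bar>norm x powr \<alpha> - norm y powr \<alpha>\<bar> \<le> \<alpha> * 1 powr (\<alpha> - 1) * \<bar>norm x - norm y\<bar>" using xy False by (intro powr_diff_lipschitz) auto
    also have "\<dots> \<le> \<alpha> * norm (x - y)" using \<alpha> norm_triangle_ineq3[of x y] by simp
    finally show "\<bar>norm x powr \<alpha> - norm y powr \<alpha>\<bar> \<le> \<alpha> * norm (x - y) powr 1" by simp
  qed (use \<alpha> in auto)
qed

text \<open>Distances in the disc are at most 2, so lowering a Hoelder exponent to a common value
  costs a factor of at most 2.\<close>

lemma powr_le_twice_powr:
  fixes d :: real
  assumes "0 \<le> d" "d \<le> 2" "\<gamma> \<le> \<gamma>'" "\<gamma>' \<le> 1" "0 < \<gamma>"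
  shows "d powr \<gamma>' \<le> 2 * d powr \<gamma>"
proof (cases "d = 0")
  case False
  have "d powr \<gamma>' = d powr \<gamma> * d powr (\<gamma>' - \<gamma>)" by (simp add: powr_add[symmetric])
  moreover have "d powr (\<gamma>' - \<gamma>) \<le> 2 powr (\<gamma>' - \<gamma>)" using assms by (intro powr_mono2) auto
  moreover have "(2::real) powr (\<gamma>' - \<gamma>) \<le> 2 powr 1" using assms by (intro powr_mono) auto
  ultimately show ?thesis using mult_left_mono[of "d powr (\<gamma>' - \<gamma>)" 2 "d powr \<gamma>"] by (simp add: mult.commute)
qed (use assms in simp)

section \<open>Identifying the real plane with the complex numbers\<close>

definition to_complex :: "real^2 \<Rightarrow> complex" where
  "to_complex x = Complex (x$1) (x$2)"

definition basis_complex :: "2 \<Rightarrow> complex" where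
  "basis_complex i = to_complex (axis i 1)"

lemma basis_complex_simps [simp]: "basis_complex 1 = 1" "basis_complex 2 = \<i>"
  by (auto simp: basis_complex_def to_complex_def axis_def complex_eq_iff)

lemma norm_to_complex [simp]: "norm (to_complex x) = norm x"
  by (simp add: to_complex_def cmod_def norm_vec_def L2_set_def UNIV_2)

lemma bounded_linear_to_complex: "bounded_linear to_complex"
proof (rule bounded_linearI')
  show "to_complex (x + y) = to_complex x + to_complex y" "to_complex (c *\<^sub>R x) = c *\<^sub>R to_complex x" for x y c
    by (simp_all add: to_complex_def complex_eq_iff)
qed

lemma to_complex_line: "to_complex (x + t *\<^sub>R axis i 1) = to_complex x + of_real t * basis_complex i"
  using bounded_linear.linear[OF bounded_linear_to_complex]
  by (simp add: basis_complex_def linear_add linear_scale scaleR_conv_of_real[where 'a=complex])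

lemma to_complex_rot: "to_complex (rot \<theta> x) = cis \<theta> * to_complex x"
  by (simp add: to_complex_def rot_def complex_eq_iff)

lemma surj_to_complex: "\<exists>x. to_complex x = z"
  by (rule exI[of _ "vector [Re z, Im z]"]) (simp add: to_complex_def)

lemma has_derivative_to_complex:
  assumes "(g has_derivative D) (at (to_complex x))"
  shows "((\<lambda>x. g (to_complex x)) has_derivative (\<lambda>h. D (to_complex h))) (at x)"
  using has_derivative_compose[OF bounded_linear_imp_has_derivative[OF bounded_linear_to_complex] assms] .

lemma dpart_to_complex:
  assumes g: "(g has_derivative D) (at (to_complex x))"
  shows "dpart i (\<lambda>x. g (to_complex x)) x = D (basis_complex i)"
proof -
  have "((\<lambda>t::real. to_complex x + of_real t * basis_complex i) has_derivative (\<lambda>h. of_real h * basis_complex i)) (at 0)"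
    by (auto intro!: derivative_eq_intros)
  from has_derivative_compose[OF this, of g D] g
  have "((\<lambda>t. g (to_complex x + of_real t * basis_complex i)) has_derivative (\<lambda>h. D (of_real h * basis_complex i))) (at 0)" by simp
  moreover have "D (of_real h * basis_complex i) = D (basis_complex i) * h" for h
  proof -
    have "linear D" using g has_derivative_linear by blast
    then show ?thesis using linear_scale[of D h "basis_complex i"] by (simp add: scaleR_conv_of_real mult.commute)
  qed
  ultimately have "((\<lambda>t. g (to_complex x + of_real t * basis_complex i)) has_field_derivative D (basis_complex i)) (at 0)"
    by (simp add: has_field_derivative_def)
  then show ?thesis unfolding dpart_def to_complex_line by (rule DERIV_imp_deriv)
qed

lemma dpart_cong_open:
  assumes "open S" "x \<in> S" "\<And>y. y \<in> S \<Longrightarrow> f y = g y"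
  shows "dpart i f x = dpart i g x"
  unfolding dpart_def
proof (rule deriv_cong_ev)
  have "((\<lambda>t::real. x + t *\<^sub>R axis i 1) \<longlongrightarrow> x + 0 *\<^sub>R axis i 1) (nhds 0)"
    by (intro tendsto_intros filterlim_ident)
  then have "\<forall>\<^sub>F t in nhds (0::real). x + t *\<^sub>R axis i 1 \<in> S"
    using assms(1,2) by (intro topological_tendstoD[of _ x]) auto
  then show "\<forall>\<^sub>F t in nhds 0. f (x + t *\<^sub>R axis i 1) = g (x + t *\<^sub>R axis i 1)"
    by (rule eventually_mono) (use assms(3) in auto)
qed simp

lemma C2_on_to_complex:
  fixes w f :: "complex \<Rightarrow> real"
  assumes E: "continuous_on (ball 0 1) E" and f: "continuous_on (ball 0 1) f"
    and w: "\<And>z. z \<in> ball 0 1 \<Longrightarrow> (w has_derivative (\<lambda>h. Re (\<Psi> z * h))) (at z)"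
    and \<Psi>: "\<And>z. z \<in> ball 0 1 \<Longrightarrow> (\<Psi> has_derivative (\<lambda>h. E z * h - of_real (f z / 2) * cnj h)) (at z)"
  shows "C2_on (ball 0 1) (\<lambda>x. w (to_complex x))"
    and "x \<in> ball 0 1 \<Longrightarrow> laplacian (\<lambda>x. w (to_complex x)) x = - f (to_complex x)"
proof -
  let ?u = "\<lambda>x. w (to_complex x)"
  have b: "to_complex x \<in> ball 0 1" if "x \<in> ball 0 1" for x using that by simp
  have d1: "dpart i ?u x = Re (\<Psi> (to_complex x) * basis_complex i)" if "x \<in> ball 0 1" for i x
    by (rule dpart_to_complex[OF w[OF b[OF that]]])
  have D\<Psi>: "((\<lambda>z. Re (\<Psi> z * basis_complex i)) has_derivative (\<lambda>h. Re ((E z * h - of_real (f z / 2) * cnj h) * basis_complex i))) (at z)"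
    if "z \<in> ball 0 1" for i z
    by (intro has_derivative_Re has_derivative_mult_left \<Psi> that)
  have d2: "dpart j (dpart i ?u) x = Re ((E (to_complex x) * basis_complex j - of_real (f (to_complex x) / 2) * cnj (basis_complex j)) * basis_complex i)"
    if "x \<in> ball 0 1" for i j x
    using dpart_cong_open[OF open_ball that, of "dpart i ?u" "\<lambda>x. Re (\<Psi> (to_complex x) * basis_complex i)" j] d1
      dpart_to_complex[OF D\<Psi>[OF b[OF that]], of j i] by simp
  have cc: "continuous_on (ball 0 1) (\<lambda>x. g (to_complex x))" if "continuous_on (ball 0 1) g" for g :: "complex \<Rightarrow> 'b::topological_space"
    using continuous_on_compose2[OF that linear_continuous_on[OF bounded_linear_to_complex]] b by blast
  show "C2_on (ball 0 1) ?u"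
    unfolding C2_on_def
  proof (intro conjI allI)
    show "?u differentiable_on ball 0 1"
      unfolding differentiable_on_def differentiable_def
      using has_derivative_to_complex[OF w[OF b]] has_derivative_at_withinI by blast
    fix i j
    have D: "(dpart i ?u has_derivative (\<lambda>h. Re ((E (to_complex x) * to_complex h - of_real (f (to_complex x) / 2) * cnj (to_complex h)) * basis_complex i))) (at x)"
      if "x \<in> ball 0 1" for x
      by (rule has_derivative_transform_within_open[OF has_derivative_to_complex[OF D\<Psi>[OF b[OF that]]] open_ball that])
        (simp add: d1)
    then show "dpart i ?u differentiable_on ball 0 1"
      unfolding differentiable_on_def differentiable_def using has_derivative_at_withinI by blast
    have "continuous_on (ball 0 1) (\<lambda>x. Re ((E (to_complex x) * basis_complex j - of_real (f (to_complex x) / 2) * cnj (basis_complex j)) * basis_complex i))"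
      by (intro continuous_intros cc E f) auto
    then show "continuous_on (ball 0 1) (dpart j (dpart i ?u))"
      by (rule continuous_on_eq) (simp add: d2)
  qed
  \<comment> \<open>In the sum of the two pure second derivatives the \<open>E\<close> terms cancel
    because 1 + \<i>^2 = 0, while the conjugate terms add up to -f.\<close>
  show "laplacian ?u x = - f (to_complex x)" if "x \<in> ball 0 1"
    unfolding laplacian_def UNIV_2 by (simp add: d2[OF that])
qed

text \<open>The weight is moved into the density, so the regularity theory is needed for the
  exponent 0 only.\<close>

lemma potential_weight_eq:
  assumes \<alpha>: "0 \<le> \<alpha>" and h: "admissible h" and x: "cmod x \<le> 1"
  shows "potential \<alpha> h x = potential 0 (\<lambda>y. indicator (ball 0 1) y * (norm y powr \<alpha> * h y)) x"
    and "admissible (\<lambda>y. indicator (ball 0 1) y * (norm y powr \<alpha> * h y))"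
proof -
  have p: "1 < (2::real)" by simp
  let ?v = "\<lambda>y. indicator (ball 0 1) y * (norm y powr \<alpha> * h y)"
  have [measurable]: "h \<in> borel_measurable borel" using h by measurable
  obtain B where B: "B \<ge> 0" "\<And>x. 0 \<le> h x" "\<And>x. h x \<le> B" using admissibleE[OF h] by blast
  show v: "admissible ?v"
  proof (rule admissibleI)
    show "?v \<in> borel_measurable borel" by measurable
    show "?v y \<le> B" for y
    proof (cases "y \<in> ball 0 1")
      case True
      then have "norm y powr \<alpha> \<le> 1" using \<alpha> powr_mono2[of \<alpha> "norm y" 1] by simp
      then show ?thesis using True B mult_mono[of "norm y powr \<alpha>" 1 "h y" B] by simp
    qed (use B in simp)
  qed (auto simp: B)
  have nn: "0 \<le> potential a g x" if "0 \<le> a" "admissible g" for a g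
    using potential_hoelder[OF that(1) p] that(2) x by blast
  have "ennreal (potential \<alpha> h x) = (\<integral>\<^sup>+y. ennreal (green x y) * ennreal (h y) \<partial>disc_measure \<alpha>)"
    by (rule nn_potential_eq[symmetric, OF \<alpha> h x])
  also have "\<dots> = (\<integral>\<^sup>+y. ennreal (norm y powr \<alpha>) * (ennreal (green x y) * ennreal (h y)) \<partial>disc_measure 0)"
    by (rule nn_integral_disc_weight) measurable
  also have "\<dots> = (\<integral>\<^sup>+y. ennreal (green x y) * ennreal (?v y) \<partial>disc_measure 0)"
    by (intro nn_integral_cong_AE eventually_mono[OF AE_disc_measure]) (simp add: ennreal_mult B mult_ac)
  also have "\<dots> = ennreal (potential 0 ?v x)" by (rule nn_potential_eq[OF _ v x]) simp
  finally show "potential \<alpha> h x = potential 0 ?v x"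
    using nn[OF \<alpha> h] nn[OF order_refl v] by simp
qed

text \<open>The bootstrap has one round: u coincides on the disc with a potential and is therefore
  Hoelder continuous, so |y|^\<alpha> u^p is Hoelder continuous, so its potential is C2. The
  solution returned is the potential, which unlike u is known to be continuous up to the circle and
  to vanish there.\<close>

theorem henon_pos_solution_of_fixed_point:
  assumes \<alpha>: "0 < \<alpha>" and p: "1 < p" and u: "admissible u" "\<not> (AE z in disc_measure \<alpha>. u z = 0)"
    and fp: "\<And>z. z \<in> ball 0 1 \<Longrightarrow> u z = potential \<alpha> (\<lambda>y. u y powr p) z"
  shows "henon_pos_solution \<alpha> p (\<lambda>x. potential \<alpha> (\<lambda>y. u y powr p) (to_complex x))"
proof -
  let ?h = "\<lambda>y. u y powr p"
  let ?w = "potential \<alpha> ?h"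
  have \<alpha>0: "0 \<le> \<alpha>" using \<alpha> by simp
  have h: "admissible ?h" using u(1) p by (intro admissible_powr) auto
  define f where "f = (\<lambda>y. indicator (ball 0 1) y * (norm y powr \<alpha> * ?h y))"
  have f: "admissible f" "\<And>x. cmod x \<le> 1 \<Longrightarrow> ?w x = potential 0 f x"
    using potential_weight_eq[OF \<alpha>0 h] norm_zero zero_le_one unfolding f_def by metis+
  obtain B where B: "B \<ge> 0" "\<And>x. 0 \<le> f x" "\<And>x. f x \<le> B" using admissibleE[OF f(1)] by blast
  obtain D where D: "D \<ge> 0" "\<And>x. 0 \<le> u x" "\<And>x. u x \<le> D" using admissibleE[OF u(1)] by blast
  obtain C0 where C0: "C0 > 0"
    "\<And>x x'. cmod x \<le> 1 \<Longrightarrow> cmod x' \<le> 1 \<Longrightarrow> \<bar>?w x - ?w x'\<bar> \<le> C0 * (1 + mass \<alpha> p ?h) * cmod (x - x') powr (1/(p+1))"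
    using potential_hoelder[OF \<alpha>0 p] h by meson
  define C where "C = C0 * (1 + mass \<alpha> p ?h)"
  have C: "0 \<le> C" "\<And>x x'. cmod x \<le> 1 \<Longrightarrow> cmod x' \<le> 1 \<Longrightarrow> \<bar>?w x - ?w x'\<bar> \<le> C * cmod (x - x') powr (1/(p+1))"
    using C0 mass_nonneg[OF \<alpha>0 p, of ?h] by (auto simp: C_def)
  obtain K \<gamma>0 where K: "0 < \<gamma>0" "\<gamma>0 \<le> 1" "0 \<le> K"
    "\<And>x y :: complex. norm x \<le> 1 \<Longrightarrow> norm y \<le> 1 \<Longrightarrow> \<bar>norm x powr \<alpha> - norm y powr \<alpha>\<bar> \<le> K * norm (x - y) powr \<gamma>0"
    using norm_powr_hoelder[OF \<alpha>] by metis
  \<comment> \<open>One exponent that serves both the weight and the potential.\<close>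
  define \<gamma> where "\<gamma> = min \<gamma>0 (1/(p+1))"
  have \<gamma>: "0 < \<gamma>" "\<gamma> \<le> 1" "\<gamma> \<le> \<gamma>0" "\<gamma> \<le> 1/(p+1)" using K p by (auto simp: \<gamma>_def min_def)
  define H where "H = 2 * K * D powr p + p * D powr (p - 1) * (2 * C)"
  have hoelder: "\<bar>f x - f y\<bar> \<le> H * cmod (x - y) powr \<gamma>" if xy: "x \<in> ball 0 1" "y \<in> ball 0 1" for x y
  proof -
    have d2: "cmod (x - y) \<le> 2" using norm_triangle_ineq4[of x y] xy by simp
    have wx: "\<bar>norm x powr \<alpha> - norm y powr \<alpha>\<bar> \<le> K * (2 * cmod (x - y) powr \<gamma>)"
      using K(4)[of x y] xy mult_left_mono[OF powr_le_twice_powr[of "cmod (x - y)" \<gamma> \<gamma>0] K(3)] d2 \<gamma> K by fastforce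
    have "\<bar>u x - u y\<bar> \<le> C * cmod (x - y) powr (1/(p+1))" using C(2)[of x y] xy by (simp add: fp)
    also have "\<dots> \<le> C * (2 * cmod (x - y) powr \<gamma>)" using d2 \<gamma> p C(1) by (intro mult_left_mono powr_le_twice_powr) auto
    finally have ux: "\<bar>u x - u y\<bar> \<le> C * (2 * cmod (x - y) powr \<gamma>)" .
    have hx: "\<bar>?h x - ?h y\<bar> \<le> p * D powr (p - 1) * (C * (2 * cmod (x - y) powr \<gamma>))"
    proof -
      have "\<bar>?h x - ?h y\<bar> \<le> p * D powr (p - 1) * \<bar>u x - u y\<bar>" using D p by (intro powr_diff_lipschitz) auto
      also have "\<dots> \<le> p * D powr (p - 1) * (C * (2 * cmod (x - y) powr \<gamma>))" using ux p by (intro mult_left_mono) auto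
      finally show ?thesis .
    qed
    have ny: "norm y powr \<alpha> \<le> 1" using xy \<alpha> powr_mono2[of \<alpha> "norm y" 1] by simp
    have hD: "?h x \<le> D powr p" using D p by (intro powr_mono2) auto
    have "f x - f y = (norm x powr \<alpha> - norm y powr \<alpha>) * ?h x + norm y powr \<alpha> * (?h x - ?h y)"
      using xy by (simp add: f_def algebra_simps)
    then have "\<bar>f x - f y\<bar> \<le> \<bar>norm x powr \<alpha> - norm y powr \<alpha>\<bar> * ?h x + norm y powr \<alpha> * \<bar>?h x - ?h y\<bar>"
      using abs_triangle_ineq[of "(norm x powr \<alpha> - norm y powr \<alpha>) * ?h x" "norm y powr \<alpha> * (?h x - ?h y)"] by (simp add: abs_mult)
    also have "\<dots> \<le> (K * (2 * cmod (x - y) powr \<gamma>)) * D powr p + 1 * (p * D powr (p - 1) * (C * (2 * cmod (x - y) powr \<gamma>)))"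
      using K(3) p by (intro add_mono mult_mono wx hx ny hD) auto
    also have "\<dots> = H * cmod (x - y) powr \<gamma>" by (simp add: H_def algebra_simps)
    finally show ?thesis .
  qed
  have fm: "f \<in> borel_measurable borel" using f(1) by measurable
  have fB: "\<bar>f y\<bar> \<le> B" for y using B by simp
  have "\<exists>\<Psi> E. continuous_on (ball 0 1) E \<and>
      (\<forall>x\<in>ball 0 1. (potential 0 f has_derivative (\<lambda>h. Re (\<Psi> x * h))) (at x)) \<and>
      (\<forall>x\<in>ball 0 1. (\<Psi> has_derivative (\<lambda>h. E x * h - of_real (f x / 2) * cnj h)) (at x))"
    by (rule potential_regularity[OF fm fB \<gamma>(1,2) hoelder]) blast+
  then obtain \<Psi> E where \<Psi>: "continuous_on (ball 0 1) E"
    "\<And>x. x \<in> ball 0 1 \<Longrightarrow> (potential 0 f has_derivative (\<lambda>h. Re (\<Psi> x * h))) (at x)"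
    "\<And>x. x \<in> ball 0 1 \<Longrightarrow> (\<Psi> has_derivative (\<lambda>h. E x * h - of_real (f x / 2) * cnj h)) (at x)"
    by blast
  have wd: "(?w has_derivative (\<lambda>h. Re (\<Psi> x * h))) (at x)" if "x \<in> ball 0 1" for x
    by (rule has_derivative_transform_within_open[OF \<Psi>(2)[OF that] open_ball that]) (simp add: f)
  have wc: "continuous_on (cball 0 1) ?w"
    unfolding continuous_on_sequentially
  proof (intro allI ballI impI, elim conjE)
    fix X :: "nat \<Rightarrow> complex" and a :: complex assume a: "a \<in> cball 0 1" and X: "\<forall>n. X n \<in> cball 0 1" and lim: "X \<longlonglongrightarrow> a"
    show "(?w \<circ> X) \<longlonglongrightarrow> ?w a"
    proof (rule LIM_zero_cancel, rule tendsto_rabs_zero_cancel, rule tendsto_sandwich[OF _ _ tendsto_const])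
      show "\<forall>\<^sub>F n in sequentially. \<bar>(?w \<circ> X) n - ?w a\<bar> \<le> C * cmod (X n - a) powr (1/(p+1))"
        using X a C(2) by (intro always_eventually) simp
      have "(\<lambda>n. C * cmod (X n - a) powr (1/(p+1))) \<longlonglongrightarrow> C * cmod (a - a) powr (1/(p+1))"
        using p by (intro tendsto_intros lim) auto
      then show "(\<lambda>n. C * cmod (X n - a) powr (1/(p+1))) \<longlonglongrightarrow> 0" by simp
    qed simp
  qed
  have fc: "continuous_on (ball 0 1) f"
  proof -
    have "continuous_on (ball 0 1) u"
      using continuous_on_subset[OF wc ball_subset_cball] by (rule continuous_on_eq) (simp add: fp)
    then have "continuous_on (ball 0 1) (\<lambda>y. norm y powr \<alpha> * ?h y)"
      using \<alpha> p D by (intro continuous_intros continuous_on_powr') auto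
    then show ?thesis by (rule continuous_on_eq) (simp add: f_def)
  qed
  have lap: "laplacian (\<lambda>x. ?w (to_complex x)) x = - f (to_complex x)" if "x \<in> ball 0 1" for x
    using that by (intro C2_on_to_complex(2)[OF \<Psi>(1) fc wd \<Psi>(3)])
  have pos: "0 < ?w z" if "z \<in> ball 0 1" for z
    using that u(2) by (intro potential_pos[OF \<alpha>0 p h]) (auto elim!: eventually_mono)
  show ?thesis
    unfolding henon_pos_solution_def
  proof (intro conjI ballI)
    show "C2_on (ball 0 1) (\<lambda>x. ?w (to_complex x))"
      by (rule C2_on_to_complex(1)[OF \<Psi>(1) fc wd \<Psi>(3)])
    show "continuous_on (cball 0 1) (\<lambda>x. ?w (to_complex x))"
      by (rule continuous_on_compose2[OF wc linear_continuous_on[OF bounded_linear_to_complex]]) auto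
    show "?w (to_complex x) = 0" if "x \<in> sphere 0 1" for x
      using that by (simp add: potential_def green_boundary)
    show "0 < ?w (to_complex x)" if "x \<in> ball 0 1" for x using that by (intro pos) simp
    fix x :: "real^2" assume x: "x \<in> ball 0 1"
    let ?z = "to_complex x"
    have z: "?z \<in> ball 0 1" using x by simp
    have "- laplacian (\<lambda>x. ?w (to_complex x)) x = f ?z" using lap[OF x] by simp
    also have "\<dots> = norm x powr \<alpha> * ?w ?z powr p" using z x by (simp add: f_def fp[symmetric])
    also have "?w ?z powr p = \<bar>?w ?z\<bar> powr (p - 1) * ?w ?z" using pos[OF z] by (simp add: powr_diff)
    finally show "- laplacian (\<lambda>x. ?w (to_complex x)) x = norm x powr \<alpha> * \<bar>?w ?z\<bar> powr (p - 1) * ?w ?z" by (simp add: mult.assoc)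
  qed
qed

section \<open>Solutions from coverings\<close>

text \<open>The covering \<open>z \<mapsto> z ^ n\<close> turns ground states with weight \<open>b = (\<alpha> + 2) / n - 2\<close> into
  solutions with weight \<open>\<alpha>\<close> that are invariant under rotation by \<open>2 * pi / n\<close>.\<close>

lemma henon_covering_solution:
  assumes \<alpha>: "0 < \<alpha>" and p: "1 < p" and n: "0 < (n::nat)" and b: "b = (\<alpha> + 2) / real n - 2" "0 \<le> b"
  obtains w where "henon_pos_solution \<alpha> p (\<lambda>x. w (to_complex x))" "w \<in> borel_measurable borel"
    "(\<integral>\<^sup>+z. ennreal (w z powr (p+1)) \<partial>disc_measure \<alpha>) =
      ennreal (real n powr ((p+3)/(p-1)) * max_energy b p powr (-(p+1)/(p-1)))"
    "\<And>g k. (\<And>z. z \<in> ball 0 1 \<Longrightarrow> w z = g (cmod z)) \<Longrightarrow> 0 < b \<Longrightarrow> 0 < (k::nat) \<Longrightarrow> 2 / b \<le> real k \<Longrightarrow>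
      max_energy b p \<le> (real k / real (k + 1)) powr (1 + 2 / (p + 1)) * max_energy 0 p"
proof -
  have \<alpha>0: "0 \<le> \<alpha>" using \<alpha> by simp
  have M: "0 < max_energy b p" by (rule max_energy_pos[OF b(2) p])
  obtain U where U: "admissible U" "(\<integral>x. U x powr (p+1) \<partial>disc_measure b) = max_energy b p powr (-(p+1)/(p-1))"
    "\<And>x. x \<in> ball 0 1 \<Longrightarrow> U x = potential b (\<lambda>y. U y powr p) x"
    using ground_state_exists[OF b(2) p] by metis
  define I where "I = max_energy b p powr (-(p+1)/(p-1))"
  have I: "0 < I" using M by (simp add: I_def)
  have [measurable]: "U \<in> borel_measurable borel" using U(1) by measurable
  obtain B where B: "B \<ge> 0" "\<And>x. 0 \<le> U x" "\<And>x. U x \<le> B" using admissibleE[OF U(1)] by blast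
  have Up: "admissible (\<lambda>x. U x powr p)" "admissible (\<lambda>x. U x powr (p+1))"
    using U(1) p by (auto intro!: admissible_powr)
  \<comment> \<open>Solves s^(p-1) = n^2, which compensates the factor 1/n^2 from
    \<open>nn_green_power\<close>.\<close>
  define s where "s = real n powr (2 / (p - 1))"
  have s: "0 < s" using n by (simp add: s_def)
  have sp: "s powr p = s * (real n)\<^sup>2"
  proof -
    have "2 / (p - 1) * p = 2 / (p - 1) + 2" using p by (simp add: field_simps)
    then show ?thesis using n by (simp add: s_def powr_powr powr_add)
  qed
  define u where "u = (\<lambda>z. s * U (z ^ n))"
  have u: "admissible u"
    unfolding u_def by (rule admissibleI[where B="s * B"]) (use s B in \<open>auto intro: mult_left_mono\<close>)
  have up: "u z powr q = s powr q * U (z ^ n) powr q" for z q using s B by (simp add: u_def powr_mult)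
  have uh: "admissible (\<lambda>z. u z powr p)" using u p by (intro admissible_powr) auto
  have fp: "u z = potential \<alpha> (\<lambda>y. u y powr p) z" if z: "z \<in> ball 0 1" for z
  proof -
    have zn: "z ^ n \<in> ball 0 1" using z n by (auto simp: norm_power power_less_one_iff)
    have nn: "0 \<le> potential \<alpha> (\<lambda>y. u y powr p) z"
      using potential_hoelder[OF \<alpha>0 p] uh z by (metis less_imp_le mem_ball_0)
    have "ennreal (potential \<alpha> (\<lambda>y. u y powr p) z) = (\<integral>\<^sup>+y. ennreal (green z y) * ennreal (u y powr p) \<partial>disc_measure \<alpha>)"
      using z by (intro nn_potential_eq[symmetric, OF \<alpha>0 uh]) simp
    also have "\<dots> = (\<integral>\<^sup>+y. ennreal (green z y) * (\<lambda>x. ennreal (s powr p * U x powr p)) (y ^ n) \<partial>disc_measure \<alpha>)"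
      by (simp add: up)
    also have "\<dots> = ennreal (1 / (real n)\<^sup>2) * (\<integral>\<^sup>+x. ennreal (green (z ^ n) x) * ennreal (s powr p * U x powr p) \<partial>disc_measure b)"
      unfolding b(1) using z by (intro nn_green_power n) (simp_all)
    also have "(\<integral>\<^sup>+x. ennreal (green (z ^ n) x) * ennreal (s powr p * U x powr p) \<partial>disc_measure b) = ennreal (potential b (\<lambda>x. s powr p * U x powr p) (z ^ n))"
      using zn by (intro nn_potential_eq[OF b(2)] admissible_scale Up) auto
    also have "potential b (\<lambda>x. s powr p * U x powr p) (z ^ n) = s powr p * U (z ^ n)"
      unfolding potential_scale[OF b(2) p] using U(3)[OF zn] by simp
    also have "ennreal (1 / (real n)\<^sup>2) * ennreal (s powr p * U (z ^ n)) = ennreal (u z)"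
      using n s B by (subst ennreal_mult[symmetric]) (auto simp: sp u_def)
    finally show ?thesis using nn admissible_nonneg[OF u] by simp
  qed
  have mU: "(\<integral>\<^sup>+x. ennreal (U x powr (p+1)) \<partial>disc_measure b) = ennreal I"
    unfolding I_def U(2)[symmetric]
    by (intro nn_integral_eq_integral integrable_admissible[OF b(2) p] Up) auto
  have mu: "(\<integral>\<^sup>+z. ennreal (u z powr (p+1)) \<partial>disc_measure \<alpha>) = ennreal (real n powr ((p+3)/(p-1)) * I)"
  proof -
    have "(\<integral>\<^sup>+z. ennreal (u z powr (p+1)) \<partial>disc_measure \<alpha>) = (\<integral>\<^sup>+z. (\<lambda>x. ennreal (s powr (p+1)) * ennreal (U x powr (p+1))) (z ^ n) \<partial>disc_measure \<alpha>)"
      by (simp add: up ennreal_mult)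
    also have "\<dots> = ennreal (1 / real n) * (\<integral>\<^sup>+x. ennreal (s powr (p+1)) * ennreal (U x powr (p+1)) \<partial>disc_measure b)"
      unfolding b(1) by (intro nn_integral_disc_power n) measurable
    also have "(\<integral>\<^sup>+x. ennreal (s powr (p+1)) * ennreal (U x powr (p+1)) \<partial>disc_measure b) = ennreal (s powr (p+1)) * ennreal I"
      unfolding mU[symmetric] by (rule nn_integral_cmult) measurable
    also have "ennreal (1 / real n) * (ennreal (s powr (p+1)) * ennreal I) = ennreal (1 / real n * s powr (p+1) * I)"
      using I by (simp add: ennreal_mult[symmetric] mult.assoc)
    also have "1 / real n * s powr (p+1) = real n powr ((p+3)/(p-1))"
    proof -
      have "1 / real n = real n powr (-1)" using n by (simp add: powr_minus_divide)
      moreover have "-1 + 2 / (p - 1) * (p + 1) = (p+3)/(p-1)" using p by (simp add: field_simps)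
      ultimately show ?thesis by (simp only: s_def powr_powr powr_add[symmetric])
    qed
    finally show ?thesis .
  qed
  have nz: "\<not> (AE z in disc_measure \<alpha>. u z = 0)"
  proof
    assume "AE z in disc_measure \<alpha>. u z = 0"
    then have "AE z in disc_measure \<alpha>. ennreal (u z powr (p+1)) = 0" by eventually_elim simp
    then have "(\<integral>\<^sup>+z. ennreal (u z powr (p+1)) \<partial>disc_measure \<alpha>) = 0"
      by (subst nn_integral_0_iff_AE) (use u in measurable)
    then show False unfolding mu using n I by simp
  qed
  define w where "w = potential \<alpha> (\<lambda>y. u y powr p)"
  have wu: "w z = u z" if "z \<in> ball 0 1" for z using fp[OF that] by (simp add: w_def)
  show ?thesis
  proof (rule that)
    show "henon_pos_solution \<alpha> p (\<lambda>x. w (to_complex x))"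
      unfolding w_def by (rule henon_pos_solution_of_fixed_point[OF \<alpha> p u nz fp])
    show "w \<in> borel_measurable borel" unfolding w_def by (rule measurable_potential[OF \<alpha>0 p admissible_bdd[OF uh]])
    have "(\<integral>\<^sup>+z. ennreal (w z powr (p+1)) \<partial>disc_measure \<alpha>) = (\<integral>\<^sup>+z. ennreal (u z powr (p+1)) \<partial>disc_measure \<alpha>)"
      by (intro nn_integral_cong_AE eventually_mono[OF AE_disc_measure]) (simp add: wu)
    then show "(\<integral>\<^sup>+z. ennreal (w z powr (p+1)) \<partial>disc_measure \<alpha>) =
        ennreal (real n powr ((p+3)/(p-1)) * max_energy b p powr (-(p+1)/(p-1)))"
      using mu by (simp add: I_def)
    fix g and k :: nat
    assume rad: "\<And>z. z \<in> ball 0 1 \<Longrightarrow> w z = g (cmod z)" and b0: "0 < b" and k: "0 < k" "2 / b \<le> real k"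
    \<comment> \<open>Every point has an n-th root, so radial symmetry of w = s U (z^n) descends to
      the ground state U.\<close>
    have Ur: "U x = g (root n (cmod x)) / s" if x: "x \<in> ball 0 1" for x
    proof -
      obtain z where z: "x = z ^ n" using exists_complex_root[of n x] n by auto
      have rz: "root n (cmod x) = cmod z" using n by (simp add: z norm_power real_root_power_cancel)
      have "cmod z < 1" using x n by (simp add: z norm_power power_less_one_iff)
      then have "s * U x = g (cmod z)" using rad[of z] wu[of z] by (simp add: u_def z)
      then show ?thesis using s by (simp add: rz field_simps)
    qed
    have pq: "p * (1 + 1/p) = p + 1" using p by (simp add: field_simps)
    \<comment> \<open>Scales U^p to unit mass. The resulting h is a maximizer, as the computation
      from the equation for U confirms, so the bound on radial competitors becomes a bound on the
      maximum itself.\<close>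
    define c where "c = I powr (- 1 / (1 + 1/p))"
    have c: "0 < c" using I by (simp add: c_def)
    define h where "h = (\<lambda>x. c * U x powr p)"
    have h: "admissible h" unfolding h_def using c by (intro admissible_scale Up) auto
    have "mass b p h = c powr (1 + 1/p) * mass b p (\<lambda>x. U x powr p)"
      unfolding h_def using c by (intro mass_scale Up) auto
    also have "mass b p (\<lambda>x. U x powr p) = I" unfolding mass_def powr_powr pq U(2) I_def ..
    also have "c powr (1 + 1/p) = 1 / I"
    proof -
      have "- 1 / (1 + 1/p) * (1 + 1/p) = -1" using exponent_pos[OF b(2) p] by simp
      then show ?thesis using I by (simp only: c_def powr_powr) (simp add: powr_minus_divide)
    qed
    finally have mh: "mass b p h \<le> 1" using I by simp
    have "energy b (\<lambda>x. U x powr p) (\<lambda>x. U x powr p) = (\<integral>x. U x powr (p+1) \<partial>disc_measure b)"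
      unfolding energy_def
    proof (rule integral_cong_AE)
      have [measurable]: "potential b (\<lambda>x. U x powr p) \<in> borel_measurable borel" by (rule measurable_potential[OF b(2) p admissible_bdd[OF Up(1)]])
      show "(\<lambda>x. U x powr p * potential b (\<lambda>x. U x powr p) x) \<in> borel_measurable (disc_measure b)" by measurable
      show "AE x in disc_measure b. U x powr p * potential b (\<lambda>x. U x powr p) x = U x powr (p+1)"
        using AE_disc_measure
      proof eventually_elim
        case (elim x)
        then have "U x powr p * potential b (\<lambda>x. U x powr p) x = U x powr p * U x" using U(3) by simp
        also have "\<dots> = U x powr (p+1)" using B(2)[of x] by (cases "U x = 0") (simp_all add: powr_add)
        finally show ?case .
      qed
    qed measurable
    then have "energy b h h = c\<^sup>2 * I" by (simp add: h_def energy_scale[OF b(2)] U(2) I_def)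
    also have "\<dots> = max_energy b p"
    proof -
      have e: "c\<^sup>2 = I powr (- 2 / (1 + 1/p))" using I by (simp add: c_def power2_eq_square powr_add[symmetric])
      have x: "-(p+1)/(p-1) * (- 2 / (1 + 1/p) + 1) = 1"
      proof -
        have e1: "- 2 / (1 + 1/p) + 1 = -(p - 1) / (p + 1)" using p by (simp add: field_simps)
        have "(- s / t) * (- t / s) = 1" if "s \<noteq> 0" "t \<noteq> 0" for s t :: real using that by simp
        from this[of "p + 1" "p - 1"] show ?thesis unfolding e1 using p by simp
      qed
      have "I powr t * I = I powr (t + 1)" for t using I by (simp add: powr_add)
      then have "c\<^sup>2 * I = I powr (- 2 / (1 + 1/p) + 1)" unfolding e .
      also have "\<dots> = max_energy b p powr 1" unfolding I_def powr_powr x ..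
      finally show ?thesis using M by simp
    qed
    finally have "energy b h h = max_energy b p" .
    moreover have "energy b h h \<le> (real k / real (k + 1)) powr (1 + 2 / (p + 1)) * max_energy 0 p"
      by (rule radial_energy_le[OF b0 p k h mh, where g="\<lambda>t. c * (g (root n t) / s) powr p"]) (simp add: h_def Ur)
    ultimately show "max_energy b p \<le> (real k / real (k + 1)) powr (1 + 2 / (p + 1)) * max_energy 0 p" by simp
  qed
qed

text \<open>Both exclusion arguments end in an inequality of this kind, and p > ln L / ln R says L <
  R^p.\<close>

lemma powr_root_bound_contradiction:
  fixes L R :: real
  assumes p: "1 < p" and R: "1 < R" and L: "0 < L" and big: "ln L / ln R < p" and le: "R powr (p+1) \<le> L"
  shows False
proof -
  have "ln L < p * ln R" using big R by (simp add: divide_less_eq)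
  also have "\<dots> \<le> (p + 1) * ln R" using R by (intro mult_right_mono) auto
  also have "\<dots> = ln (R powr (p+1))" using R by (simp add: ln_powr)
  also have "\<dots> \<le> ln L" using le R L by (subst ln_le_cancel_iff) auto
  finally show False by simp
qed

theorem theorem1p5:
  fixes \<alpha> :: real
  assumes "\<alpha> > 0"
  shows "\<exists>pstar::real. \<forall>p > pstar. \<exists>S :: (real^2 \<Rightarrow> real) set.
           finite S \<and> card S \<ge> nat \<lceil>\<alpha> / 2\<rceil> \<and>
           (\<forall>u\<in>S. henon_pos_solution \<alpha> p u \<and> \<not> radial_on (ball 0 1) u) \<and>
           (\<forall>u\<in>S. \<forall>v\<in>S. u \<noteq> v \<longrightarrow> \<not> rot_equiv u v)"
proof -
  define N where "N = nat \<lceil>\<alpha> / 2\<rceil>"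
  have N: "0 < N" "real N < \<alpha> / 2 + 1" using assms unfolding N_def by linarith+
  define \<beta> where "\<beta> = (\<lambda>n::nat. (\<alpha> + 2) / real n - 2)"
  \<comment> \<open>This is where the ceiling enters: N < \<alpha>/2 + 1 is the same as \<beta> N >
    0, and \<beta> decreases in n.\<close>
  have \<beta>N: "0 < \<beta> N" using N by (simp add: \<beta>_def less_divide_eq)
  have \<beta>: "0 < \<beta> n" "\<beta> n \<le> \<alpha>" "\<beta> N \<le> \<beta> n" if "n \<in> {1..N}" for n
  proof -
    show 1: "\<beta> N \<le> \<beta> n" using that assms by (auto simp: \<beta>_def intro!: divide_left_mono mult_pos_pos)
    show "0 < \<beta> n" using 1 \<beta>N by simp
    have "(\<alpha> + 2) / real n \<le> (\<alpha> + 2) / 1" using that assms by (intro divide_left_mono) auto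
    then show "\<beta> n \<le> \<alpha>" by (simp add: \<beta>_def)
  qed
  \<comment> \<open>One integer with two duties: k >= 2 / \<beta> N lets
    \<open>radial_energy_le\<close> apply to every n, and k >= N gives m / n >= 1 + 1/k whenever n <
    m <= N.\<close>
  define k where "k = max N (nat \<lceil>2 / \<beta> N\<rceil>)"
  have k: "0 < k" "N \<le> k" "2 / \<beta> N \<le> real k" using N unfolding k_def by (auto simp: le_max_iff_disj) linarith
  define R where "R = real (k + 1) / real k"
  have R: "1 < R" using k by (simp add: R_def)
  \<comment> \<open>The constant of \<open>max_energy_ge_subdisc\<close> at b = \<alpha>; since
    \<beta> n <= \<alpha> it serves all n.\<close>
  define L where "L = 256 * 2 powr (2 * \<alpha>)"
  have L: "0 < L" by (simp add: L_def)
  show ?thesis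
  proof (intro exI[of _ "max 1 (ln L / ln R)"] allI impI)
    fix p assume "max 1 (ln L / ln R) < p"
    then have p: "1 < p" "ln L / ln R < p" by auto
    have M0: "0 < max_energy 0 p" by (rule max_energy_pos[OF order_refl p(1)])
    have lower: "max_energy 0 p powr (p+1) \<le> L * max_energy (\<beta> n) p powr (p+1)" if n: "n \<in> {1..N}" for n
    proof -
      have b0: "0 \<le> \<beta> n" using \<beta>[OF n] by simp
      have Mb: "0 < max_energy (\<beta> n) p" by (rule max_energy_pos[OF b0 p(1)])
      have "max_energy 0 p powr (p+1) \<le> ((256 * 2 powr (2 * \<beta> n)) powr (1 / (p + 1)) * max_energy (\<beta> n) p) powr (p+1)"
        using M0 p max_energy_ge_subdisc[OF b0 p(1)] by (intro powr_mono2) auto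
      also have "\<dots> = (256 * 2 powr (2 * \<beta> n)) * max_energy (\<beta> n) p powr (p+1)"
        using Mb p by (simp add: powr_mult powr_powr)
      also have "\<dots> \<le> L * max_energy (\<beta> n) p powr (p+1)"
        unfolding L_def using \<beta>[OF n] by (intro mult_right_mono mult_left_mono powr_mono) auto
      finally show ?thesis .
    qed
    have "\<exists>w. henon_pos_solution \<alpha> p (\<lambda>x. w (to_complex x)) \<and> w \<in> borel_measurable borel \<and>
      (\<integral>\<^sup>+z. ennreal (w z powr (p+1)) \<partial>disc_measure \<alpha>) =
        ennreal (real n powr ((p+3)/(p-1)) * max_energy (\<beta> n) p powr (-(p+1)/(p-1))) \<and>
      (\<forall>g. (\<forall>z\<in>ball 0 1. w z = g (cmod z)) \<longrightarrow>
        max_energy (\<beta> n) p \<le> (real k / real (k + 1)) powr (1 + 2 / (p + 1)) * max_energy 0 p)" if n: "n \<in> {1..N}" for n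
    proof -
      have n0: "0 < n" and b0: "0 \<le> \<beta> n" using n \<beta>[OF n] by auto
      have "2 / \<beta> n \<le> 2 / \<beta> N" using \<beta>[OF n] \<beta>N by (intro divide_left_mono) auto
      then have k2: "2 / \<beta> n \<le> real k" using k by simp
      have \<beta>n: "\<beta> n = (\<alpha> + 2) / real n - 2" by (simp add: \<beta>_def)
      show ?thesis
      proof (rule henon_covering_solution[OF assms p(1) n0 \<beta>n b0])
        fix w :: "complex \<Rightarrow> real"
        assume w: "henon_pos_solution \<alpha> p (\<lambda>x. w (to_complex x))" "w \<in> borel_measurable borel"
          "(\<integral>\<^sup>+z. ennreal (w z powr (p+1)) \<partial>disc_measure \<alpha>) =
            ennreal (real n powr ((p+3)/(p-1)) * max_energy (\<beta> n) p powr (-(p+1)/(p-1)))"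
          "\<And>g k. (\<And>z. z \<in> ball 0 1 \<Longrightarrow> w z = g (cmod z)) \<Longrightarrow> 0 < \<beta> n \<Longrightarrow> 0 < (k::nat) \<Longrightarrow> 2 / \<beta> n \<le> real k \<Longrightarrow>
            max_energy (\<beta> n) p \<le> (real k / real (k + 1)) powr (1 + 2 / (p + 1)) * max_energy 0 p"
        show ?thesis using w(1-3) w(4)[OF _ \<beta>(1)[OF n] k(1) k2] by (intro exI[of _ w] conjI allI impI) auto
      qed
    qed
    then obtain w where w: "\<And>n. n \<in> {1..N} \<Longrightarrow> henon_pos_solution \<alpha> p (\<lambda>x. w n (to_complex x))"
      "\<And>n. n \<in> {1..N} \<Longrightarrow> w n \<in> borel_measurable borel"
      "\<And>n. n \<in> {1..N} \<Longrightarrow> (\<integral>\<^sup>+z. ennreal (w n z powr (p+1)) \<partial>disc_measure \<alpha>) =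
        ennreal (real n powr ((p+3)/(p-1)) * max_energy (\<beta> n) p powr (-(p+1)/(p-1)))"
      "\<And>n g. n \<in> {1..N} \<Longrightarrow> \<forall>z\<in>ball 0 1. w n z = g (cmod z) \<Longrightarrow>
        max_energy (\<beta> n) p \<le> (real k / real (k + 1)) powr (1 + 2 / (p + 1)) * max_energy 0 p"
      by metis
    define v where "v = (\<lambda>n x. w n (to_complex x))"
    have nonradial: "\<not> radial_on (ball 0 1) (v n)" if n: "n \<in> {1..N}" for n
    proof
      assume "radial_on (ball 0 1) (v n)"
      then obtain g where g: "\<And>x. x \<in> ball 0 1 \<Longrightarrow> w n (to_complex x) = g (norm x)"
        by (auto simp: radial_on_def v_def)
      have "\<forall>z\<in>ball 0 1. w n z = g (cmod z)"
      proof
        fix z :: complex assume z: "z \<in> ball 0 1"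
        obtain x where x: "to_complex x = z" using surj_to_complex by blast
        then have "norm x = cmod z" using norm_to_complex[of x] by simp
        then show "w n z = g (cmod z)" using g[of x] z x by simp
      qed
      from w(4)[OF n this] have "max_energy (\<beta> n) p powr (p+1) \<le> ((1 / R) powr (1 + 2 / (p + 1)) * max_energy 0 p) powr (p+1)"
        using max_energy_pos[OF less_imp_le[OF \<beta>(1)[OF n]] p(1)] p by (intro powr_mono2) (auto simp: R_def)
      also have "\<dots> = (1 / R) powr (p + 3) * max_energy 0 p powr (p+1)"
      proof -
        have "(1 + 2 / (p + 1)) * (p + 1) = p + 3" using p by (simp add: field_simps)
        then show ?thesis using R M0 by (simp only: powr_mult powr_powr)
      qed
      finally have "max_energy (\<beta> n) p powr (p+1) \<le> (1 / R) powr (p + 3) * max_energy 0 p powr (p+1)" .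
      then have "max_energy 0 p powr (p+1) \<le> L * ((1 / R) powr (p + 3) * max_energy 0 p powr (p+1))"
        using lower[OF n] L by (meson mult_left_mono order_trans less_imp_le)
      then have "1 \<le> L * (1 / R) powr (p + 3)" using M0 by (simp add: mult.assoc[symmetric])
      then have "R powr (p + 3) \<le> L" using R by (simp add: powr_divide field_simps)
      moreover have "R powr (p + 1) \<le> R powr (p + 3)" using R by (intro powr_mono) auto
      ultimately show False using powr_root_bound_contradiction[OF p(1) R L p(2)] by linarith
    qed
    have distinct: "\<not> rot_equiv (v n) (v m) \<and> \<not> rot_equiv (v m) (v n)" if nm: "n \<in> {1..N}" "m \<in> {1..N}" "n < m" for n m
    proof -
      \<comment> \<open>The indices i and j run through both orders, which settles the two
        directions of \<open>rot_equiv\<close> with one argument.\<close>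
      have "False" if ij: "i \<in> {1..N}" "j \<in> {1..N}" "i = n \<and> j = m \<or> i = m \<and> j = n" and eq: "rot_equiv (v i) (v j)" for i j
      proof -
        obtain \<theta> where th: "\<And>x. x \<in> cball 0 1 \<Longrightarrow> w i (to_complex (rot \<theta> x)) = w j (to_complex x)"
          using eq unfolding rot_equiv_def v_def by blast
        have wij: "w i (cis \<theta> * z) = w j z" if z: "z \<in> ball 0 1" for z
        proof -
          obtain x where x: "to_complex x = z" using surj_to_complex by blast
          then have "norm x = cmod z" using norm_to_complex[of x] by simp
          then show ?thesis using th[of x] z x by (simp add: to_complex_rot)
        qed
        have "(\<integral>\<^sup>+z. ennreal (w j z powr (p+1)) \<partial>disc_measure \<alpha>) = (\<integral>\<^sup>+z. ennreal (w i (cis \<theta> * z) powr (p+1)) \<partial>disc_measure \<alpha>)"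
          by (intro nn_integral_cong_AE eventually_mono[OF AE_disc_measure]) (simp add: wij)
        also have "\<dots> = (\<integral>\<^sup>+z. ennreal (w i z powr (p+1)) \<partial>disc_measure \<alpha>)"
          using w(2)[OF ij(1)] by (intro nn_integral_disc_rotate[of "\<lambda>z. ennreal (w i z powr (p+1))"]) auto
        finally have "ennreal (real j powr ((p+3)/(p-1)) * max_energy (\<beta> j) p powr (-(p+1)/(p-1))) =
            ennreal (real i powr ((p+3)/(p-1)) * max_energy (\<beta> i) p powr (-(p+1)/(p-1)))"
          unfolding w(3)[OF ij(1)] w(3)[OF ij(2)] .
        then have "real j powr ((p+3)/(p-1)) * max_energy (\<beta> j) p powr (-(p+1)/(p-1)) =
            real i powr ((p+3)/(p-1)) * max_energy (\<beta> i) p powr (-(p+1)/(p-1))"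
          by (subst (asm) ennreal_inj) auto
        then have J: "real m powr ((p+3)/(p-1)) * max_energy (\<beta> m) p powr (-(p+1)/(p-1)) =
            real n powr ((p+3)/(p-1)) * max_energy (\<beta> n) p powr (-(p+1)/(p-1))"
          using ij(3) by auto
        have Mn: "0 < max_energy (\<beta> n) p" and Mm: "0 < max_energy (\<beta> m) p"
          using \<beta>(1)[OF nm(1)] \<beta>(1)[OF nm(2)] p by (auto intro!: max_energy_pos)
        have n0: "0 < real n" and m0: "0 < real m" using nm by auto
        \<comment> \<open>Raising to the power p - 1 clears the common denominator of the exponents
          and brings the comparison to (p+1)-th powers of the maximal energies.\<close>
        have pw: "(t powr (c / (p-1))) powr (p-1) = t powr c" for t c using p by (simp add: powr_powr)
        have "(real m powr ((p+3)/(p-1)) * max_energy (\<beta> m) p powr (-(p+1)/(p-1))) powr (p-1) =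
            (real n powr ((p+3)/(p-1)) * max_energy (\<beta> n) p powr (-(p+1)/(p-1))) powr (p-1)" unfolding J ..
        then have "real m powr (p+3) * max_energy (\<beta> m) p powr (-(p+1)) = real n powr (p+3) * max_energy (\<beta> n) p powr (-(p+1))"
          by (simp only: powr_mult pw)
        then have e: "real m powr (p+3) * max_energy (\<beta> n) p powr (p+1) = real n powr (p+3) * max_energy (\<beta> m) p powr (p+1)"
          using Mn Mm unfolding powr_minus_divide by (simp add: field_simps)
        have "max_energy (\<beta> m) p powr (p+1) \<le> max_energy 0 p powr (p+1)"
          using \<beta>(1)[OF nm(2)] p Mm by (intro powr_mono2 max_energy_le_zero_weight) auto
        also have "\<dots> \<le> L * max_energy (\<beta> n) p powr (p+1)" by (rule lower[OF nm(1)])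
        finally have "real m powr (p+3) * max_energy (\<beta> n) p powr (p+1) \<le> real n powr (p+3) * (L * max_energy (\<beta> n) p powr (p+1))"
          unfolding e by (rule mult_left_mono) simp
        then have "real m powr (p+3) \<le> real n powr (p+3) * L" using Mn by (simp add: mult.assoc[symmetric])
        then have "(real m / real n) powr (p+3) \<le> L" using n0 m0 by (simp add: powr_divide field_simps)
        moreover have "R \<le> real m / real n"
        proof -
          have "real n \<le> real k" using nm k by auto
          then have "1 / real k \<le> 1 / real n" using n0 by (intro divide_left_mono) auto
          moreover have "R = 1 + 1 / real k" using k by (simp add: R_def field_simps)
          moreover have "(real n + 1) / real n \<le> real m / real n" using nm by (intro divide_right_mono) auto
          then have "1 + 1 / real n \<le> real m / real n" using n0 by (simp add: add_divide_distrib)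
          ultimately show ?thesis by linarith
        qed
        then have "R powr (p+3) \<le> (real m / real n) powr (p+3)" using R p by (intro powr_mono2) auto
        moreover have "R powr (p + 1) \<le> R powr (p + 3)" using R by (intro powr_mono) auto
        ultimately show False using powr_root_bound_contradiction[OF p(1) R L p(2)] by linarith
      qed
      then show ?thesis using nm by blast
    qed
    \<comment> \<open>With reflexivity, inequivalence under rotation also implies that the functions
      are different, so the set has exactly N elements.\<close>
    have refl: "rot_equiv (v n) (v n)" for n
      unfolding rot_equiv_def by (rule exI[of _ 0]) (simp add: v_def to_complex_rot)
    have inj: "inj_on v {1..N}"
    proof (rule inj_onI)
      fix n m assume nm: "n \<in> {1..N}" "m \<in> {1..N}" "v n = v m"
      show "n = m"
      proof (rule ccontr)
        assume "n \<noteq> m"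
        then have "n < m \<or> m < n" by auto
        then show False using distinct[of n m] distinct[of m n] nm refl[of n] by auto
      qed
    qed
    have "card (v ` {1..N}) = N" using card_image[OF inj] by simp
    moreover have "\<not> rot_equiv (v n) (v m)" if "n \<in> {1..N}" "m \<in> {1..N}" "v n \<noteq> v m" for n m
    proof -
      have "n < m \<or> m < n" using that by (cases n m rule: linorder_cases) auto
      then show ?thesis using distinct that by blast
    qed
    moreover have "henon_pos_solution \<alpha> p (v n)" if "n \<in> {1..N}" for n
      using w(1)[OF that] by (simp add: v_def)
    ultimately show "\<exists>S :: (real^2 \<Rightarrow> real) set. finite S \<and> card S \<ge> nat \<lceil>\<alpha> / 2\<rceil> \<and>
           (\<forall>u\<in>S. henon_pos_solution \<alpha> p u \<and> \<not> radial_on (ball 0 1) u) \<and>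
           (\<forall>u\<in>S. \<forall>v\<in>S. u \<noteq> v \<longrightarrow> \<not> rot_equiv u v)"
      using nonradial by (intro exI[of _ "v ` {1..N}"]) (auto simp: N_def)
  qed
qed

end
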